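(* Let $E$ be an elliptic function field defined over $\mathbb{F}_q$. Let $\mathrm{Aut}(E,O)$ be the stabilizer of the infinite place $O$ in $\mathrm{Aut}(E/\mathbb{F}_q)$, and let $T_E=\{\tau_Q : Q\in\mathbb{P}_E^1\}$ be the translation group of $E$. Then the automorphism group of $E$ over $\mathbb{F}_q$ is the (internal) semidirect product of the translation group $T_E$ and the stabilizer $\mathrm{Aut}(E,O)$: $$\mathrm{Aut}(E/\mathbb{F}_q)=T_E\rtimes \mathrm{Aut}(E,O).$$ The group law of $\mathrm{Aut}(E/\mathbb{F}_q)$ is given by $(\tau_P\alpha)\cdot(\tau_Q\beta)=\tau_{P\oplus\alpha(Q)}\cdot\alpha\beta$ for any $\tau_P,\tau_Q\in T_E$ and $\alpha,\beta\in\mathrm{Aut}(E,O)$.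
   Context: $\mathbb{F}_q$ is a finite field of characteristic $p$. An elliptic function field $E/\mathbb{F}_q$ is the function field $\mathbb{F}_q(x,y)$ of an elliptic curve over $\mathbb{F}_q$ given by a nonsingular Weierstrass equation; $O$ is the common pole of $x$ and $y$ (the infinite place). $\mathbb{P}_E^1$ is the set of rational (degree one) places of $E$; it is an abelian group with zero $O$ and with $P\oplus Q=R$ iff the divisors $P+Q$ and $R+O$ are linearly equivalent. $\mathrm{Aut}(E/\mathbb{F}_q)$ is the group of field automorphisms of $E$ fixing $\mathbb{F}_q$ elementwise, acting on places by $\sigma(P)=\{\sigma(z):z\in P\}$. $\mathrm{Aut}(E,O)=\{\sigma\in\mathrm{Aut}(E/\mathbb{F}_q):\sigma(O)=O\}$. For $Q\in\mathbb{P}_E^1$, $\tau_Q\in\mathrm{Aut}(E/\mathbb{F}_q)$ is the automorphism induced by translation by $Q$: its extension to the constant field extension $E\overline{\mathbb{F}}_q$ sends every rational place $P$ of $E\overline{\mathbb{F}}_q$ to $P\oplus Q$. *)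

theory Defs
  imports "HOL-Algebra.Algebra" "HOL-Algebra.Algebraic_Closure_Type"
begin

text \<open>
  Fields are subsets \<^term>\<open>F\<close> of a type of class \<^class>\<open>field\<close>, so that the library's carrier-based
  notions apply to \<^term>\<open>subring_of F\<close>. An elliptic function field is a whole type; its constant
  field extension is a subset of the type of its algebraic closure.
\<close>

abbreviation subring_of :: "'a::field set \<Rightarrow> 'a ring" where
  "subring_of F \<equiv> ring_of_type_algebra\<lparr>carrier := F\<rparr>"


section \<open>Places and divisors of a function field \<open>F/K\<close>\<close>

definition is_valuation_ring :: "'a::field set \<Rightarrow> 'a set \<Rightarrow> 'a set \<Rightarrow> bool" where
  "is_valuation_ring K F V \<longleftrightarrow>
     subring V ring_of_type_algebra \<and> K \<subset> V \<and> V \<subset> F \<and> (\<forall>z\<in>F. z \<in> V \<or> inverse z \<in> V)"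

definition places :: "'a::field set \<Rightarrow> 'a set \<Rightarrow> 'a set set" where
  "places K F = {P. \<exists>V. is_valuation_ring K F V \<and> maximalideal P (subring_of V)}"

text \<open>
  A valuation ring with maximal ideal \<^term>\<open>P\<close> consists of the \<^term>\<open>z\<close> with
  \<open>z\<^sup>-\<^sup>1 \<notin> P\<close>; zero is listed separately because \<^prop>\<open>inverse 0 = (0::'a::field)\<close>.
\<close>
definition place_ring :: "'a::field set \<Rightarrow> 'a set \<Rightarrow> 'a set" where
  "place_ring F P = {z \<in> F. z = 0 \<or> inverse z \<notin> P}"

definition residue_field :: "'a::field set \<Rightarrow> 'a set \<Rightarrow> 'a set ring" where
  "residue_field F P = subring_of (place_ring F P) Quot P"

text \<open>Degree one: the residue field has dimension 1 over the image of \<^term>\<open>K\<close> in it.\<close>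
definition rational_places :: "'a::field set \<Rightarrow> 'a set \<Rightarrow> 'a set set" where
  "rational_places K F = {P \<in> places K F.
     ring.dimension (residue_field F P) 1
       ((\<lambda>c. P +>\<^bsub>subring_of (place_ring F P)\<^esub> c) ` K) (carrier (residue_field F P))}"

text \<open>The value at 0 (mathematically \<open>\<infinity>\<close>) is unspecified.\<close>
definition place_val :: "'a::field set \<Rightarrow> 'a set \<Rightarrow> 'a \<Rightarrow> int" where
  "place_val F P z = (THE n. \<exists>t u. P = (\<lambda>w. t * w) ` place_ring F P
     \<and> u \<in> Units (subring_of (place_ring F P)) \<and> z = t powi n * u)"

definition linearly_equivalent ::
  "'a::field set \<Rightarrow> 'a set \<Rightarrow> ('a set \<Rightarrow>\<^sub>0 int) \<Rightarrow> ('a set \<Rightarrow>\<^sub>0 int) \<Rightarrow> bool" where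
  "linearly_equivalent K F A B \<longleftrightarrow>
     A \<in> carrier (free_Abelian_group (places K F)) \<and>
     B \<in> carrier (free_Abelian_group (places K F)) \<and>
     (\<exists>z\<in>F - {0}. \<forall>P\<in>places K F. Poly_Mapping.lookup (A - B) P = place_val F P z)"

definition infinite_place :: "'a::field set \<Rightarrow> 'a set \<Rightarrow> 'a \<Rightarrow> 'a \<Rightarrow> 'a set" where
  "infinite_place K F x y =
     (THE P. P \<in> places K F \<and> place_val F P x < 0 \<and> place_val F P y < 0)"

definition place_add ::
  "'a::field set \<Rightarrow> 'a set \<Rightarrow> 'a set \<Rightarrow> 'a set \<Rightarrow> 'a set \<Rightarrow> 'a set" where
  "place_add K F Inf_place P Q = (THE R. R \<in> rational_places K F \<and>
     linearly_equivalent K F (frag_of P + frag_of Q) (frag_of R + frag_of Inf_place))"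

definition field_auts :: "'a::field set \<Rightarrow> 'a set \<Rightarrow> ('a \<Rightarrow> 'a) set" where
  "field_auts K F = {\<sigma> \<in> ring_iso (subring_of F) (subring_of F). \<forall>c\<in>K. \<sigma> c = c}"


section \<open>Constant field extension\<close>

definition const_closure :: "'e::field set \<Rightarrow> 'e alg_closure set" where
  "const_closure K = {z. (ring.algebraic ring_of_type_algebra over (to_ac ` K)) z}"

definition const_ext :: "'e::field set \<Rightarrow> 'e alg_closure set" where
  "const_ext K = generate_field ring_of_type_algebra (range to_ac \<union> const_closure K)"


section \<open>Elliptic function fields\<close>

text \<open>
  Nonsingularity: no point of the affine curve over the algebraic closure of \<^term>\<open>K\<close> is a common
  zero of both partial derivatives. The point at infinity of a Weierstrass curve is always
  nonsingular.
\<close>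
definition nonsingular_weierstrass ::
  "'e::field set \<Rightarrow> 'e \<Rightarrow> 'e \<Rightarrow> 'e \<Rightarrow> 'e \<Rightarrow> 'e \<Rightarrow> bool" where
  "nonsingular_weierstrass K a1 a2 a3 a4 a6 \<longleftrightarrow>
     \<not> (\<exists>u\<in>const_closure K. \<exists>v\<in>const_closure K.
          v^2 + to_ac a1 * u * v + to_ac a3 * v
            = u^3 + to_ac a2 * u^2 + to_ac a4 * u + to_ac a6 \<and>
          to_ac a1 * v = 3 * u^2 + 2 * to_ac a2 * u + to_ac a4 \<and>
          2 * v + to_ac a1 * u + to_ac a3 = 0)"

text \<open>
  The type \<^typ>\<open>'e\<close> is the function field \<open>K(x, y)\<close>. As a Weierstrass polynomial is irreducible
  over \<open>K(x)\<close>, transcendence of \<^term>\<open>x\<close> makes \<open>K(x, y)\<close> the function field of the curve.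
\<close>
definition elliptic_function_field :: "'e::field set \<Rightarrow> 'e \<Rightarrow> 'e \<Rightarrow> bool" where
  "elliptic_function_field K x y \<longleftrightarrow>
     subfield K ring_of_type_algebra \<and> finite K \<and>
     (ring.transcendental ring_of_type_algebra over K) x \<and>
     generate_field ring_of_type_algebra (K \<union> {x, y}) = UNIV \<and>
     (\<exists>a1\<in>K. \<exists>a2\<in>K. \<exists>a3\<in>K. \<exists>a4\<in>K. \<exists>a6\<in>K.
        nonsingular_weierstrass K a1 a2 a3 a4 a6 \<and>
        y^2 + a1 * x * y + a3 * y = x^3 + a2 * x^2 + a4 * x + a6)"

abbreviation rat_places_E :: "'e::field set \<Rightarrow> 'e set set" where
  "rat_places_E K \<equiv> rational_places K UNIV"

abbreviation inf_E :: "'e::field set \<Rightarrow> 'e \<Rightarrow> 'e \<Rightarrow> 'e set" where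
  "inf_E K x y \<equiv> infinite_place K UNIV x y"

abbreviation add_E :: "'e::field set \<Rightarrow> 'e \<Rightarrow> 'e \<Rightarrow> 'e set \<Rightarrow> 'e set \<Rightarrow> 'e set" where
  "add_E K x y \<equiv> place_add K UNIV (inf_E K x y)"

definition aut_group :: "'e::field set \<Rightarrow> ('e \<Rightarrow> 'e) monoid" where
  "aut_group K = \<lparr>carrier = field_auts K UNIV, monoid.mult = (\<circ>), one = id\<rparr>"

definition aut_stabilizer :: "'e::field set \<Rightarrow> 'e \<Rightarrow> 'e \<Rightarrow> ('e \<Rightarrow> 'e) set" where
  "aut_stabilizer K x y = {\<sigma> \<in> field_auts K UNIV. \<sigma> ` inf_E K x y = inf_E K x y}"

text \<open>The place of the constant field extension lying over the rational place \<^term>\<open>Q\<close>.\<close>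
definition lift_place :: "'e::field set \<Rightarrow> 'e set \<Rightarrow> 'e alg_closure set" where
  "lift_place K Q =
     (THE Q'. Q' \<in> places (const_closure K) (const_ext K) \<and> to_ac ` Q \<subseteq> Q')"

text \<open>
  The extension of \<open>\<sigma>\<close> to the constant field extension is the one fixing the algebraic closure
  of \<^term>\<open>K\<close> elementwise. Only its values on \<^term>\<open>const_ext K\<close> matter.
\<close>
definition translation :: "'e::field set \<Rightarrow> 'e \<Rightarrow> 'e \<Rightarrow> 'e set \<Rightarrow> 'e \<Rightarrow> 'e" where
  "translation K x y Q = (THE \<sigma>. \<sigma> \<in> field_auts K UNIV \<and>
     (\<exists>\<sigma>' \<in> field_auts (const_closure K) (const_ext K).
        (\<forall>z. \<sigma>' (to_ac z) = to_ac (\<sigma> z)) \<and>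
        (\<forall>P \<in> rational_places (const_closure K) (const_ext K).
           \<sigma>' ` P = place_add (const_closure K) (const_ext K)
             (infinite_place (const_closure K) (const_ext K) (to_ac x) (to_ac y))
             P (lift_place K Q))))"

definition translation_group :: "'e::field set \<Rightarrow> 'e \<Rightarrow> 'e \<Rightarrow> ('e \<Rightarrow> 'e) set" where
  "translation_group K x y = translation K x y ` rat_places_E K"

definition internal_semidirect_product ::
  "('g, 'b) monoid_scheme \<Rightarrow> 'g set \<Rightarrow> 'g set \<Rightarrow> bool" where
  "internal_semidirect_product G N H \<longleftrightarrow>
     group G \<and> N \<lhd> G \<and> subgroup H G \<and> N <#>\<^bsub>G\<^esub> H = carrier G \<and> N \<inter> H = {\<one>\<^bsub>G\<^esub>}"

end

theory Submission
  imports Defs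
begin


text \<open>Write \<tau>_Q for the translation by Q. The group theory is short. An automorphism
  \<sigma> sends \<O> to a rational place P, as does \<tau>_P, so \<sigma> is \<tau>_P followed on
  the right by an automorphism fixing \<O> (\<open>decomposition\<close>). A translation fixing \<O>
  is \<tau>_\<O>, the identity. If \<alpha> fixes \<O>, it preserves linear equivalence and hence
  the addition of places, so \<alpha> \<tau>_Q = \<tau>_{\<alpha>(Q)} \<alpha>
  (\<open>tr_conj\<close>). With \<tau>_P \<tau>_Q = \<tau>_{P+Q} (\<open>tr_comp\<close>) this
  gives normality and the group law.

  The work lies in showing that translations exist and that the definite descriptions in the
  definitions denote.

  Existence: \<tau>_Q is a product of two involutions. The negation \<nu> fixes \<open>x\<close>, a
  function with a double pole at \<O>, so its fibres give P + \<nu>P ~ 2\<O>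
  (\<open>ex_negation\<close>). The lines through -Q define an involution \<iota> that swaps the two
  remaining intersection points with the curve; it fixes the slope, a function with simple poles at
  \<O> and Q, so P + \<iota>P ~ \<O> + Q (\<open>ex_chord_involution\<close>). Hence \<tau> =
  \<iota> \<nu> satisfies \<tau>P + \<O> ~ P + Q for every rational P
  (\<open>ex_translation_at\<close>). Both equivalences come from one statement on involutions,
  \<open>leq_involution\<close>.

  Uniqueness of sums: the genus enters only through \<open>no_simple_pole\<close>. If two rational
  places differed by a principal divisor, a translation would move the pole to \<O>, where no
  function has a single simple pole (\<open>leq_unique\<close>). So \<open>place_add\<close> is
  determined by linear equivalence.

  Uniqueness of translations: over the algebraically closed constant field there are enough rational
  places to determine an automorphism (\<open>aut_eqI\<close>). The formulas for \<tau>_Q have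
  coefficients in the base field, so they define compatible automorphisms below and above
  (\<open>ex_is_translation\<close>), and a rational place has exactly one place above it
  (\<open>ex1_lift\<close>).

  These arguments rest on the places of a Weierstrass function field: each is discrete
  (\<open>ex_uniformizer\<close>), \<open>x\<close> has exactly one pole (\<open>ex_pole\<close>,
  \<open>inf_unique\<close>), and the other rational places correspond to the affine points
  (\<open>at_unique\<close>, \<open>rational_at_ex\<close>). The locale \<open>wcurve\<close> holds
  this theory and is instantiated both for E and for its constant field extension.\<close>

section \<open>Subrings and subfields as sets, and polynomials over them\<close>

lemma rta_simps [simp]:
  "carrier (ring_of_type_algebra :: 'a::field ring) = UNIV"
  "monoid.mult (ring_of_type_algebra :: 'a::field ring) = (*)"
  "monoid.one (ring_of_type_algebra :: 'a::field ring) = 1"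
  "ring.zero (ring_of_type_algebra :: 'a::field ring) = 0"
  "ring.add (ring_of_type_algebra :: 'a::field ring) = (+)"
  by (simp_all add: ring_of_type_algebra_def)

lemma field_rta: "Ring.field (ring_of_type_algebra :: 'a::field ring)"
  by (rule field_from_type_algebra)

lemma a_inv_rta [simp]: "a_inv (ring_of_type_algebra :: 'a::field ring) z = - z"
proof -
  interpret R: Ring.field "ring_of_type_algebra :: 'a ring" by (rule field_rta)
  show ?thesis using R.minus_equality[of "- z" z] by simp
qed

lemma m_inv_rta [simp]: "z \<noteq> 0 \<Longrightarrow> m_inv (ring_of_type_algebra :: 'a::field ring) z = inverse z"
proof -
  assume z: "z \<noteq> 0"
  interpret R: Ring.field "ring_of_type_algebra :: 'a ring" by (rule field_rta)
  show ?thesis using R.inv_unique'[of z "inverse z"] z by simp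
qed

lemma subring_rta_iff:
  "subring V (ring_of_type_algebra :: 'a::field ring) \<longleftrightarrow>
     1 \<in> V \<and> (\<forall>a\<in>V. - a \<in> V) \<and> (\<forall>a\<in>V. \<forall>b\<in>V. a + b \<in> V \<and> a * b \<in> V)"
proof -
  interpret R: Ring.field "ring_of_type_algebra :: 'a ring" by (rule field_rta)
  show ?thesis
  proof
    assume "subring V (ring_of_type_algebra :: 'a::field ring)"
    from subringE[OF this] show "1 \<in> V \<and> (\<forall>a\<in>V. - a \<in> V) \<and> (\<forall>a\<in>V. \<forall>b\<in>V. a + b \<in> V \<and> a * b \<in> V)"
      by simp
  next
    assume "1 \<in> V \<and> (\<forall>a\<in>V. - a \<in> V) \<and> (\<forall>a\<in>V. \<forall>b\<in>V. a + b \<in> V \<and> a * b \<in> V)"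
    thus "subring V (ring_of_type_algebra :: 'a::field ring)"
      by (intro R.subringI) auto
  qed
qed

text \<open>Closure under \<open>inverse\<close> needs no exception at 0, because
  \<open>inverse 0 = 0\<close>.\<close>

definition set_field :: "'a::field set \<Rightarrow> bool" where
  "set_field K \<longleftrightarrow> 1 \<in> K \<and> (\<forall>a\<in>K. - a \<in> K \<and> inverse a \<in> K) \<and> (\<forall>a\<in>K. \<forall>b\<in>K. a + b \<in> K \<and> a * b \<in> K)"

lemma subfield_rta_iff: "subfield K (ring_of_type_algebra :: 'a::field ring) \<longleftrightarrow> set_field K"
proof -
  interpret R: Ring.field "ring_of_type_algebra :: 'a ring" by (rule field_rta)
  show ?thesis
  proof
    assume s: "subfield K (ring_of_type_algebra :: 'a ring)"
    have r: "subring K (ring_of_type_algebra :: 'a ring)" using subfieldE(1)[OF s] .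
    have "0 \<in> K" using subringE(2)[OF r] by simp
    moreover have "inverse a \<in> K" if "a \<in> K" "a \<noteq> 0" for a
      using R.subfield_m_inv(1)[OF s, of a] that by simp
    ultimately have "\<forall>a\<in>K. inverse a \<in> K" by (metis inverse_zero)
    thus "set_field K" using r unfolding subring_rta_iff set_field_def by blast
  next
    assume s: "set_field K"
    show "subfield K (ring_of_type_algebra :: 'a ring)"
      by (rule R.subfieldI') (use s in \<open>auto simp: subring_rta_iff set_field_def\<close>)
  qed
qed

text \<open>Kept apart from \<open>sfield\<close> for the coordinate ring \<open>Rxy\<close> and for
  the rings in the maximality argument of \<open>ex_pole\<close>.\<close>

locale sring =
  fixes K :: "'a::field set"
  assumes set_ring: "1 \<in> K" "\<And>a. a \<in> K \<Longrightarrow> - a \<in> K"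
    "\<And>a b. a \<in> K \<Longrightarrow> b \<in> K \<Longrightarrow> a + b \<in> K" "\<And>a b. a \<in> K \<Longrightarrow> b \<in> K \<Longrightarrow> a * b \<in> K"
begin

lemma one_mem [simp, intro]: "1 \<in> K"
  and uminus_mem [simp, intro]: "a \<in> K \<Longrightarrow> - a \<in> K"
  and add_mem [simp, intro]: "a \<in> K \<Longrightarrow> b \<in> K \<Longrightarrow> a + b \<in> K"
  and mult_mem [simp, intro]: "a \<in> K \<Longrightarrow> b \<in> K \<Longrightarrow> a * b \<in> K"
  using set_ring by auto

lemma zero_mem [simp, intro]: "0 \<in> K"
  using add_mem[OF one_mem uminus_mem[OF one_mem]] by simp

lemma diff_mem [simp, intro]: "a \<in> K \<Longrightarrow> b \<in> K \<Longrightarrow> a - b \<in> K"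
  using add_mem[of a "- b"] by simp

lemma power_mem [simp, intro]: "a \<in> K \<Longrightarrow> a ^ n \<in> K"
  by (induction n) auto

lemma of_nat_mem [simp, intro]: "of_nat n \<in> K"
  by (induction n) auto

lemma numeral_mem [simp, intro]: "numeral n \<in> K"
  using of_nat_mem[of "numeral n"] by simp

lemma sum_mem [intro]: "(\<And>i. i \<in> I \<Longrightarrow> f i \<in> K) \<Longrightarrow> sum f I \<in> K"
  by (induction I rule: infinite_finite_induct) auto

end

locale sfield =
  fixes K :: "'a::field set"
  assumes set_field: "set_field K"
begin

sublocale sring K
  by standard (use set_field in \<open>auto simp: set_field_def\<close>)

lemma inverse_mem [simp, intro]: "a \<in> K \<Longrightarrow> inverse a \<in> K"
  using set_field by (auto simp: set_field_def)

lemma divide_mem [simp, intro]: "a \<in> K \<Longrightarrow> b \<in> K \<Longrightarrow> a / b \<in> K"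
  by (simp add: divide_inverse)

lemma powi_mem [simp, intro]: "a \<in> K \<Longrightarrow> a powi n \<in> K"
  by (cases "n \<ge> 0") (auto simp: power_int_def)

end

text \<open>Polynomials of the full type with restricted coefficients: the type-based polynomial
  calculus applies while the constant field stays a set.\<close>

definition polys_over :: "'a::zero set \<Rightarrow> 'a poly set" where
  "polys_over K = {p. \<forall>i. Polynomial.coeff p i \<in> K}"

context sring
begin

lemma polys_over_0 [simp, intro]: "0 \<in> polys_over K"
  by (simp add: polys_over_def)

lemma polys_over_pCons [simp]: "pCons a p \<in> polys_over K \<longleftrightarrow> a \<in> K \<and> p \<in> polys_over K"
  by (auto simp: polys_over_def coeff_pCons split: nat.splits)

lemma polys_over_1 [simp, intro]: "1 \<in> polys_over K"
  by (simp add: one_pCons)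

lemma polys_over_add [simp, intro]: "p \<in> polys_over K \<Longrightarrow> q \<in> polys_over K \<Longrightarrow> p + q \<in> polys_over K"
  and polys_over_diff [simp, intro]: "p \<in> polys_over K \<Longrightarrow> q \<in> polys_over K \<Longrightarrow> p - q \<in> polys_over K"
  and polys_over_uminus [simp, intro]: "p \<in> polys_over K \<Longrightarrow> - p \<in> polys_over K"
  and polys_over_smult [simp, intro]: "a \<in> K \<Longrightarrow> p \<in> polys_over K \<Longrightarrow> Polynomial.smult a p \<in> polys_over K"
  by (auto simp: polys_over_def)

lemma polys_over_mult [simp, intro]: "p \<in> polys_over K \<Longrightarrow> q \<in> polys_over K \<Longrightarrow> p * q \<in> polys_over K"
  by (auto simp: polys_over_def coeff_mult intro!: sum_mem)

lemma polys_over_power [simp, intro]: "p \<in> polys_over K \<Longrightarrow> p ^ n \<in> polys_over K"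
  by (induction n) auto

lemma polys_over_monom [simp, intro]: "a \<in> K \<Longrightarrow> Polynomial.monom a n \<in> polys_over K"
  by (auto simp: polys_over_def)

lemma coeff_mem [simp, intro]: "p \<in> polys_over K \<Longrightarrow> Polynomial.coeff p i \<in> K"
  by (auto simp: polys_over_def)

lemma polys_over_induct [consumes 1, case_names 0 pCons]:
  assumes "p \<in> polys_over K" "P 0"
    "\<And>a p. a \<in> K \<Longrightarrow> p \<in> polys_over K \<Longrightarrow> pCons a p \<noteq> 0 \<Longrightarrow> P p \<Longrightarrow> P (pCons a p)"
  shows "P p"
  using assms(1)
proof (induction p)
  case (pCons a p)
  thus ?case using assms(3)[of a p] by (auto simp: pCons_eq_0_iff)
qed (simp add: assms(2))

lemma poly_mem:
  assumes "p \<in> polys_over K" "z \<in> R" "K \<subseteq> R"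
    "\<And>a b. a \<in> R \<Longrightarrow> b \<in> R \<Longrightarrow> a + b \<in> R" "\<And>a b. a \<in> R \<Longrightarrow> b \<in> R \<Longrightarrow> a * b \<in> R"
  shows "poly p z \<in> R"
  using assms(1) by (induction rule: polys_over_induct) (use assms zero_mem in \<open>auto intro!: assms(4,5)\<close>)

end

context sfield
begin

text \<open>Long division never leaves \<open>K\<close>: each new coefficient of the quotient is a
  quotient of leading coefficients.\<close>

lemma polys_over_division:
  assumes "p \<in> polys_over K" "g \<in> polys_over K" "g \<noteq> 0"
  shows "\<exists>q\<in>polys_over K. \<exists>r\<in>polys_over K. p = q * g + r \<and> (r = 0 \<or> Polynomial.degree r < Polynomial.degree g)"
  using assms(1)
proof (induction "Polynomial.degree p" arbitrary: p rule: less_induct)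
  case less
  show ?case
  proof (cases "p = 0 \<or> Polynomial.degree p < Polynomial.degree g")
    case True
    thus ?thesis using less.prems by (intro bexI[of _ 0] bexI[of _ p]) auto
  next
    case False
    define c where "c = Polynomial.monom (Polynomial.lead_coeff p / Polynomial.lead_coeff g) (Polynomial.degree p - Polynomial.degree g)"
    have c: "c \<in> polys_over K" using less.prems assms by (auto simp: c_def)
    define p' where "p' = p - c * g"
    have p': "p' \<in> polys_over K" using c less.prems assms by (simp add: p'_def)
    have lcp: "Polynomial.lead_coeff p \<noteq> 0" "Polynomial.lead_coeff g \<noteq> 0" using False assms by auto
    have dc: "Polynomial.degree c = Polynomial.degree p - Polynomial.degree g" using lcp by (simp add: c_def degree_monom_eq)
    have c0: "c \<noteq> 0" using lcp by (simp add: c_def)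
    have dcg: "Polynomial.degree (c * g) = Polynomial.degree p" using dc c0 assms False by (simp add: degree_mult_eq)
    have "Polynomial.coeff (c * g) (Polynomial.degree p) = Polynomial.lead_coeff c * Polynomial.lead_coeff g"
      using lead_coeff_mult[of c g] dcg by simp
    also have "\<dots> = Polynomial.lead_coeff p" using lcp dc by (simp add: c_def)
    finally have z: "Polynomial.coeff p' (Polynomial.degree p) = 0" by (simp add: p'_def)
    have dle: "Polynomial.degree p' \<le> Polynomial.degree p" unfolding p'_def using dcg by (intro degree_diff_le) auto
    have "\<exists>q\<in>polys_over K. \<exists>r\<in>polys_over K. p' = q * g + r \<and> (r = 0 \<or> Polynomial.degree r < Polynomial.degree g)"
    proof (cases "p' = 0 \<or> Polynomial.degree p' < Polynomial.degree p")
      case True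
      thus ?thesis
      proof
        assume "p' = 0" thus ?thesis by (intro bexI[of _ 0]) auto
      next
        assume "Polynomial.degree p' < Polynomial.degree p" from less.hyps[OF this p'] show ?thesis .
      qed
    next
      case False
      hence "Polynomial.degree p' = Polynomial.degree p" using dle by simp
      with z have "p' = 0" by (metis leading_coeff_0_iff)
      with False show ?thesis by simp
    qed
    then obtain q r where qr: "q \<in> polys_over K" "r \<in> polys_over K" "p' = q * g + r" "r = 0 \<or> Polynomial.degree r < Polynomial.degree g"
      by blast
    have "p = (q + c) * g + r" using qr(3) by (simp add: p'_def algebra_simps)
    thus ?thesis using qr c by (intro bexI[of _ "q + c"] bexI[of _ r]) auto
  qed
qed

lemma polys_over_root:
  assumes "p \<in> polys_over K" "a \<in> K" "poly p a = 0"
  shows "\<exists>q\<in>polys_over K. p = [:-a, 1:] * q"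
proof -
  obtain q r where qr: "q \<in> polys_over K" "p = q * [:-a, 1:] + r"
     "r = 0 \<or> Polynomial.degree r < Polynomial.degree [:-a, 1:]"
    using polys_over_division[of p "[:-a,1:]"] assms by fastforce
  then obtain c where c: "r = [:c:]" by (metis One_nat_def degree_eq_zeroE degree_pCons_eq_if less_one one_neq_zero pCons_eq_0_iff zero_less_one degree_0 gr0I less_nat_zero_code nat_neq_iff)
  have "c = 0" using assms(3) qr(2) c by simp
  thus ?thesis using qr c by (intro bexI[of _ q]) (auto simp: mult.commute)
qed

end

section \<open>Valuation rings and places in elementwise form\<close>

locale fpair = K: sfield K + F: sfield F for K F :: "'a::field set" +
  assumes KF: "K \<subseteq> F"
begin

lemma valuation_ring_iff:
  "is_valuation_ring K F V \<longleftrightarrow> 1 \<in> V \<and> (\<forall>a\<in>V. - a \<in> V) \<and> (\<forall>a\<in>V. \<forall>b\<in>V. a + b \<in> V \<and> a * b \<in> V) \<and>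
     K \<subset> V \<and> V \<subset> F \<and> (\<forall>z\<in>F. z \<in> V \<or> inverse z \<in> V)"
  by (auto simp: is_valuation_ring_def subring_rta_iff)

text \<open>The non-units form an ideal: of \<open>a / b\<close> and \<open>b / a\<close> one lies
  in \<open>V\<close>, so \<open>a + b\<close> is a multiple of \<open>b\<close> or of
  \<open>a\<close>. Every proper ideal consists of non-units, so this ideal is the only maximal
  one.\<close>

lemma maximalideal_valuation_ring:
  assumes "is_valuation_ring K F V"
  shows "maximalideal P (subring_of V) \<longleftrightarrow> P = {z \<in> V. z = 0 \<or> inverse z \<notin> V}"
proof -
  note V = assms[unfolded valuation_ring_iff]
  interpret R: Ring.field "ring_of_type_algebra :: 'a ring" by (rule field_rta)
  have sr: "subring V (ring_of_type_algebra :: 'a ring)" using assms by (simp add: is_valuation_ring_def)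
  interpret S: ring "subring_of V" using R.subring_is_ring[OF sr] .
  have a_inv: "a_inv (subring_of V) z = - z" if "z \<in> V" for z
    using S.minus_equality[of "- z" z] that V by simp
  let ?N = "{z \<in> V. z = 0 \<or> inverse z \<notin> V}"
  have Vadd: "a + b \<in> V" if "a \<in> V" "b \<in> V" for a b using V that by simp
  have V1: "1 \<in> V" using V by simp
  have VF: "V \<subseteq> F" using V by auto
  have Vcase: "z \<in> V \<or> inverse z \<in> V" if "z \<in> F" for z using V that by simp
  have V0: "0 \<in> V" using V by (metis add.right_inverse)
  have N_mult: "a * b \<in> ?N" if "a \<in> V" "b \<in> ?N" for a b
  proof (rule ccontr)
    assume "a * b \<notin> ?N"
    hence *: "a * b \<noteq> 0" "inverse (a * b) \<in> V" using that V by auto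
    hence "a * inverse (a * b) \<in> V" using that V by blast
    moreover have "a * inverse (a * b) = inverse b" using * by (simp add: field_simps)
    ultimately have "inverse b \<in> V" by metis
    thus False using that * by auto
  qed
  have N_add: "a + b \<in> ?N" if "a \<in> ?N" "b \<in> ?N" for a b
  proof (cases "a = 0 \<or> b = 0")
    case False
    have "a \<in> F" "b \<in> F" using that VF by auto
    hence "a / b \<in> F" by (rule F.divide_mem)
    hence "a / b \<in> V \<or> inverse (a / b) \<in> V" by (rule Vcase)
    hence "a / b \<in> V \<or> b / a \<in> V" by simp
    hence "(1 + a / b) * b \<in> ?N \<or> (1 + b / a) * a \<in> ?N"
    proof
      assume "a / b \<in> V"
      hence "1 + a / b \<in> V" using V1 Vadd by simp
      from N_mult[OF this that(2)] show ?thesis ..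
    next
      assume "b / a \<in> V"
      hence "1 + b / a \<in> V" using V1 Vadd by simp
      from N_mult[OF this that(1)] show ?thesis ..
    qed
    thus ?thesis using False by (auto simp: field_simps)
  qed (use that in auto)
  have N_ideal: "ideal ?N (subring_of V)"
  proof (rule idealI)
    show "subgroup ?N (add_monoid (subring_of V))"
    proof (rule S.add.subgroupI)
      show "?N \<noteq> {}" using V0 by auto
      show "\<ominus>\<^bsub>subring_of V\<^esub> a \<in> ?N" if "a \<in> ?N" for a
      proof -
        have "\<ominus>\<^bsub>subring_of V\<^esub> a = - a" using a_inv[of a] that by simp
        moreover have "- 1 * a \<in> ?N" by (rule N_mult[OF _ that]) (use V in simp)
        ultimately show ?thesis by simp
      qed
      show "a \<oplus>\<^bsub>subring_of V\<^esub> b \<in> ?N" if "a \<in> ?N" "b \<in> ?N" for a b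
        using N_add[OF that] by simp
    qed auto
  next
    show "r \<otimes>\<^bsub>subring_of V\<^esub> a \<in> ?N" "a \<otimes>\<^bsub>subring_of V\<^esub> r \<in> ?N"
      if "a \<in> ?N" "r \<in> carrier (subring_of V)" for a r
      using N_mult[of r a] that by (simp_all add: mult.commute)
  qed (rule S.ring_axioms)
  have proper: "I \<subseteq> ?N" if "ideal I (subring_of V)" "1 \<notin> I" for I
  proof
    fix z assume z: "z \<in> I"
    interpret I: ideal I "subring_of V" by fact
    have zV: "z \<in> V" using z I.a_subset by auto
    show "z \<in> ?N"
    proof (rule ccontr)
      assume "z \<notin> ?N" hence "z \<noteq> 0" "inverse z \<in> V" using zV by auto
      with I.I_l_closed[OF z, of "inverse z"] that(2) show False by simp
    qed
  qed
  show ?thesis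
  proof
    assume P: "maximalideal P (subring_of V)"
    then interpret P: maximalideal P "subring_of V" .
    have "1 \<notin> P" using P.one_imp_carrier P.I_notcarr by auto
    hence "P \<subseteq> ?N" using proper P.ideal_axioms by blast
    moreover have "1 \<notin> ?N" using V1 by simp
    hence "?N \<noteq> V" by (rule contrapos_nn) (erule ssubst, rule V1)
    ultimately show "P = ?N" using P.I_maximal[OF N_ideal] by auto
  next
    assume P: "P = ?N"
    show "maximalideal P (subring_of V)" unfolding P
    proof (rule maximalidealI[OF N_ideal])
      have "1 \<notin> ?N" using V1 by simp
      moreover have "1 \<in> carrier (subring_of V)" using V1 by simp
      ultimately show "carrier (subring_of V) \<noteq> ?N" by (metis (no_types, lifting))
      fix J assume J: "ideal J (subring_of V)" "?N \<subseteq> J" "J \<subseteq> carrier (subring_of V)"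
      show "J = ?N \<or> J = carrier (subring_of V)"
      proof (cases "1 \<in> J")
        case True thus ?thesis using ideal.one_imp_carrier[OF J(1)] by simp
      next
        case False thus ?thesis using proper[OF J(1)] J(2) by blast
      qed
    qed
  qed
qed

lemma places_iff:
  "P \<in> places K F \<longleftrightarrow> (\<exists>V. is_valuation_ring K F V \<and> P = {z \<in> V. z = 0 \<or> inverse z \<notin> V})"
  using maximalideal_valuation_ring by (auto simp: places_def)

lemma place_ring_eq:
  assumes "is_valuation_ring K F V" "P = {z \<in> V. z = 0 \<or> inverse z \<notin> V}"
  shows "place_ring F P = V"
proof -
  note V = assms(1)[unfolded valuation_ring_iff]
  have "0 \<in> V" using V by (metis add.right_inverse)
  thus ?thesis using V assms(2) unfolding place_ring_def by auto
qed

lemma place_valuation_ring: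
  assumes "P \<in> places K F"
  shows "is_valuation_ring K F (place_ring F P)"
    and "P = {z \<in> place_ring F P. z = 0 \<or> inverse z \<notin> place_ring F P}"
  using assms place_ring_eq unfolding places_iff by metis+

abbreviation Pl where "Pl \<equiv> places K F"
abbreviation V where "V \<equiv> place_ring F"

context
  fixes P assumes P: "P \<in> Pl"
begin

lemmas VR = place_valuation_ring(1)[OF P, unfolded valuation_ring_iff]
lemmas PR = place_valuation_ring(2)[OF P]

lemma P_iff: "z \<in> P \<longleftrightarrow> z \<in> V P \<and> (z = 0 \<or> inverse z \<notin> V P)"
  using PR by blast

lemma V_one [simp]: "1 \<in> V P"
  and V_uminus: "a \<in> V P \<Longrightarrow> - a \<in> V P"
  and V_add: "a \<in> V P \<Longrightarrow> b \<in> V P \<Longrightarrow> a + b \<in> V P"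
  and V_mult: "a \<in> V P \<Longrightarrow> b \<in> V P \<Longrightarrow> a * b \<in> V P"
  and V_cases: "a \<in> F \<Longrightarrow> a \<in> V P \<or> inverse a \<in> V P"
  using VR by simp_all

lemma K_V: "a \<in> K \<Longrightarrow> a \<in> V P"
  and V_F: "a \<in> V P \<Longrightarrow> a \<in> F"
  and V_psub: "\<exists>f\<in>F. f \<notin> V P"
  using VR unfolding psubset_eq by (elim conjE; auto)+

lemma V_diff: "a \<in> V P \<Longrightarrow> b \<in> V P \<Longrightarrow> a - b \<in> V P"
  using V_add[of a "- b"] V_uminus by simp

lemma V_zero [simp]: "0 \<in> V P" using K_V by blast

lemma V_power: "a \<in> V P \<Longrightarrow> a ^ n \<in> V P"
  by (induction n) (auto intro: V_mult)

lemma P_V: "a \<in> P \<Longrightarrow> a \<in> V P" using PR by blast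
lemma P_F: "a \<in> P \<Longrightarrow> a \<in> F" using P_V V_F by blast
lemma P_zero [simp]: "0 \<in> P" using V_zero by (simp add: P_iff)
lemma P_one [simp]: "1 \<notin> P" by (simp add: P_iff)
lemma notV: "a \<in> F \<Longrightarrow> a \<notin> V P \<Longrightarrow> inverse a \<in> P"
  using V_cases[of a] by (auto simp: P_iff)
lemma unitV: "a \<in> V P \<Longrightarrow> a \<notin> P \<Longrightarrow> inverse a \<in> V P \<and> inverse a \<notin> P \<and> a \<noteq> 0"
  by (auto simp: P_iff)
lemma P_inverse: "a \<in> P \<Longrightarrow> a \<noteq> 0 \<Longrightarrow> inverse a \<notin> V P"
  using PR by blast
lemma P_mult: "a \<in> V P \<Longrightarrow> b \<in> P \<Longrightarrow> a * b \<in> P"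
proof (rule ccontr)
  assume *: "a \<in> V P" "b \<in> P" "a * b \<notin> P"
  hence "inverse (a * b) \<in> V P" "a * b \<noteq> 0" using unitV[of "a * b"] V_mult P_V by blast+
  hence "a * inverse (a * b) \<in> V P" "b \<noteq> 0" "a \<noteq> 0" using * V_mult by auto
  moreover from this have "a * inverse (a * b) = inverse b" by (simp add: field_simps)
  ultimately show False using P_inverse[of b] * by metis
qed
lemma P_mult2: "a \<in> P \<Longrightarrow> b \<in> V P \<Longrightarrow> a * b \<in> P"
  using P_mult[of b a] by (simp add: mult.commute)
lemma P_uminus: "a \<in> P \<Longrightarrow> - a \<in> P"
  using P_mult[of "- 1" a] V_uminus by simp
lemma P_add: "a \<in> P \<Longrightarrow> b \<in> P \<Longrightarrow> a + b \<in> P"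
proof (rule ccontr)
  assume *: "a \<in> P" "b \<in> P" "a + b \<notin> P"
  hence u: "inverse (a + b) \<in> V P" "a + b \<noteq> 0" using unitV[of "a + b"] V_add P_V by blast+
  have nz: "a \<noteq> 0" "b \<noteq> 0" using * by auto
  have "a / b \<in> V P \<or> inverse (a / b) \<in> V P" using * P_F by (intro V_cases F.divide_mem) auto
  thus False
  proof
    assume "a / b \<in> V P"
    hence "(1 + a / b) * b \<in> P" using * by (intro P_mult V_add) auto
    moreover have "(1 + a / b) * b = a + b" using nz by (simp add: distrib_right)
    ultimately show False using * by metis
  next
    assume "inverse (a / b) \<in> V P"
    hence "(1 + inverse (a / b)) * a \<in> P" using * by (intro P_mult V_add) auto
    moreover have "(1 + inverse (a / b)) * a = a + b" using nz by (simp add: distrib_right)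
    ultimately show False using * by metis
  qed
qed
lemma P_diff: "a \<in> P \<Longrightarrow> b \<in> P \<Longrightarrow> a - b \<in> P"
  using P_add[of a "- b"] P_uminus by simp
lemma P_prime: "a \<in> V P \<Longrightarrow> b \<in> V P \<Longrightarrow> a * b \<in> P \<Longrightarrow> a \<in> P \<or> b \<in> P"
proof (rule ccontr)
  assume *: "a \<in> V P" "b \<in> V P" "a * b \<in> P" "\<not> (a \<in> P \<or> b \<in> P)"
  hence "inverse a * (a * b) \<in> P" using unitV P_mult by blast
  moreover have "a \<noteq> 0" using * P_zero by blast
  ultimately show False using * by (simp add: field_simps)
qed
lemma K_P: "c \<in> K \<Longrightarrow> c \<in> P \<Longrightarrow> c = 0"
  using P_inverse K_V K.inverse_mem by blast
lemma inverseP: "a \<in> P \<Longrightarrow> a \<noteq> 0 \<Longrightarrow> inverse a \<in> F \<and> inverse a \<notin> V P"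
  using P_inverse P_F by blast
lemma P_power: "a \<in> P \<Longrightarrow> n > 0 \<Longrightarrow> a ^ n \<in> P"
  by (induction n) (auto intro: P_mult2 P_V V_power)
lemma V_if_inverse_notP: "a \<in> F \<Longrightarrow> inverse a \<notin> P \<Longrightarrow> a \<in> V P"
  using notV by blast
lemma V_iff: "a \<in> V P \<longleftrightarrow> a \<in> F \<and> (a = 0 \<or> inverse a \<notin> P)"
  by (auto simp: place_ring_def)

lemma units_V: "u \<in> Units (subring_of (V P)) \<longleftrightarrow> u \<in> V P \<and> u \<notin> P"
proof
  assume "u \<in> Units (subring_of (V P))"
  then obtain w where "u \<in> V P" "w \<in> V P" "w * u = 1" by (auto simp: Units_def)
  thus "u \<in> V P \<and> u \<notin> P" using P_mult by fastforce
next
  assume "u \<in> V P \<and> u \<notin> P"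
  thus "u \<in> Units (subring_of (V P))" using unitV[of u]
    by (auto simp: Units_def intro!: bexI[of _ "inverse u"])
qed

end

lemma place_eqI: "P \<in> Pl \<Longrightarrow> Q \<in> Pl \<Longrightarrow> V P = V Q \<Longrightarrow> P = Q"
  using PR by blast

end


section \<open>Rational places and discrete valuations\<close>

context fpair
begin

context
  fixes P assumes P: "P \<in> Pl"
begin

text \<open>A one-dimensional residue field is a line over the image of \<open>K\<close>, and the
  class of 1 can be taken as its generator.\<close>

lemma rational_iff: "P \<in> rational_places K F \<longleftrightarrow> (\<forall>z\<in>V P. \<exists>c\<in>K. z - c \<in> P)"
proof -
  define S where "S = subring_of (V P)"
  interpret R0: Ring.field "ring_of_type_algebra :: 'a ring" by (rule field_rta)
  have "is_valuation_ring K F (V P)" using place_valuation_ring(1)[OF P] .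
  hence sr: "subring (V P) (ring_of_type_algebra :: 'a ring)" by (simp add: is_valuation_ring_def)
  interpret S: ring S unfolding S_def using R0.subring_is_ring[OF sr] .
  have "maximalideal P S" unfolding S_def
    using maximalideal_valuation_ring[OF place_valuation_ring(1)[OF P]] place_valuation_ring(2)[OF P] by simp
  then interpret I: ideal P S by (rule maximalideal.axioms(1))
  define R where "R = residue_field F P"
  have R_def': "R = S Quot P" by (simp add: R_def residue_field_def S_def)
  interpret R: ring R unfolding R_def' by (rule I.quotient_is_ring)
  have carrS: "carrier S = V P" by (simp add: S_def)
  have coset: "P +>\<^bsub>S\<^esub> a = (\<lambda>h. h + a) ` P" for a
    by (auto simp: a_r_coset_def' S_def)
  have coset_eq: "P +>\<^bsub>S\<^esub> a = P +>\<^bsub>S\<^esub> b \<longleftrightarrow> a - b \<in> P" for a b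
  proof
    assume "P +>\<^bsub>S\<^esub> a = P +>\<^bsub>S\<^esub> b"
    moreover have "a \<in> P +>\<^bsub>S\<^esub> a" unfolding coset using P_zero[OF P] by force
    ultimately obtain h where "h \<in> P" "a = h + b" unfolding coset by blast
    thus "a - b \<in> P" by simp
  next
    assume d: "a - b \<in> P"
    show "P +>\<^bsub>S\<^esub> a = P +>\<^bsub>S\<^esub> b" unfolding coset
    proof (intro Set.set_eqI iffI; elim imageE)
      fix x h assume "h \<in> P" "x = h + a"
      thus "x \<in> (\<lambda>h. h + b) ` P" using P_add[OF P _ d, of h]
        by (intro image_eqI[of _ _ "h + (a - b)"]) auto
    next
      fix x h assume "h \<in> P" "x = h + b"
      thus "x \<in> (\<lambda>h. h + a) ` P" using P_diff[OF P _ d, of h]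
        by (intro image_eqI[of _ _ "h - (a - b)"]) auto
    qed
  qed
  have carrR: "carrier R = (\<lambda>a. P +>\<^bsub>S\<^esub> a) ` V P"
    by (auto simp: R_def' FactRing_def A_RCOSETS_def' carrS)
  have multR: "(P +>\<^bsub>S\<^esub> a) \<otimes>\<^bsub>R\<^esub> (P +>\<^bsub>S\<^esub> b) = P +>\<^bsub>S\<^esub> (a * b)" if "a \<in> V P" "b \<in> V P" for a b
    using I.rcoset_mult_add[of a b] that by (simp add: R_def' FactRing_def S_def)
  have zeroR: "\<zero>\<^bsub>R\<^esub> = P" by (simp add: R_def' FactRing_def)
  define K' where "K' = (\<lambda>c. P +>\<^bsub>S\<^esub> c) ` K"
  have K'R: "K' \<subseteq> carrier R" using K_V[OF P] by (auto simp: K'_def carrR)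
  have "P \<in> rational_places K F \<longleftrightarrow> R.dimension 1 K' (carrier R)"
    using P by (simp add: rational_places_def R_def K'_def S_def)
  also have "\<dots> \<longleftrightarrow> (\<exists>v\<in>carrier R. v \<noteq> \<zero>\<^bsub>R\<^esub> \<and> carrier R = R.line_extension K' v {\<zero>\<^bsub>R\<^esub>})"
  proof
    assume "R.dimension 1 K' (carrier R)"
    thus "\<exists>v\<in>carrier R. v \<noteq> \<zero>\<^bsub>R\<^esub> \<and> carrier R = R.line_extension K' v {\<zero>\<^bsub>R\<^esub>}"
    proof (cases rule: R.dimension.cases)
      case (Suc_dim v E n)
      hence "R.dimension 0 K' E" by simp
      hence "E = {\<zero>\<^bsub>R\<^esub>}" by (cases rule: R.dimension.cases) auto
      thus ?thesis using Suc_dim by auto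
    qed auto
  next
    assume "\<exists>v\<in>carrier R. v \<noteq> \<zero>\<^bsub>R\<^esub> \<and> carrier R = R.line_extension K' v {\<zero>\<^bsub>R\<^esub>}"
    then obtain v where v: "v \<in> carrier R" "v \<noteq> \<zero>\<^bsub>R\<^esub>" "carrier R = R.line_extension K' v {\<zero>\<^bsub>R\<^esub>}" by blast
    have "R.dimension (Suc 0) K' (R.line_extension K' v {\<zero>\<^bsub>R\<^esub>})"
      by (rule R.dimension.Suc_dim) (use v in auto)
    thus "R.dimension 1 K' (carrier R)" using v(3) by simp
  qed
  also have "\<dots> \<longleftrightarrow> (\<exists>v\<in>carrier R. v \<noteq> \<zero>\<^bsub>R\<^esub> \<and> carrier R = {k \<otimes>\<^bsub>R\<^esub> v | k. k \<in> K'})"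
  proof -
    have "R.line_extension K' v {\<zero>\<^bsub>R\<^esub>} = {k \<otimes>\<^bsub>R\<^esub> v | k. k \<in> K'}" if v: "v \<in> carrier R" for v
    proof -
      have "k \<otimes>\<^bsub>R\<^esub> v \<oplus>\<^bsub>R\<^esub> \<zero>\<^bsub>R\<^esub> = k \<otimes>\<^bsub>R\<^esub> v" if "k \<in> K'" for k using that v K'R by auto
      thus ?thesis by (auto simp: R.line_extension_mem_iff)
    qed
    thus ?thesis by (intro bex_cong) auto
  qed
  also have "\<dots> \<longleftrightarrow> (\<forall>z\<in>V P. \<exists>c\<in>K. z - c \<in> P)"
  proof
    assume "\<exists>v\<in>carrier R. v \<noteq> \<zero>\<^bsub>R\<^esub> \<and> carrier R = {k \<otimes>\<^bsub>R\<^esub> v | k. k \<in> K'}"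
    then obtain a where a: "a \<in> V P" "carrier R = {k \<otimes>\<^bsub>R\<^esub> (P +>\<^bsub>S\<^esub> a) | k. k \<in> K'}" unfolding carrR by blast
    have *: "\<exists>k\<in>K. z - k * a \<in> P" if z: "z \<in> V P" for z
    proof -
      have "P +>\<^bsub>S\<^esub> z \<in> carrier R" using z by (simp add: carrR)
      then obtain k where k: "k \<in> K" "P +>\<^bsub>S\<^esub> z = (P +>\<^bsub>S\<^esub> k) \<otimes>\<^bsub>R\<^esub> (P +>\<^bsub>S\<^esub> a)" unfolding a(2) K'_def by blast
      hence "P +>\<^bsub>S\<^esub> z = P +>\<^bsub>S\<^esub> (k * a)" using multR[OF K_V[OF P k(1)] a(1)] by simp
      thus ?thesis using k(1) coset_eq by blast
    qed
    \<comment> \<open>The given generator is the class of some \<open>a\<close>; a constant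
      \<open>k0\<close> with \<open>k0 * a\<close> congruent to 1 rescales it to the class of
      1.\<close>
    obtain k0 where k0: "k0 \<in> K" "1 - k0 * a \<in> P" using *[of 1] V_one[OF P] by blast
    have k0n: "k0 \<noteq> 0" using k0 P_one[OF P] by auto
    show "\<forall>z\<in>V P. \<exists>c\<in>K. z - c \<in> P"
    proof
      fix z assume "z \<in> V P"
      then obtain k1 where k1: "k1 \<in> K" "z - k1 * a \<in> P" using * by blast
      have "z - k1 * a - (k1 / k0) * (1 - k0 * a) \<in> P"
        by (rule P_diff[OF P k1(2) P_mult[OF P K_V[OF P] k0(2)]]) (use k0 k1 in auto)
      also have "z - k1 * a - (k1 / k0) * (1 - k0 * a) = z - k1 / k0" using k0n by (simp add: field_simps)
      finally show "\<exists>c\<in>K. z - c \<in> P" using k0 k1 by blast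
    qed
  next
    assume *: "\<forall>z\<in>V P. \<exists>c\<in>K. z - c \<in> P"
    let ?v = "P +>\<^bsub>S\<^esub> 1"
    have "?v \<in> carrier R" using V_one[OF P] by (auto simp: carrR)
    moreover have "?v \<noteq> \<zero>\<^bsub>R\<^esub>"
    proof
      assume "?v = \<zero>\<^bsub>R\<^esub>"
      hence "(\<lambda>h. h + 1) ` P = P" unfolding zeroR coset .
      hence "0 + 1 \<in> P" using P_zero[OF P] by blast
      thus False using P_one[OF P] by simp
    qed
    moreover have "carrier R = {k \<otimes>\<^bsub>R\<^esub> ?v | k. k \<in> K'}"
    proof (intro Set.set_eqI iffI)
      fix w assume "w \<in> carrier R"
      then obtain z where z: "z \<in> V P" "w = P +>\<^bsub>S\<^esub> z" by (auto simp: carrR)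
      then obtain c where c: "c \<in> K" "z - c \<in> P" using * by blast
      hence "w = P +>\<^bsub>S\<^esub> (c * 1)" using z coset_eq by simp
      also have "\<dots> = (P +>\<^bsub>S\<^esub> c) \<otimes>\<^bsub>R\<^esub> ?v" using multR[of c 1] K_V[OF P c(1)] V_one[OF P] by simp
      finally show "w \<in> {k \<otimes>\<^bsub>R\<^esub> ?v | k. k \<in> K'}" using c(1) by (auto simp: K'_def)
    next
      fix w assume "w \<in> {k \<otimes>\<^bsub>R\<^esub> ?v | k. k \<in> K'}"
      thus "w \<in> carrier R" using K'R \<open>?v \<in> carrier R\<close> by auto
    qed
    ultimately show "\<exists>v\<in>carrier R. v \<noteq> \<zero>\<^bsub>R\<^esub> \<and> carrier R = {k \<otimes>\<^bsub>R\<^esub> v | k. k \<in> K'}" by blast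
  qed
  finally show ?thesis .
qed

lemma powi_unit: "u \<in> V P \<Longrightarrow> u \<notin> P \<Longrightarrow> u powi n \<in> V P \<and> u powi n \<notin> P"
proof -
  assume u: "u \<in> V P" "u \<notin> P"
  have *: "w ^ k \<in> V P \<and> w ^ k \<notin> P" if "w \<in> V P" "w \<notin> P" for w k
    by (induction k) (use that P_prime[OF P] V_mult[OF P] V_one[OF P] P_one[OF P] in auto)
  show ?thesis using *[OF u] *[of "inverse u"] unitV[OF P u] by (auto simp: power_int_def)
qed

lemma unit_mult: "u \<in> V P \<Longrightarrow> u \<notin> P \<Longrightarrow> w \<in> V P \<Longrightarrow> w \<notin> P \<Longrightarrow> u * w \<in> V P \<and> u * w \<notin> P"
  using P_prime[OF P] V_mult[OF P] by blast

lemma powi_P: "t \<in> P \<Longrightarrow> n > 0 \<Longrightarrow> t powi n \<in> P"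
  using P_power[OF P, of t "nat n"] by (auto simp: power_int_def)

lemma powi_unit_cases:
  assumes "t \<in> P" "t \<noteq> 0" "u \<in> V P" "u \<notin> P"
  shows "t powi n * u \<in> V P \<longleftrightarrow> n \<ge> 0" "t powi n * u \<in> P \<longleftrightarrow> n > 0"
proof -
  have un: "u \<noteq> 0" using assms P_zero[OF P] by blast
  have pos: "t powi n * u \<in> P" if "n > 0" using powi_P[OF assms(1) that] assms(3) by (rule P_mult2[OF P])
  have zero: "t powi n * u \<in> V P \<and> t powi n * u \<notin> P" if "n = 0" using that assms by simp
  have neg: "t powi n * u \<notin> V P" if "n < 0"
  proof -
    have "t powi (- n) * inverse u \<in> P" using powi_P[OF assms(1), of "- n"] that unitV[OF P assms(3,4)]
      by (intro P_mult2[OF P]) auto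
    moreover have "t powi (- n) * inverse u = inverse (t powi n * u)" using un assms by (simp add: power_int_minus)
    moreover have "t powi n * u \<noteq> 0" using un assms by simp
    ultimately show ?thesis using P_inverse[OF P, of "inverse (t powi n * u)"] by (metis inverse_inverse_eq inverse_nonzero_iff_nonzero)
  qed
  consider "n > 0" | "n = 0" | "n < 0" by linarith
  thus "t powi n * u \<in> V P \<longleftrightarrow> n \<ge> 0" "t powi n * u \<in> P \<longleftrightarrow> n > 0"
    using pos zero neg P_V[OF P] by (cases; force)+
qed

end

text \<open>For a place this says that its valuation ring is a discrete valuation ring with uniformizer \<open>t\<close>.\<close>
definition uniformizer :: "'a set \<Rightarrow> 'a \<Rightarrow> bool" where
  "uniformizer P t \<longleftrightarrow> t \<in> P \<and> t \<noteq> 0 \<and> (\<forall>f\<in>F - {0}. \<exists>n. \<exists>u\<in>V P - P. f = t powi n * u)"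

abbreviation v where "v \<equiv> place_val F"

context
  fixes P t assumes P: "P \<in> Pl" and t: "uniformizer P t"
begin

lemma t_P: "t \<in> P" and t_nz: "t \<noteq> 0" and t_rep: "f \<in> F \<Longrightarrow> f \<noteq> 0 \<Longrightarrow> \<exists>n. \<exists>u\<in>V P - P. f = t powi n * u"
  using t by (auto simp: uniformizer_def)

lemma uniformizer_generates: "P = (\<lambda>w. t * w) ` V P"
proof (intro Set.set_eqI iffI)
  fix f assume f: "f \<in> P"
  show "f \<in> (\<lambda>w. t * w) ` V P"
  proof (cases "f = 0")
    case False
    then obtain n u where nu: "u \<in> V P" "u \<notin> P" "f = t powi n * u" using t_rep[of f] P_F[OF P f] by blast
    hence "n > 0" using f powi_unit_cases(2)[OF P t_P t_nz nu(1,2)] by blast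
    hence "t powi (n - 1) * u \<in> V P" using powi_unit_cases(1)[OF P t_P t_nz nu(1,2)] by simp
    moreover have "f = t * (t powi (n - 1) * u)" using nu t_nz by (simp add: power_int_diff)
    ultimately show ?thesis by blast
  qed (use V_zero[OF P] in force)
next
  fix f assume "f \<in> (\<lambda>w. t * w) ` V P"
  thus "f \<in> P" using P_mult2[OF P t_P] by blast
qed

text \<open>Another generator of \<open>P\<close> differs from \<open>t\<close> by a unit, so the
  exponent does not depend on the generator. This makes the description in \<open>place_val\<close>
  denote.\<close>

lemma v_eqI: 
  assumes "u \<in> V P" "u \<notin> P"
  shows "v P (t powi n * u) = n"
  unfolding place_val_def
proof (rule the_equality)
  show "\<exists>t' u'. P = (\<lambda>w. t' * w) ` V P \<and> u' \<in> Units (subring_of (V P)) \<and> t powi n * u = t' powi n * u'"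
    using uniformizer_generates assms units_V[OF P] by blast
next
  fix m assume "\<exists>t' u'. P = (\<lambda>w. t' * w) ` V P \<and> u' \<in> Units (subring_of (V P)) \<and> t powi n * u = t' powi m * u'"
  then obtain t' u' where *: "P = (\<lambda>w. t' * w) ` V P" "u' \<in> V P" "u' \<notin> P" "t powi n * u = t' powi m * u'"
    using units_V[OF P] by blast
  obtain a where a: "a \<in> V P" "t = t' * a" using *(1) t_P by blast
  have "t' * 1 \<in> P" using *(1) V_one[OF P] by blast
  then obtain b where b: "b \<in> V P" "t' = t * b" using uniformizer_generates by auto
  have ab: "a * b = 1" using a b t_nz by (metis mult.assoc mult_cancel_left1)
  have bP: "b \<notin> P" using ab P_mult[OF P a(1)] P_one[OF P] by metis
  have "t powi n * u = t powi m * (b powi m * u')" using * b by (simp add: power_int_mult_distrib)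
  hence "t powi (n - m) * u = b powi m * u'" using t_nz by (simp add: power_int_diff field_simps)
  moreover have "b powi m * u' \<in> V P \<and> b powi m * u' \<notin> P"
    using powi_unit[OF P b(1) bP] unit_mult[OF P] * by blast
  ultimately have "n - m \<ge> 0" "\<not> n - m > 0" using powi_unit_cases[OF P t_P t_nz assms, of "n - m"] by auto
  thus "m = n" by simp
qed

end

text \<open>All the facts on \<^term>\<open>v P\<close> below only need some uniformizer.\<close>
definition discrete where "discrete P \<longleftrightarrow> P \<in> Pl \<and> (\<exists>t. uniformizer P t)"

context
  fixes P assumes D: "discrete P"
begin

lemma discrete_Pl: "P \<in> Pl" using D by (simp add: discrete_def)
lemmas P' = discrete_Pl

lemma ex_rep: "\<exists>t. t \<in> P \<and> t \<noteq> 0 \<and> v P t = 1 \<and> (\<forall>f\<in>F - {0}. \<exists>u\<in>V P - P. f = t powi v P f * u)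
    \<and> (\<forall>n u. u \<in> V P - P \<longrightarrow> v P (t powi n * u) = n)"
proof -
  obtain t where t: "uniformizer P t" using D by (auto simp: discrete_def)
  have "v P (t powi 1 * 1) = 1" by (rule v_eqI[OF P' t]) (use V_one P_one P' in auto)
  moreover have "\<exists>u\<in>V P - P. f = t powi v P f * u" if "f \<in> F - {0}" for f
    using t_rep[OF P' t, of f] that v_eqI[OF P' t] by auto
  ultimately show ?thesis using t_P[OF P' t] t_nz[OF P' t] v_eqI[OF P' t] by auto
qed

lemma v_uniformizer: "uniformizer P t \<Longrightarrow> v P t = 1"
  using v_eqI[OF P', of t 1 1] V_one[OF P'] P_one[OF P'] by simp

lemma V_iff_v: "f \<in> F \<Longrightarrow> f \<noteq> 0 \<Longrightarrow> f \<in> V P \<longleftrightarrow> v P f \<ge> 0"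
  and P_iff_v: "f \<in> F \<Longrightarrow> f \<noteq> 0 \<Longrightarrow> f \<in> P \<longleftrightarrow> v P f > 0"
proof -
  obtain t where t: "t \<in> P" "t \<noteq> 0" "\<forall>f\<in>F - {0}. \<exists>u\<in>V P - P. f = t powi v P f * u" using ex_rep by blast
  assume "f \<in> F" "f \<noteq> 0"
  then obtain u where "u \<in> V P" "u \<notin> P" "f = t powi v P f * u" using t(3) by blast
  thus "f \<in> V P \<longleftrightarrow> v P f \<ge> 0" "f \<in> P \<longleftrightarrow> v P f > 0" using powi_unit_cases[OF P' t(1,2)] by metis+
qed

lemma v_mult: "f \<in> F \<Longrightarrow> f \<noteq> 0 \<Longrightarrow> g \<in> F \<Longrightarrow> g \<noteq> 0 \<Longrightarrow> v P (f * g) = v P f + v P g"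
proof -
  obtain t where t: "t \<in> P" "t \<noteq> 0" "\<forall>f\<in>F - {0}. \<exists>u\<in>V P - P. f = t powi v P f * u"
     "\<forall>n u. u \<in> V P - P \<longrightarrow> v P (t powi n * u) = n" using ex_rep by blast
  assume "f \<in> F" "f \<noteq> 0" "g \<in> F" "g \<noteq> 0"
  then obtain u w where *: "u \<in> V P - P" "f = t powi v P f * u" "w \<in> V P - P" "g = t powi v P g * w" using t(3) by blast
  have "(t powi m * u) * (t powi n * w) = t powi (m + n) * (u * w)" for m n
    using t(2) by (simp add: power_int_add mult_ac)
  hence "f * g = t powi (v P f + v P g) * (u * w)"
    using *(2,4) by metis
  moreover have "u * w \<in> V P - P" using unit_mult[OF P'] *(1,3) by blast
  ultimately show ?thesis using t(4) by simp
qed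

lemma v_unit: "u \<in> V P \<Longrightarrow> u \<notin> P \<Longrightarrow> v P u = 0"
proof -
  assume u: "u \<in> V P" "u \<notin> P"
  have "u \<noteq> 0" using u P_zero[OF P'] by blast
  thus ?thesis using V_iff_v[of u] P_iff_v[of u] V_F[OF P' u(1)] u by auto
qed

lemma v_K: "c \<in> K \<Longrightarrow> c \<noteq> 0 \<Longrightarrow> v P c = 0"
  using v_unit K_V[OF P'] K_P[OF P'] by blast

lemma v_one [simp]: "v P 1 = 0" using v_K by simp

lemma v_inverse: "f \<in> F \<Longrightarrow> f \<noteq> 0 \<Longrightarrow> v P (inverse f) = - v P f"
  using v_mult[of f "inverse f"] by simp

lemma v_divide: "f \<in> F \<Longrightarrow> f \<noteq> 0 \<Longrightarrow> g \<in> F \<Longrightarrow> g \<noteq> 0 \<Longrightarrow> v P (f / g) = v P f - v P g"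
  using v_mult[of f "inverse g"] v_inverse[of g] by (simp add: divide_inverse)

lemma v_power: "f \<in> F \<Longrightarrow> f \<noteq> 0 \<Longrightarrow> v P (f ^ n) = int n * v P f"
  by (induction n) (auto simp: v_mult algebra_simps)

lemma v_uminus: "f \<in> F \<Longrightarrow> f \<noteq> 0 \<Longrightarrow> v P (- f) = v P f"
  using v_mult[of "- 1" f] v_K[of "- 1"] by simp

lemma v_add_ge:
  assumes "f \<in> F" "f \<noteq> 0" "g \<in> F" "g \<noteq> 0" "f + g \<noteq> 0" "v P f \<ge> n" "v P g \<ge> n"
  shows "v P (f + g) \<ge> n"
proof -
  have *: "v P (f + g) \<ge> v P f" if "f \<in> F" "f \<noteq> 0" "g \<in> F" "g \<noteq> 0" "f + g \<noteq> 0" "v P f \<le> v P g" for f g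
  proof -
    have "g / f \<in> V P" using V_iff_v[of "g / f"] v_divide[of g f] that by simp
    hence "1 + g / f \<in> V P" using V_add[OF P'] V_one[OF P'] by blast
    moreover have e: "f + g = f * (1 + g / f)" using that by (simp add: field_simps)
    moreover have nz: "1 + g / f \<noteq> 0" using e that by auto
    ultimately have "v P (f + g) = v P f + v P (1 + g / f)" "v P (1 + g / f) \<ge> 0"
      using v_mult[of f "1 + g / f"] that V_iff_v[of "1 + g / f"] by auto
    thus ?thesis by simp
  qed
  show ?thesis using *[of f g] *[of g f] assms by (cases "v P f \<le> v P g") (auto simp: add.commute)
qed

lemma v_add_less:
  assumes "f \<in> F" "f \<noteq> 0" "g \<in> F" "g = 0 \<or> v P f < v P g"
  shows "f + g \<noteq> 0" "v P (f + g) = v P f"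
proof -
  have "f + g \<noteq> 0 \<and> v P (f + g) = v P f"
  proof (cases "g = 0")
    case False
    have gf: "g / f \<in> P" using P_iff_v[of "g / f"] v_divide[of g f] assms False by simp
    have u: "1 + g / f \<in> V P" using gf by (intro V_add[OF P'] V_one[OF P'] P_V[OF P'])
    have uP: "1 + g / f \<notin> P" using P_diff[OF P' _ gf, of "1 + g / f"] P_one[OF P'] by auto
    have nz: "1 + g / f \<noteq> 0" using uP P_zero[OF P'] by metis
    have "f + g = f * (1 + g / f)" using assms by (simp add: field_simps)
    thus ?thesis using v_mult[of f "1 + g / f"] v_unit[OF u uP] nz assms by simp
  qed (use assms in auto)
  thus "f + g \<noteq> 0" "v P (f + g) = v P f" by auto
qed

lemma v_ex1: "\<exists>t\<in>P. t \<noteq> 0 \<and> v P t = 1" using ex_rep by blast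

end

lemma uniformizer_rep: 
  assumes "discrete P" "t \<in> F" "t \<noteq> 0" "v P t = 1" "f \<in> F" "f \<noteq> 0"
  shows "f * t powi (- v P f) \<in> V P" "f * t powi (- v P f) \<notin> P"
proof -
  have pw: "v P (t powi n) = n" for n
    using v_power[OF assms(1), of t] v_power[OF assms(1), of "inverse t"] v_inverse[OF assms(1), of t] assms
    by (auto simp: power_int_def)
  have F: "t powi n \<in> F" "t powi n \<noteq> 0" for n using assms by auto
  have "v P (f * t powi (- v P f)) = 0" using v_mult[OF assms(1,5,6) F] pw by simp
  moreover have "f * t powi (- v P f) \<in> F" "f * t powi (- v P f) \<noteq> 0" using F assms by auto
  ultimately show "f * t powi (- v P f) \<in> V P" "f * t powi (- v P f) \<notin> P"
    using V_iff_v[OF assms(1), of "f * t powi (- v P f)"] P_iff_v[OF assms(1), of "f * t powi (- v P f)"] by auto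
qed

end


section \<open>Weierstrass function fields: every place is discrete\<close>

text \<open>Common to the function field over the finite field and over its algebraic closure.
  Accordingly \<open>smooth\<close> speaks of \<open>K\<close>-points only, and
  \<open>separable\<close>, which follows from nonsingularity over the closure, is a separate
  assumption; it makes the negation differ from the identity. By \<open>rep\<close>, the field is
  spanned by 1 and \<open>y\<close> over \<open>K(x)\<close>.\<close>

locale wcurve = fpair K F for K F :: "'a::field set" +
  fixes x y a1 a2 a3 a4 a6 :: 'a
  assumes xF [simp, intro]: "x \<in> F" and yF [simp, intro]: "y \<in> F"
    and aK [simp, intro]: "a1 \<in> K" "a2 \<in> K" "a3 \<in> K" "a4 \<in> K" "a6 \<in> K"
    and curve: "y^2 + a1 * x * y + a3 * y = x^3 + a2 * x^2 + a4 * x + a6"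
    and x_trans: "p \<in> polys_over K \<Longrightarrow> poly p x = 0 \<Longrightarrow> p = 0"
    and rep: "f \<in> F \<Longrightarrow> \<exists>A\<in>polys_over K. \<exists>B\<in>polys_over K. \<exists>C\<in>polys_over K.
                C \<noteq> 0 \<and> f = (poly A x + poly B x * y) / poly C x"
    and smooth: "a \<in> K \<Longrightarrow> b \<in> K \<Longrightarrow> b^2 + a1 * a * b + a3 * b = a^3 + a2 * a^2 + a4 * a + a6 \<Longrightarrow>
                a1 * b = 3 * a^2 + 2 * a2 * a + a4 \<Longrightarrow> 2 * b + a1 * a + a3 = 0 \<Longrightarrow> False"
    and separable: "\<not> ((2::'a) = 0 \<and> a1 = 0 \<and> a3 = 0)"
begin

abbreviation "Kp \<equiv> polys_over K"

lemma K_F [simp, intro]: "c \<in> K \<Longrightarrow> c \<in> F" using KF by blast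

lemma poly_F [simp, intro]: "p \<in> Kp \<Longrightarrow> z \<in> F \<Longrightarrow> poly p z \<in> F"
  by (rule K.poly_mem) auto

lemma poly_x_nz: "p \<in> Kp \<Longrightarrow> p \<noteq> 0 \<Longrightarrow> poly p x \<noteq> 0"
  using x_trans by blast

definition Kx where "Kx = {poly p x / poly q x | p q. p \<in> Kp \<and> q \<in> Kp \<and> q \<noteq> 0}"

lemma Kx_I: "p \<in> Kp \<Longrightarrow> q \<in> Kp \<Longrightarrow> q \<noteq> 0 \<Longrightarrow> poly p x / poly q x \<in> Kx"
  by (auto simp: Kx_def)

lemma Kx_poly: "p \<in> Kp \<Longrightarrow> poly p x \<in> Kx"
  using Kx_I[of p 1] by simp

lemma set_field_Kx: "set_field Kx"
proof -
  have add: "f + g \<in> Kx" and mult: "f * g \<in> Kx" if fg: "f \<in> Kx" "g \<in> Kx" for f g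
  proof -
    obtain p q r s where *: "p \<in> Kp" "q \<in> Kp" "q \<noteq> 0" "f = poly p x / poly q x"
       "r \<in> Kp" "s \<in> Kp" "s \<noteq> 0" "g = poly r x / poly s x" using fg unfolding Kx_def by blast
    have nz: "poly q x \<noteq> 0" "poly s x \<noteq> 0" using * poly_x_nz by auto
    have "poly (p * s + r * q) x / poly (q * s) x \<in> Kx" using * by (intro Kx_I) auto
    moreover have "poly (p * s + r * q) x / poly (q * s) x = f + g"
      unfolding *(4) *(8) using nz by (simp add: add_frac_eq)
    ultimately show "f + g \<in> Kx" by metis
    have "poly (p * r) x / poly (q * s) x \<in> Kx" using * by (intro Kx_I) auto
    moreover have "poly (p * r) x / poly (q * s) x = f * g"
      unfolding *(4) *(8) by simp
    ultimately show "f * g \<in> Kx" by metis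
  qed
  have um: "- f \<in> Kx" and inv: "inverse f \<in> Kx" if f: "f \<in> Kx" for f
  proof -
    from f obtain p q where *: "p \<in> Kp" "q \<in> Kp" "q \<noteq> 0" "f = poly p x / poly q x" unfolding Kx_def by blast
    have "poly (- p) x / poly q x \<in> Kx" using * by (intro Kx_I) auto
    thus "- f \<in> Kx" unfolding *(4) by simp
    show "inverse f \<in> Kx"
    proof (cases "p = 0")
      case True
      thus ?thesis using Kx_poly[of 0] by (simp add: *(4))
    next
      case False
      have "poly q x / poly p x \<in> Kx" using * False by (intro Kx_I)
      thus ?thesis unfolding *(4) by simp
    qed
  qed
  have "1 \<in> Kx" using Kx_poly[of 1] by simp
  thus ?thesis using add mult um inv by (simp add: set_field_def)
qed

sublocale KX: sfield Kx by standard (rule set_field_Kx)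

lemma Kx_F: "f \<in> Kx \<Longrightarrow> f \<in> F" by (auto simp: Kx_def)

lemma rep2: "f \<in> F \<Longrightarrow> \<exists>\<alpha>\<in>Kx. \<exists>\<beta>\<in>Kx. f = \<alpha> + \<beta> * y"
proof -
  assume "f \<in> F"
  then obtain A B C where *: "A \<in> Kp" "B \<in> Kp" "C \<in> Kp" "C \<noteq> 0" "f = (poly A x + poly B x * y) / poly C x"
    using rep by blast
  hence "f = poly A x / poly C x + (poly B x / poly C x) * y" by (simp add: add_divide_distrib)
  thus ?thesis using * Kx_I by blast
qed

text \<open>The field has dimension at most two over \<open>K(x)\<close>, and the 2x2 minors of the
  coordinates are the coefficients of a relation. If all minors vanish, \<open>f1\<close> and
  \<open>f2\<close> alone are proportional.\<close>

lemma dep3: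
  assumes "f1 \<in> F" "f2 \<in> F" "f3 \<in> F" "f1 \<noteq> 0" "f2 \<noteq> 0" "f3 \<noteq> 0"
  shows "\<exists>c1\<in>Kx. \<exists>c2\<in>Kx. \<exists>c3\<in>Kx. (c1 \<noteq> 0 \<or> c2 \<noteq> 0 \<or> c3 \<noteq> 0) \<and> c1 * f1 + c2 * f2 + c3 * f3 = 0"
proof -
  obtain p1 q1 p2 q2 p3 q3 where *: "p1 \<in> Kx" "q1 \<in> Kx" "f1 = p1 + q1 * y" "p2 \<in> Kx" "q2 \<in> Kx" "f2 = p2 + q2 * y"
    "p3 \<in> Kx" "q3 \<in> Kx" "f3 = p3 + q3 * y" using rep2 assms(1-3) by metis
  define c1 c2 c3 where "c1 = p2 * q3 - p3 * q2" and "c2 = p3 * q1 - p1 * q3" and "c3 = p1 * q2 - p2 * q1"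
  have cK: "c1 \<in> Kx" "c2 \<in> Kx" "c3 \<in> Kx" using * by (auto simp: c1_def c2_def c3_def)
  have z: "c1 * f1 + c2 * f2 + c3 * f3 = 0" by (simp add: * c1_def c2_def c3_def algebra_simps)
  show ?thesis
  proof (cases "c1 = 0 \<and> c2 = 0 \<and> c3 = 0")
    case False thus ?thesis using z cK by blast
  next
    case True
    hence e: "p1 * q2 = p2 * q1" by (simp add: c3_def)
    have r: "q2 * f1 + (- q1) * f2 + 0 * f3 = 0" using e by (simp add: * algebra_simps)
    show ?thesis
    proof (cases "q1 = 0 \<and> q2 = 0")
      case False
      show ?thesis by (rule bexI[of _ q2], rule bexI[of _ "- q1"], rule bexI[of _ 0]) (use False r * in auto)
    next
      case True
      have "p2 * f1 + (- p1) * f2 + 0 * f3 = 0" using True by (simp add: *)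
      moreover have "p2 \<noteq> 0" using True assms * by auto
      ultimately show ?thesis using * by (intro bexI[of _ p2] bexI[of _ "- p1"] bexI[of _ 0]) auto
    qed
  qed
qed

context
  fixes P assumes P: "P \<in> Pl"
begin

lemma poly_V: "p \<in> Kp \<Longrightarrow> z \<in> V P \<Longrightarrow> poly p z \<in> V P"
  by (rule K.poly_mem) (auto intro: K_V[OF P] V_add[OF P] V_mult[OF P])

text \<open>\<open>y\<close> is integral over \<open>K[x]\<close>: at a pole of \<open>y\<close>
  where \<open>x\<close> is finite, dividing the equation by \<open>y^2\<close> would put 1 into
  \<open>P\<close>.\<close>

lemma y_V: "x \<in> V P \<Longrightarrow> y \<in> V P"
proof (rule ccontr)
  assume x: "x \<in> V P" and y: "y \<notin> V P"
  have yi: "inverse y \<in> P" using notV[OF P _ y] by simp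
  have yn: "y \<noteq> 0" using y V_zero[OF P] by blast
  have "1 = inverse y * (inverse y * (x^3 + a2 * x^2 + a4 * x + a6) - a1 * x - a3)"
  proof -
    have "inverse y * (inverse y * (y^2 + a1 * x * y + a3 * y) - a1 * x - a3) = 1"
      using yn by (simp add: field_simps power2_eq_square)
    thus ?thesis using curve by simp
  qed
  moreover have "inverse y * (inverse y * (x^3 + a2 * x^2 + a4 * x + a6) - a1 * x - a3) \<in> P"
    by (intro P_mult2[OF P yi] V_diff[OF P] V_mult[OF P] V_add[OF P] V_power[OF P] x P_V[OF P yi] K_V[OF P] aK)
  ultimately show False using P_one[OF P] by simp
qed

text \<open>The restriction of \<open>P\<close> to \<open>K(x)\<close> is discrete. If
  \<open>x\<close> has a pole, \<open>inverse x\<close> is a uniformizer there. Otherwise take a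
  polynomial \<open>g\<close> of least degree with \<open>poly g x\<close> in \<open>P\<close>: any
  other polynomial in \<open>x\<close> lying in \<open>P\<close> is divisible by \<open>g\<close>,
  since the remainder would have smaller degree.\<close>

lemma ex_pi: "\<exists>t\<in>P. t \<noteq> 0 \<and> (\<forall>k\<in>Kx - {0}. \<exists>n. \<exists>u\<in>V P - P. k = t powi n * u)"
proof -
  have red: "?thesis" if t: "t \<in> P" "t \<noteq> 0" and *: "\<And>p. p \<in> Kp \<Longrightarrow> p \<noteq> 0 \<Longrightarrow> \<exists>n. \<exists>u\<in>V P - P. poly p x = t powi n * u" for t
  proof -
    have "\<exists>n. \<exists>u\<in>V P - P. k = t powi n * u" if "k \<in> Kx - {0}" for k
    proof -
      have "k \<in> Kx" using that by simp
      then obtain p q where pq: "p \<in> Kp" "q \<in> Kp" "q \<noteq> 0" "k = poly p x / poly q x" unfolding Kx_def by blast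
      have "p \<noteq> 0" using pq that by auto
      then obtain n u m w where nu: "u \<in> V P - P" "poly p x = t powi n * u" "w \<in> V P - P" "poly q x = t powi m * w"
        using *[of p] *[of q] pq by blast
      have "k = t powi (n - m) * (u * inverse w)" using pq nu t by (simp add: power_int_diff divide_inverse)
      moreover have "u * inverse w \<in> V P - P" using unit_mult[OF P, of u "inverse w"] unitV[OF P, of w] nu by blast
      ultimately show ?thesis by blast
    qed
    thus ?thesis using t by blast
  qed
  show ?thesis
  proof (cases "x \<in> V P")
    case False
    have xi: "inverse x \<in> P" using notV[OF P _ False] by simp
    have xn: "x \<noteq> 0" using False V_zero[OF P] by blast
    have px: "\<exists>u\<in>V P - P. poly p x = inverse x powi (- int (Polynomial.degree p)) * u" if "p \<in> Kp" "p \<noteq> 0" for p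
      using that
    proof (induction rule: K.polys_over_induct)
      case (pCons a p)
      show ?case
      proof (cases "p = 0")
        case True
        thus ?thesis using pCons K_V[OF P, of a] K_P[OF P, of a] by (intro bexI[of _ a]) auto
      next
        case False
        then obtain u where u: "u \<in> V P" "u \<notin> P" "poly p x = inverse x powi (- int (Polynomial.degree p)) * u"
          using pCons by blast
        define d where "d = Polynomial.degree p"
        have px: "poly p x = x ^ d * u" using u(3) by (simp add: d_def power_int_minus power_inverse)
        have m: "a * inverse x ^ Suc d \<in> P" using P_mult[OF P K_V[OF P pCons(1)] P_power[OF P xi]] by blast
        have "u + a * inverse x ^ Suc d \<in> V P" using u m by (intro V_add[OF P] P_V[OF P m])
        moreover have "u + a * inverse x ^ Suc d \<notin> P" using P_diff[OF P _ m, of "u + a * inverse x ^ Suc d"] u by auto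
        moreover have "poly (pCons a p) x = inverse x powi (- int (Polynomial.degree (pCons a p))) * (u + a * inverse x ^ Suc d)"
        proof -
          have "inverse x powi (- int (Polynomial.degree (pCons a p))) = x ^ Suc d"
            using False by (simp add: d_def power_int_minus power_inverse del: power_Suc of_nat_Suc)
          moreover have "x ^ Suc d * (u + a * inverse x ^ Suc d) = x * (x ^ d * u) + a * (x ^ Suc d * inverse x ^ Suc d)"
            by (simp add: algebra_simps)
          moreover have "x ^ Suc d * inverse x ^ Suc d = 1" using xn by (simp only: power_mult_distrib[symmetric]) simp
          ultimately show ?thesis by (simp add: px)
        qed
        ultimately show ?thesis by blast
      qed
    qed simp
    show ?thesis
    proof (rule red[of "inverse x"])
      fix p assume "p \<in> Kp" "p \<noteq> 0"
      from px[OF this] show "\<exists>n. \<exists>u\<in>V P - P. poly p x = inverse x powi n * u" ..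
    qed (use xi xn in auto)
  next
    case True
    \<comment> \<open>If no nonzero polynomial in \<open>x\<close> lay in \<open>P\<close>, all
      denominators would be units and \<open>V P\<close> would be the whole field.\<close>
    have "\<exists>g. g \<in> Kp \<and> g \<noteq> 0 \<and> poly g x \<in> P"
    proof (rule ccontr)
      assume no: "\<not> ?thesis"
      have "f \<in> V P" if f: "f \<in> F" for f
      proof -
        obtain A B C where *: "A \<in> Kp" "B \<in> Kp" "C \<in> Kp" "C \<noteq> 0" "f = (poly A x + poly B x * y) / poly C x"
          using rep[OF f] by blast
        have "inverse (poly C x) \<in> V P" using no * unitV[OF P poly_V[OF _ True]] by blast
        thus ?thesis unfolding *(5) divide_inverse
          using * by (intro V_mult[OF P] V_add[OF P] poly_V True y_V)
      qed
      thus False using V_psub[OF P] by blast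
    qed
    then obtain g0 where g0: "g0 \<in> Kp \<and> g0 \<noteq> 0 \<and> poly g0 x \<in> P" ..
    obtain g where gg: "(g \<in> Kp \<and> g \<noteq> 0 \<and> poly g x \<in> P) \<and>
        (\<forall>h. h \<in> Kp \<and> h \<noteq> 0 \<and> poly h x \<in> P \<longrightarrow> Polynomial.degree g \<le> Polynomial.degree h)"
      by (rule exE[OF ex_has_least_nat[of "\<lambda>g. g \<in> Kp \<and> g \<noteq> 0 \<and> poly g x \<in> P", OF g0]])
    from gg have g: "g \<in> Kp" "g \<noteq> 0" "poly g x \<in> P" and
       gmin: "\<And>h. h \<in> Kp \<Longrightarrow> h \<noteq> 0 \<Longrightarrow> poly h x \<in> P \<Longrightarrow> Polynomial.degree g \<le> Polynomial.degree h"
      by simp_all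
    have deg: "Polynomial.degree g > 0"
    proof (rule ccontr)
      assume "\<not> Polynomial.degree g > 0"
      then obtain c where "g = [:c:]" by (metis degree_eq_zeroE gr0I)
      thus False using g K_P[OF P, of c] by auto
    qed
    have "\<exists>n. \<exists>u\<in>V P - P. poly p x = poly g x powi n * u" if "p \<in> Kp" "p \<noteq> 0" for p
      using that
    proof (induction "Polynomial.degree p" arbitrary: p rule: less_induct)
      case less
      show ?case
      proof (cases "poly p x \<in> P")
        case False
        thus ?thesis using poly_V[OF less.prems(1) True] by (intro exI[of _ 0] bexI[of _ "poly p x"]) auto
      next
        case pP: True
        obtain q r where qr: "q \<in> Kp" "r \<in> Kp" "p = q * g + r" "r = 0 \<or> Polynomial.degree r < Polynomial.degree g"
          using K.polys_over_division[OF less.prems(1) g(1,2)] by blast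
        have "poly p x - poly q x * poly g x \<in> P" using pP g qr by (intro P_diff[OF P] P_mult[OF P] poly_V True)
        hence "poly r x \<in> P" by (simp add: qr(3))
        hence "r = 0" using gmin[of r] qr by linarith
        hence p: "p = q * g" using qr by simp
        hence q0: "q \<noteq> 0" using less.prems by auto
        have "Polynomial.degree q < Polynomial.degree p" using p q0 g deg by (simp add: degree_mult_eq)
        then obtain n u where nu: "u \<in> V P - P" "poly q x = poly g x powi n * u" using less.hyps[of q] qr q0 by blast
        have "poly p x = poly g x powi (n + 1) * u" using p nu poly_x_nz[OF g(1,2)] by (simp add: power_int_add)
        thus ?thesis using nu by blast
      qed
    qed
    thus ?thesis using g poly_x_nz[OF g(1,2)] by (intro red[of "poly g x"])
  qed
qed

text \<open>In a vanishing sum the least value is attained twice. It is phrased by units because no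
  integer valuation is available at \<open>P\<close> yet.\<close>

lemma three_term:
  assumes "g1 \<in> F" "g2 \<in> F" "g3 \<in> F" "g1 + g2 + g3 = 0" "g1 \<noteq> 0" "g2 \<noteq> 0"
  shows "g1 / g2 \<in> V P - P \<or> (g3 \<noteq> 0 \<and> (g1 / g3 \<in> V P - P \<or> g2 / g3 \<in> V P - P))"
proof (cases "g3 = 0")
  case True
  hence "g1 / g2 = - 1" using assms by (simp add: field_simps eq_neg_iff_add_eq_0)
  moreover have "- 1 \<in> V P" using V_uminus[OF P V_one[OF P]] .
  moreover have "- 1 \<notin> P" using P_uminus[OF P, of "- 1"] P_one[OF P] by auto
  ultimately show ?thesis by simp
next
  case False
  have *: "b / c \<in> V P - P" if "a + b + c = 0" "a \<noteq> 0" "b \<noteq> 0" "c \<noteq> 0" "a / c \<in> P" for a b c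
  proof -
    have "b / c = - 1 - a / c" using that by (simp add: field_simps eq_neg_iff_add_eq_0)
    moreover have "- 1 - a / c \<in> V P" using V_diff[OF P V_uminus[OF P V_one[OF P]] P_V[OF P that(5)]] .
    moreover have "- 1 - a / c \<notin> P" 
    proof
      assume "- 1 - a / c \<in> P"
      from P_uminus[OF P P_add[OF P this that(5)]] show False using P_one[OF P] by simp
    qed
    ultimately show ?thesis by simp
  qed
  have "g1 / g2 \<in> F" "g2 / g1 \<in> F" using assms by auto
  then consider "g1 / g2 \<in> V P - P" | "g1 / g2 \<in> P" | "g2 / g1 \<in> P"
    using notV[OF P, of "g1 / g2"] by (metis DiffI inverse_divide)
  thus ?thesis
  proof cases
    case 2
    have "g3 / g2 \<in> V P - P" using *[of g1 g3 g2] 2 assms False by (simp add: add_ac)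
    thus ?thesis using unitV[OF P, of "g3 / g2"] False by simp
  next
    case 3
    have "g3 / g1 \<in> V P - P" using *[of g2 g3 g1] 3 assms False by (simp add: add_ac)
    thus ?thesis using unitV[OF P, of "g3 / g1"] False by simp
  qed auto
qed

text \<open>As \<open>F\<close> has degree two over \<open>K(x)\<close>, of any three elements two have the same value up to
  the value group of \<open>K(x)\<close>. This bounds the ramification index by two.\<close>

lemma two_associated:
  assumes t: "t \<in> P" "t \<noteq> 0" "\<And>k. k \<in> Kx - {0} \<Longrightarrow> \<exists>n. \<exists>u\<in>V P - P. k = t powi n * u"
  assumes f: "f1 \<in> F" "f2 \<in> F" "f3 \<in> F" "f1 \<noteq> 0" "f2 \<noteq> 0" "f3 \<noteq> 0"
  shows "\<exists>n. \<exists>u\<in>V P - P. f1 / f2 = t powi n * u \<or> f1 / f3 = t powi n * u \<or> f2 / f3 = t powi n * u"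
proof -
  obtain c1 c2 c3 where c: "c1 \<in> Kx" "c2 \<in> Kx" "c3 \<in> Kx" "c1 \<noteq> 0 \<or> c2 \<noteq> 0 \<or> c3 \<noteq> 0" "c1 * f1 + c2 * f2 + c3 * f3 = 0"
    using dep3[OF f] by blast
  have A: "\<exists>n. \<exists>u\<in>V P - P. f / g = t powi n * u"
    if "(c * f) / (d * g) \<in> V P - P" "c \<in> Kx" "d \<in> Kx" "c \<noteq> 0" "d \<noteq> 0" for c d f g
  proof -
    have "d / c \<in> Kx - {0}" using that(2-5) by simp
    from t(3)[OF this] obtain n u where nu: "u \<in> V P - P" "d / c = t powi n * u" by blast
    have "f / g = (d / c) * ((c * f) / (d * g))" using that by simp
    hence "f / g = t powi n * (u * ((c * f) / (d * g)))" using nu by simp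
    moreover have "u * ((c * f) / (d * g)) \<in> V P - P" using unit_mult[OF P, of u "(c * f) / (d * g)"] nu(1) that(1) by blast
    ultimately show ?thesis by blast
  qed
  have cF: "c1 * f1 \<in> F" "c2 * f2 \<in> F" "c3 * f3 \<in> F" using c f Kx_F by auto
  consider "c1 \<noteq> 0" "c2 \<noteq> 0" | "c1 \<noteq> 0" "c2 = 0" "c3 \<noteq> 0" | "c1 = 0" "c2 \<noteq> 0" "c3 \<noteq> 0"
    using c(4,5) f by (cases "c1 = 0"; cases "c2 = 0"; cases "c3 = 0"; simp)
  thus ?thesis
  proof cases
    case 1
    from three_term[OF cF c(5)] 1 f
    consider "(c1 * f1) / (c2 * f2) \<in> V P - P" | "c3 \<noteq> 0" "(c1 * f1) / (c3 * f3) \<in> V P - P" | "c3 \<noteq> 0" "(c2 * f2) / (c3 * f3) \<in> V P - P"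
      by fastforce
    thus ?thesis using A[of c1 f1 c2 f2] A[of c1 f1 c3 f3] A[of c2 f2 c3 f3] c 1 by cases blast+
  next
    case 2
    have "(c1 * f1) / (c3 * f3) \<in> V P - P" using three_term[OF cF(1,3,2)] c(5) 2 f by auto
    thus ?thesis using A[of c1 f1 c3 f3] c 2 by blast
  next
    case 3
    have "(c2 * f2) / (c3 * f3) \<in> V P - P" using three_term[OF cF(2,3,1)] c(5) 3 f by auto
    thus ?thesis using A[of c2 f2 c3 f3] c 3 by blast
  qed
qed

text \<open>If \<open>t\<close> does not divide all of \<open>P\<close>, there is \<open>s\<close>
  of value strictly between 0 and that of \<open>t\<close>, and such an \<open>s\<close> already
  generates \<open>P\<close>. An \<open>r\<close> in \<open>P\<close> not divisible by
  \<open>s\<close> would give \<open>s / r\<close>, \<open>r\<close> and \<open>s\<close> all of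
  value strictly between 0 and that of \<open>t\<close>, whereas \<open>two_associated\<close> makes
  one of them a power of \<open>t\<close> up to a unit.\<close>

lemma ex_generator:
  assumes t: "t \<in> P" "t \<noteq> 0" "\<And>k. k \<in> Kx - {0} \<Longrightarrow> \<exists>n. \<exists>u\<in>V P - P. k = t powi n * u"
  shows "\<exists>s\<in>P. s \<noteq> 0 \<and> (\<forall>r\<in>P. r / s \<in> V P)"
proof (cases "\<forall>s\<in>P. s / t \<in> V P")
  case True thus ?thesis using t by blast
next
  case False
  then obtain s where s: "s \<in> P" "s / t \<notin> V P" by blast
  have sn: "s \<noteq> 0" using s V_zero[OF P] by auto
  have ts: "t / s \<in> P" using notV[OF P _ s(2)] s t P_F[OF P] by (simp add: F.divide_mem)
  have notunits: False if "r \<in> P" "t / r \<in> P" "r = t powi n * u" "u \<in> V P - P" for r n u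
  proof -
    have "n > 0" using powi_unit_cases(2)[OF P t(1,2), of u n] that by auto
    hence "t powi (n - 1) * u \<in> V P" using powi_unit_cases(1)[OF P t(1,2), of u "n - 1"] that by auto
    hence "(t powi (n - 1) * u) * (t / r) \<in> P" using P_mult[OF P] that by blast
    moreover have "r \<noteq> 0" using that t P_zero[OF P] by auto
    hence "(t powi (n - 1) * u) * (t / r) = 1" using that(3) t by (simp add: power_int_diff field_simps)
    ultimately show False using P_one[OF P] by simp
  qed
  have "r / s \<in> V P" if r: "r \<in> P" for r
  proof (rule ccontr)
    assume rs: "r / s \<notin> V P"
    have rn: "r \<noteq> 0" using rs V_zero[OF P] by auto
    have sr: "s / r \<in> P" using notV[OF P _ rs] s r P_F[OF P] by (simp add: F.divide_mem)
    have tr: "t / r \<in> P" using P_mult[OF P P_V[OF P ts] sr] sn by simp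
    obtain n u where nu: "u \<in> V P - P" "r / s = t powi n * u \<or> r / 1 = t powi n * u \<or> s / 1 = t powi n * u"
      using two_associated[OF t, of r s 1] r s rn sn P_F[OF P] by fastforce
    from nu(2) consider "r / s = t powi n * u" | "r = t powi n * u" | "s = t powi n * u" by auto
    thus False
    proof cases
      case 1
      hence "s / r = t powi (- n) * inverse u" by (metis inverse_divide inverse_mult_distrib power_int_minus)
      moreover have "inverse u \<in> V P - P" using unitV[OF P] nu(1) by blast
      moreover have "t / (s / r) \<in> P" using P_mult[OF P P_V[OF P r] ts] by (simp add: mult.commute)
      ultimately show False using notunits[of "s / r"] sr by blast
    qed (use notunits[of r] notunits[of s] nu r s tr ts in blast)+
  qed
  thus ?thesis using s sn by blast
qed

text \<open>With a generator \<open>s\<close> of \<open>P\<close> at hand, what remains is the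
  archimedean property: no nonzero \<open>f\<close> is divisible by all powers of \<open>s\<close>.
  It holds because suitable powers of \<open>f\<close> and of \<open>s\<close> are powers of
  \<open>t\<close> up to units.\<close>

lemma ex_uniformizer: "\<exists>s. uniformizer P s"
proof -
  obtain t where t: "t \<in> P" "t \<noteq> 0" "\<And>k. k \<in> Kx - {0} \<Longrightarrow> \<exists>n. \<exists>u\<in>V P - P. k = t powi n * u"
    using ex_pi by blast
  obtain s where s: "s \<in> P" "s \<noteq> 0" "\<And>r. r \<in> P \<Longrightarrow> r / s \<in> V P" using ex_generator[OF t] by blast
  have sF: "s \<in> F" using s P_F[OF P] by blast
  \<comment> \<open>By \<open>two_associated\<close> for \<open>f ^ 2\<close>, \<open>f\<close> and
    1, either \<open>f\<close> or \<open>f ^ 2\<close> is a power of \<open>t\<close> up to a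
    unit.\<close>
  have power: "\<exists>k n u. k > 0 \<and> u \<in> V P - P \<and> f ^ k = t powi n * u" if f: "f \<in> F" "f \<noteq> 0" for f
  proof -
    obtain n u where nu: "u \<in> V P - P" "f ^ 2 / f = t powi n * u \<or> f ^ 2 / 1 = t powi n * u \<or> f / 1 = t powi n * u"
      using two_associated[OF t, of "f ^ 2" f 1] f by fastforce
    from nu(2) have "f ^ 1 = t powi n * u \<or> f ^ 2 = t powi n * u" using f by (auto simp: power2_eq_square)
    thus ?thesis using nu(1) by (metis zero_less_one zero_less_numeral)
  qed
  have V_rep: "\<exists>n. \<exists>u\<in>V P - P. f = s powi n * u" if f: "f \<in> V P" "f \<noteq> 0" for f
  proof (rule ccontr)
    assume no: "\<not> ?thesis"
    have div: "f / s ^ N \<in> V P" for N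
    proof (induction N)
      case (Suc N)
      have "f = s powi int N * (f / s ^ N)" using s by simp
      hence "f / s ^ N \<in> P" using no Suc by blast
      from s(3)[OF this] show ?case by (simp add: mult.commute)
    qed (use f in simp)
    obtain k m u where k: "k > 0" "u \<in> V P - P" "f ^ k = t powi m * u" using power f V_F[OF P] by blast
    obtain j i w where j: "j > 0" "w \<in> V P - P" "s ^ j = t powi i * w" using power[OF sF s(2)] by blast
    have i: "i > 0" using powi_unit_cases(2)[OF P t(1,2), of w i] j P_power[OF P s(1) j(1)] by auto
    \<comment> \<open>As a multiple of \<open>j\<close>, \<open>N\<close> makes \<open>s ^ N\<close>
      a power of \<open>t\<close> up to a unit; it is large enough for
      \<open>(f / s ^ N) ^ k\<close> to have a negative exponent.\<close>
    define N where "N = j * nat (\<bar>m\<bar> + 1)"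
    have "(f / s ^ N) ^ k \<in> V P" using V_power[OF P div] .
    moreover have "(f / s ^ N) ^ k = t powi (m - i * int (nat (\<bar>m\<bar> + 1) * k)) * (u * inverse (w ^ (nat (\<bar>m\<bar> + 1) * k)))"
    proof -
      have "(s ^ N) ^ k = (s ^ j) ^ (nat (\<bar>m\<bar> + 1) * k)" by (simp add: N_def power_mult[symmetric] mult_ac)
      also have "\<dots> = t powi (i * int (nat (\<bar>m\<bar> + 1) * k)) * w ^ (nat (\<bar>m\<bar> + 1) * k)"
        unfolding j(3) power_mult_distrib power_int_power' by simp
      finally have e: "(s ^ N) ^ k = t powi (i * int (nat (\<bar>m\<bar> + 1) * k)) * w ^ (nat (\<bar>m\<bar> + 1) * k)" .
      have gen: "(t powi m * u) / (t powi a * b) = t powi (m - a) * (u * inverse b)" for a b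
        using t(2) by (simp add: power_int_diff divide_inverse mult_ac)
      show ?thesis unfolding power_divide k(3) e gen ..
    qed
    moreover have "u * inverse (w ^ (nat (\<bar>m\<bar> + 1) * k)) \<in> V P - P"
    proof -
      have "w powi (- int (nat (\<bar>m\<bar> + 1) * k)) \<in> V P - P" using powi_unit[OF P] j(2) by blast
      hence "inverse (w ^ (nat (\<bar>m\<bar> + 1) * k)) \<in> V P - P" by (simp only: power_int_minus power_int_of_nat)
      thus ?thesis using unit_mult[OF P] k(2) by blast
    qed
    moreover define M where "M = i * int (nat (\<bar>m\<bar> + 1) * k)"
    ultimately have "m - M \<ge> 0" using powi_unit_cases(1)[OF P t(1,2)] by auto
    moreover have "M \<ge> 1 * (\<bar>m\<bar> + 1)" unfolding M_def
    proof (intro mult_mono)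
      show "\<bar>m\<bar> + 1 \<le> int (nat (\<bar>m\<bar> + 1) * k)" using k(1) mult_left_mono[of 1 "int k" "\<bar>m\<bar> + 1"] by simp
    qed (use i in auto)
    ultimately have "M \<le> m" "\<bar>m\<bar> < M" by simp_all
    thus False using abs_ge_self[of m] by (meson leD le_less_trans order_trans)
  qed
  have "\<exists>n. \<exists>u\<in>V P - P. f = s powi n * u" if f: "f \<in> F - {0}" for f
  proof (cases "f \<in> V P")
    case True thus ?thesis using V_rep f by blast
  next
    case False
    hence "inverse f \<in> V P" "inverse f \<noteq> 0" using notV[OF P] P_V[OF P] f by auto
    then obtain n u where nu: "u \<in> V P - P" "inverse f = s powi n * u" using V_rep by blast
    hence "f = s powi (- n) * inverse u" by (metis inverse_inverse_eq inverse_mult_distrib power_int_minus)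
    thus ?thesis using nu unitV[OF P, of u] by blast
  qed
  thus ?thesis using s unfolding uniformizer_def by blast
qed

lemma discrete: "discrete P" unfolding discrete_def using P ex_uniformizer by blast

end

end


section \<open>Existence of poles: Chevalley's extension argument\<close>

lemma (in sring) polys_over_reflect [simp, intro]:
  "p \<in> polys_over K \<Longrightarrow> reflect_poly p \<in> polys_over K"
  unfolding polys_over_def mem_Collect_eq by (auto simp: coeff_reflect_poly simp del: coeff_mem)

text \<open>Let \<open>b\<close> be the constant term of \<open>q\<close> and \<open>n\<close> the
  degree of \<open>p\<close>. Multiplied by \<open>z ^ n\<close>, the relation for \<open>q\<close>
  expresses \<open>(1 - w * b) * z ^ n\<close> by lower powers of \<open>z\<close>. Multiplying the
  relation for \<open>p\<close> by \<open>1 - w * b\<close> and substituting removes the leading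
  term of \<open>p\<close>.\<close>

lemma (in sring) degree_reduction:
  assumes "p \<in> polys_over K" "q \<in> polys_over K" "w \<in> K" "z \<noteq> 0"
    and "w * poly p z = 1" "w * poly q (inverse z) = 1"
    and "Polynomial.degree q \<le> Polynomial.degree p" "Polynomial.degree p > 0"
  shows "\<exists>r\<in>polys_over K. Polynomial.degree r < Polynomial.degree p \<and> w * poly r z = 1"
proof -
  define n where "n = Polynomial.degree p"
  obtain b q' where q: "q = pCons b q'" by (cases q)
  have bq: "b \<in> K" "q' \<in> polys_over K" using assms(2) q by auto
  define e where "e = 1 - w * b"
  define a where "a = Polynomial.coeff p n"
  define p1 where "p1 = p - Polynomial.monom a n"
  have aK: "a \<in> K" using assms(1) by (simp add: a_def)
  have p1: "p1 \<in> polys_over K" using assms(1) aK by (simp add: p1_def)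
  have p1d: "Polynomial.degree p1 < n"
  proof -
    have "Polynomial.degree p1 \<le> n" unfolding p1_def
      by (intro degree_diff_le) (auto simp: n_def degree_monom_le)
    moreover have "Polynomial.coeff p1 n = 0" by (simp add: p1_def a_def)
    ultimately show ?thesis using assms(8) leading_coeff_neq_0[of p1] unfolding n_def
      by (cases "p1 = 0"; cases "Polynomial.degree p1 = Polynomial.degree p") simp_all
  qed
  \<comment> \<open>\<open>r\<close> is \<open>z ^ (n - 1) * q'(1 / z)\<close> written as a
    polynomial in \<open>z\<close>.\<close>
  define r where "r = (if q' = 0 then 0 else Polynomial.monom 1 (n - 1 - Polynomial.degree q') * reflect_poly q')"
  have rK: "r \<in> polys_over K" using bq by (auto simp: r_def)
  have rd: "Polynomial.degree r < n" and rz: "poly r z * z = z ^ n * poly q' (inverse z)"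
  proof -
    show "Polynomial.degree r < n"
    proof (cases "q' = 0")
      case False
      hence d: "Polynomial.degree q' \<le> n - 1" "n > 0" using assms(7,8) q by (auto simp: n_def)
      have "Polynomial.degree r \<le> (n - 1 - Polynomial.degree q') + Polynomial.degree q'"
        using degree_mult_le[of "Polynomial.monom 1 (n - 1 - Polynomial.degree q') :: 'a poly" "reflect_poly q'"]
          degree_monom_le[of "1::'a" "n - 1 - Polynomial.degree q'"] degree_reflect_poly_le[of q'] False
        by (simp add: r_def)
      thus ?thesis using d by simp
    qed (use assms(8) n_def r_def in auto)
    show "poly r z * z = z ^ n * poly q' (inverse z)"
    proof (cases "q' = 0")
      case False
      hence d: "Polynomial.degree q' \<le> n - 1" "n > 0" using assms(7,8) q by (auto simp: n_def)
      have "poly r z * z = z ^ (n - 1 - Polynomial.degree q') * (z ^ Polynomial.degree q' * poly q' (inverse z)) * z"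
        using False assms(4) by (simp add: r_def poly_monom poly_reflect_poly_nz)
      also have "\<dots> = (z ^ (n - 1 - Polynomial.degree q') * z ^ Polynomial.degree q' * z) * poly q' (inverse z)"
        by (simp only: mult_ac)
      also have "z ^ (n - 1 - Polynomial.degree q') * z ^ Polynomial.degree q' * z = z ^ Suc (n - 1)"
        using d by (simp only: power_add[symmetric] power_Suc2) simp
      finally show ?thesis using d by simp
    qed (simp add: r_def)
  qed
  have "w * b + w * (inverse z * poly q' (inverse z)) = 1"
    using assms(6) by (simp add: q distrib_left)
  hence e1: "e = w * (inverse z * poly q' (inverse z))"
    by (simp add: e_def diff_eq_eq add.commute)
  have e2: "e * z ^ n = w * poly r z"
  proof -
    have "e * z ^ n = w * inverse z * (z ^ n * poly q' (inverse z))" unfolding e1 by (simp only: mult_ac)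
    also have "\<dots> = w * poly r z" using assms(4) unfolding rz[symmetric] by simp
    finally show ?thesis .
  qed
  \<comment> \<open>This is \<open>e * p\<close> with \<open>e * z ^ n\<close> replaced by
    \<open>w * r\<close>, plus \<open>b\<close>; since \<open>w * p(z) = 1\<close>, the value of
    \<open>w * p2\<close> at \<open>z\<close> is \<open>e + w * b = 1\<close>.\<close>
  define p2 where "p2 = [:b:] + Polynomial.smult e p1 + Polynomial.smult (a * w) r"
  have eK: "e \<in> K" using assms(3) bq by (simp add: e_def)
  have "p2 \<in> polys_over K" using bq eK p1 aK assms(3) rK by (simp add: p2_def)
  moreover have "Polynomial.degree p2 < n" unfolding p2_def
    using p1d rd assms(8) degree_smult_le[of e p1] degree_smult_le[of "a * w" r]
    by (intro degree_add_less) (auto simp: n_def intro: le_less_trans)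
  moreover have "w * poly p2 z = 1"
  proof -
    have p: "poly p z = poly p1 z + a * z ^ n" by (simp add: p1_def poly_monom)
    have "w * poly p2 z = w * b + w * e * poly p1 z + w * a * (w * poly r z)" by (simp add: p2_def algebra_simps)
    also have "\<dots> = w * b + e * (w * poly p z)" unfolding e2[symmetric] p by (simp add: algebra_simps)
    also have "\<dots> = 1" using assms(5) by (simp add: e_def)
    finally show ?thesis by simp
  qed
  ultimately show ?thesis unfolding n_def by blast
qed

text \<open>Infinite descent: \<open>degree_reduction\<close> lowers the larger of the two degrees,
  after exchanging \<open>z\<close> and \<open>inverse z\<close> if necessary, and a constant
  polynomial would put \<open>inverse w\<close> into \<open>K\<close>.\<close>

lemma (in sring) valuation_dichotomy:
  assumes "w \<in> K" "inverse w \<notin> K" "w \<noteq> 0" "z \<noteq> 0"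
    and "p \<in> polys_over K" "q \<in> polys_over K" "w * poly p z = 1" "w * poly q (inverse z) = 1"
  shows False
  using assms(4-8)
proof (induction "Polynomial.degree p + Polynomial.degree q" arbitrary: p q z rule: less_induct)
  case less
  have pos: "Polynomial.degree r > 0" if r: "r \<in> polys_over K" "w * poly r u = 1" for r u
  proof (rule ccontr)
    assume "\<not> Polynomial.degree r > 0"
    then obtain c where c: "r = [:c:]" by (metis degree_eq_zeroE gr0I)
    have "inverse w = c" using r(2) unfolding c by (intro inverse_unique) simp
    thus False using assms(2) r(1) unfolding c by simp
  qed
  show False
  proof (cases "Polynomial.degree q \<le> Polynomial.degree p")
    case True
    obtain r where r: "r \<in> polys_over K" "Polynomial.degree r < Polynomial.degree p" "w * poly r z = 1"
      using degree_reduction[OF less.prems(2,3) assms(1) less.prems(1,4,5) True pos[OF less.prems(2,4)]] by blast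
    show False by (rule less.hyps[OF _ less.prems(1) r(1) less.prems(3) r(3) less.prems(5)]) (use r(2) in simp)
  next
    case False
    have i: "inverse z \<noteq> 0" "w * poly p (inverse (inverse z)) = 1" using less.prems(1,4) by simp_all
    have le: "Polynomial.degree p \<le> Polynomial.degree q" using False by simp
    obtain r where r: "r \<in> polys_over K" "Polynomial.degree r < Polynomial.degree q" "w * poly r (inverse z) = 1"
      using degree_reduction[OF less.prems(3,2) assms(1) i(1) less.prems(5) i(2) le pos[OF less.prems(3,5)]] by blast
    show False by (rule less.hyps[OF _ less.prems(1,2) r(1) less.prems(4) r(3)]) (use r(2) in simp)
  qed
qed

lemma (in sring) sring_adjoin: "sring ((\<lambda>p. poly p z) ` polys_over K)"
proof
  show "1 \<in> (\<lambda>p. poly p z) ` polys_over K" by (rule image_eqI[of _ _ 1]) auto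
  fix a assume "a \<in> (\<lambda>p. poly p z) ` polys_over K"
  then obtain p where p: "p \<in> polys_over K" "a = poly p z" by blast
  thus "- a \<in> (\<lambda>p. poly p z) ` polys_over K" by (intro image_eqI[of _ _ "- p"]) auto
  fix b assume "b \<in> (\<lambda>p. poly p z) ` polys_over K"
  then obtain q where q: "q \<in> polys_over K" "b = poly q z" by blast
  show "a + b \<in> (\<lambda>p. poly p z) ` polys_over K" using p q by (intro image_eqI[of _ _ "p + q"]) auto
  show "a * b \<in> (\<lambda>p. poly p z) ` polys_over K" using p q by (intro image_eqI[of _ _ "p * q"]) auto
qed

text \<open>Every transcendental element has a pole: the valuation ring is a subring maximal among
  those in which \<open>inverse g\<close> is a non-unit.\<close>

lemma (in fpair) ex_pole:
  assumes g: "g \<in> F" "\<And>p. p \<in> polys_over K \<Longrightarrow> poly p g = 0 \<Longrightarrow> p = 0"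
  shows "\<exists>P\<in>Pl. g \<notin> V P"
proof -
  define w where "w = inverse g"
  have gn: "g \<noteq> 0" using g(2)[of "[:0, 1:]"] by auto
  hence wn: "w \<noteq> 0" "inverse w = g" and wg: "w * g = 1" by (auto simp: w_def)
  define \<S> where "\<S> = {S. sring S \<and> K \<subseteq> S \<and> S \<subseteq> F \<and> w \<in> S \<and> g \<notin> S}"
  define S0 where "S0 = (\<lambda>p. poly p w) ` polys_over K"
  have adj: "R \<subseteq> (\<lambda>p. poly p z) ` polys_over R" "z \<in> (\<lambda>p. poly p z) ` polys_over R" if "sring R" for R :: "'a set" and z
  proof -
    interpret R: sring R by fact
    show "R \<subseteq> (\<lambda>p. poly p z) ` polys_over R" by (auto intro!: image_eqI[of _ _ "[:_:]"])
    show "z \<in> (\<lambda>p. poly p z) ` polys_over R" by (rule image_eqI[of _ _ "[:0, 1:]"]) auto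
  qed
  have "g \<notin> S0"
  proof
    assume "g \<in> S0"
    then obtain p where p: "p \<in> polys_over K" "g = poly p w" unfolding S0_def by blast
    \<comment> \<open>From \<open>w * g = 1\<close> it follows that \<open>w\<close> is a root of
      \<open>q\<close>. The reversed polynomial then has the root \<open>g\<close>, against
      transcendence, as \<open>q\<close> has constant term 1.\<close>
    define q where "q = 1 - [:0, 1:] * p"
    have q: "q \<in> polys_over K" using p(1) by (auto simp: q_def)
    have "poly q w = 0" using wg by (simp add: q_def flip: p(2))
    hence "poly (reflect_poly q) g = 0" using gn by (simp add: poly_reflect_poly_nz w_def)
    hence "reflect_poly q = 0" using g(2) K.polys_over_reflect[OF q] by blast
    hence "q = 0" by simp
    hence "poly q 0 = 0" by simp
    thus False by (simp add: q_def)
  qed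
  moreover have "S0 \<subseteq> F" unfolding S0_def
    using g(1) KF by (auto simp: w_def intro!: K.poly_mem[of _ _ F])
  ultimately have "S0 \<in> \<S>" using adj[OF K.sring_axioms, of w] K.sring_adjoin[of w] by (auto simp: \<S>_def S0_def)
  have "\<exists>M\<in>\<S>. \<forall>N\<in>\<S>. M \<subseteq> N \<longrightarrow> N = M"
  proof (rule subset_Zorn_nonempty)
    show "\<S> \<noteq> {}" using \<open>S0 \<in> \<S>\<close> by blast
    fix \<C> assume C: "\<C> \<noteq> {}" "subset.chain \<S> \<C>"
    have CS: "S \<in> \<S>" if "S \<in> \<C>" for S using C(2) that by (auto simp: subset_chain_def)
    have two: "\<exists>S\<in>\<C>. a \<in> S \<and> b \<in> S" if ab: "a \<in> \<Union>\<C>" "b \<in> \<Union>\<C>" for a b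
    proof -
      obtain S T where "S \<in> \<C>" "a \<in> S" "T \<in> \<C>" "b \<in> T" using ab by blast
      moreover from this have "S \<subseteq> T \<or> T \<subseteq> S" using C(2) by (auto simp: subset_chain_def)
      ultimately show ?thesis by blast
    qed
    have CS': "sring S" "K \<subseteq> S" "S \<subseteq> F" "w \<in> S" "g \<notin> S" if "S \<in> \<C>" for S
      using CS[OF that] by (simp_all add: \<S>_def)
    obtain S0 where S0: "S0 \<in> \<C>" using C(1) by blast
    have "sring (\<Union>\<C>)"
    proof
      show "1 \<in> \<Union>\<C>" using sring.one_mem[OF CS'(1)[OF S0]] S0 by blast
      fix a assume a: "a \<in> \<Union>\<C>"
      then obtain S where "S \<in> \<C>" "a \<in> S" by blast
      thus "- a \<in> \<Union>\<C>" using sring.uminus_mem[OF CS'(1)] by blast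
      fix b assume b: "b \<in> \<Union>\<C>"
      obtain S where S: "S \<in> \<C>" "a \<in> S" "b \<in> S" using two[OF a b] by blast
      then interpret S: sring S using CS' by blast
      show "a + b \<in> \<Union>\<C>" "a * b \<in> \<Union>\<C>" using S S.add_mem S.mult_mem by blast+
    qed
    moreover have "K \<subseteq> \<Union>\<C>" "w \<in> \<Union>\<C>" using S0 CS'[OF S0] by blast+
    moreover have "g \<notin> \<Union>\<C>" "\<Union>\<C> \<subseteq> F" using CS' by blast+
    ultimately show "\<Union>\<C> \<in> \<S>" by (simp add: \<S>_def)
  qed
  then obtain M where M: "M \<in> \<S>" "\<And>N. N \<in> \<S> \<Longrightarrow> M \<subseteq> N \<Longrightarrow> N = M" by blast
  have MF: "K \<subseteq> M" "M \<subseteq> F" "w \<in> M" "g \<notin> M" using M(1) by (auto simp: \<S>_def)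
  interpret M: sring M using M(1) by (simp add: \<S>_def)
  \<comment> \<open>By maximality the ring \<open>M[z]\<close> must contain
    \<open>g = inverse w\<close>, which is a relation of the kind refuted by
    \<open>valuation_dichotomy\<close>.\<close>
  have ext: "\<exists>p\<in>polys_over M. w * poly p z = 1" if z: "z \<in> F" "z \<notin> M" for z
  proof -
    define N where "N = (\<lambda>p. poly p z) ` polys_over M"
    have "N \<subseteq> F" unfolding N_def using z MF by (auto intro!: M.poly_mem[of _ _ F])
    moreover have "sring N" unfolding N_def by (rule M.sring_adjoin)
    moreover have "M \<subseteq> N" "z \<in> N" unfolding N_def using adj[OF M.sring_axioms] by auto
    moreover have "N \<noteq> M" using z(2) \<open>z \<in> N\<close> by blast
    ultimately have "N \<notin> \<S>" using M(2)[of N] by blast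
    hence "g \<in> N" using \<open>N \<subseteq> F\<close> \<open>sring N\<close> \<open>M \<subseteq> N\<close> MF by (auto simp: \<S>_def)
    then obtain p where p: "p \<in> polys_over M" "g = poly p z" unfolding N_def by blast
    show ?thesis by (rule bexI[OF _ p(1)]) (use wg p(2) in simp)
  qed
  have vr: "z \<in> M \<or> inverse z \<in> M" if z: "z \<in> F" for z
  proof (rule ccontr)
    assume no: "\<not> (z \<in> M \<or> inverse z \<in> M)"
    obtain p q where "p \<in> polys_over M" "w * poly p z = 1" "q \<in> polys_over M" "w * poly q (inverse z) = 1"
      using ext[OF z] ext[OF F.inverse_mem[OF z]] no by blast
    moreover have "z \<noteq> 0" using no by auto
    ultimately show False using M.valuation_dichotomy[of w z p q] MF wn by simp
  qed
  have "w \<notin> K" using MF(1,4) wn(2) K.inverse_mem[of w] by auto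
  hence "K \<noteq> M" "M \<noteq> F" using MF g(1) by auto
  hence V: "is_valuation_ring K F M" unfolding valuation_ring_iff psubset_eq
    using MF vr by simp
  define P where "P = {z \<in> M. z = 0 \<or> inverse z \<notin> M}"
  have "V P = M" using place_ring_eq[OF V P_def] .
  moreover have "P \<in> Pl" unfolding places_iff by (intro exI[of _ M] conjI V P_def)
  ultimately show ?thesis using MF(4) by (intro bexI[of _ P]) simp_all
qed

section \<open>The place at infinity\<close>

context wcurve
begin

text \<open>The constant coefficient of a polynomial relation for \<open>h\<close> is a multiple of
  \<open>h\<close>, so it lies in \<open>P\<close> and in \<open>K\<close> and vanishes; then divide
  by \<open>h\<close> and repeat.\<close>

lemma h_trans:
  assumes "P \<in> Pl" "h \<in> P" "h \<noteq> 0"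
  shows "p \<in> Kp \<Longrightarrow> poly p h = 0 \<Longrightarrow> p = 0"
proof (induction p)
  case (pCons a p)
  have e: "a = - h * poly p h" using pCons.prems by (simp add: eq_neg_iff_add_eq_0)
  have "poly p h \<in> V P" using poly_V[OF assms(1)] P_V[OF assms(1,2)] pCons.prems by simp
  hence "a \<in> P" unfolding e using P_mult2[OF assms(1) P_uminus[OF assms(1,2)]] by blast
  hence "a = 0" using K_P[OF assms(1)] pCons.prems by auto
  moreover from this have "poly p h = 0" using e assms(3) by simp
  hence "p = 0" using pCons by auto
  ultimately show ?case by simp
qed simp

text \<open>Subtract the residue of \<open>f\<close> at \<open>Q\<close>. A nonzero difference would
  be a nonzero element of a place, hence transcendental by \<open>h_trans\<close>, and would have a
  pole by \<open>ex_pole\<close>.\<close>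

lemma no_poles_const:
  assumes "Q \<in> rational_places K F" "f \<in> F" "\<And>P. P \<in> Pl \<Longrightarrow> f \<in> V P"
  shows "f \<in> K"
proof -
  have Q: "Q \<in> Pl" using assms(1) by (simp add: rational_places_def)
  obtain c where c: "c \<in> K" "f - c \<in> Q" using rational_iff[OF Q] assms(1) assms(3)[OF Q] by blast
  have "f - c = 0"
  proof (rule ccontr)
    assume "f - c \<noteq> 0"
    from h_trans[OF Q c(2) this] obtain P where "P \<in> Pl" "f - c \<notin> V P"
      using ex_pole[of "f - c"] assms(2) c(1) by blast
    thus False using assms(3) V_diff K_V[OF _ c(1)] by blast
  qed
  thus ?thesis using c by simp
qed

text \<open>At a pole of \<open>z\<close> the leading term dominates.\<close>

lemma v_poly_neg:
  assumes "P \<in> Pl" "z \<in> F" "z \<notin> V P" "p \<in> Kp" "p \<noteq> 0"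
  shows "poly p z \<noteq> 0 \<and> v P (poly p z) = int (Polynomial.degree p) * v P z"
proof -
  note D = discrete[OF assms(1)]
  have zn: "z \<noteq> 0" using assms V_zero by blast
  have vz: "v P z < 0" using V_iff_v[OF D assms(2) zn] assms(3) by simp
  show ?thesis using assms(4,5)
  proof (induction rule: K.polys_over_induct)
    case (pCons a p)
    show ?case
    proof (cases "p = 0")
      case True
      thus ?thesis using pCons v_K[OF D, of a] by auto
    next
      case False
      hence IH: "poly p z \<noteq> 0" "v P (poly p z) = int (Polynomial.degree p) * v P z" using pCons by auto
      have zp: "z * poly p z \<in> F" "z * poly p z \<noteq> 0" using IH zn assms pCons by auto
      have v1: "v P (z * poly p z) = int (Suc (Polynomial.degree p)) * v P z"
        using v_mult[OF D assms(2) zn _ IH(1)] IH(2) assms pCons by (simp add: algebra_simps)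
      have "int (Suc (Polynomial.degree p)) * v P z < 0" by (rule mult_pos_neg[OF _ vz]) simp
      hence "a = 0 \<or> v P (z * poly p z) < v P a"
        using v_K[OF D pCons(1)] unfolding v1 by (cases "a = 0") simp_all
      from v_add_less[OF D zp _ this] pCons(1) v1 show ?thesis using False by (simp add: add.commute)
    qed
  qed simp
qed

text \<open>The pole order at infinity of \<open>A(x) + B(x) y\<close>, for \<open>x\<close> and
  \<open>y\<close> of pole orders 2 and 3.\<close>

definition "deg2 A B = (if B = 0 then 2 * Polynomial.degree A
   else if A = 0 then 2 * Polynomial.degree B + 3
   else max (2 * Polynomial.degree A) (2 * Polynomial.degree B + 3))"

context
  fixes P assumes P: "P \<in> Pl" and xP: "x \<notin> V P"
begin

lemmas D = discrete[OF P]

lemma x_nz: "x \<noteq> 0" using xP V_zero[OF P] by blast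

lemma y_nz: "y \<noteq> 0"
proof
  assume "y = 0"
  hence "poly [:a6, a4, a2, 1:] x = 0" using curve by (simp add: algebra_simps power2_eq_square power3_eq_cube)
  moreover have "[:a6, a4, a2, 1:] \<in> Kp" by simp
  ultimately have "[:a6, a4, a2, 1:] = 0" using x_trans by blast
  thus False by simp
qed

text \<open>The cubic in \<open>x\<close> has value \<open>3 * v P x\<close> and equals
  \<open>y * (y + a1 * x + a3)\<close>. If \<open>y\<close> had value at least that of
  \<open>x\<close>, the product would have value at least \<open>2 * v P x\<close>, too large; so
  \<open>y\<close> dominates in both factors.\<close>

lemma v_rel: "2 * v P y = 3 * v P x"
proof -
  have X: "v P x < 0" using V_iff_v[OF D xF x_nz] xP by simp
  define R where "R = poly [:a6, a4, a2, 1:] x"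
  have R: "R \<in> F" "R \<noteq> 0" "v P R = 3 * v P x"
    using v_poly_neg[OF P xF xP, of "[:a6, a4, a2, 1:]"] by (auto simp: R_def)
  have Ry: "R = y * (y + (a1 * x + a3))" using curve
    by (simp add: R_def algebra_simps power2_eq_square power3_eq_cube)
  define L where "L = a1 * x + a3"
  have L: "L \<in> F" "L = 0 \<or> v P L \<ge> v P x"
  proof -
    show "L \<in> F" by (simp add: L_def)
    have "L = poly [:a3, a1:] x" by (simp add: L_def algebra_simps)
    moreover have "[:a3, a1:] \<noteq> 0 \<Longrightarrow> v P (poly [:a3, a1:] x) \<ge> v P x"
      using v_poly_neg[OF P xF xP, of "[:a3, a1:]"] X by (auto split: if_splits)
    ultimately show "L = 0 \<or> v P L \<ge> v P x" by (cases "[:a3, a1:] = 0") auto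
  qed
  have yL: "y + L \<noteq> 0" using R(2) Ry by (auto simp: L_def)
  have vR: "v P R = v P y + v P (y + L)" unfolding Ry L_def[symmetric]
    using L by (intro v_mult[OF D] y_nz yL) auto
  show ?thesis
  proof (cases "v P y < v P x")
    case True
    hence "L = 0 \<or> v P y < v P L" using L by auto
    from v_add_less[OF D yF y_nz L(1) this] show ?thesis using vR R by simp
  next
    case False
    have "v P (y + L) \<ge> v P x"
    proof (cases "L = 0")
      case False
      show ?thesis by (rule v_add_ge[OF D]) (use L yL y_nz False \<open>\<not> v P y < v P x\<close> in auto)
    qed (use False in simp)
    thus ?thesis using vR R X False by linarith
  qed
qed

text \<open>\<open>2 * deg A\<close> is even and \<open>2 * deg B + 3\<close> is odd, so the two
  terms have different values and cannot cancel. The factor \<open>k\<close> is left open;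
  \<open>v_xy\<close> determines it from this lemma.\<close>

lemma v_AB_aux:
  assumes "k < 0" "v P x = 2 * k" "v P y = 3 * k"
  assumes AB: "A \<in> Kp" "B \<in> Kp" "A \<noteq> 0 \<or> B \<noteq> 0"
  shows "poly A x + poly B x * y \<noteq> 0 \<and> v P (poly A x + poly B x * y) = k * int (deg2 A B)"
proof -
  have A: "v P (poly A x) = int (2 * Polynomial.degree A) * k" "poly A x \<noteq> 0" if "A \<noteq> 0"
    using v_poly_neg[OF P xF xP AB(1) that] assms(2) by auto
  have B: "v P (poly B x * y) = int (2 * Polynomial.degree B + 3) * k" "poly B x * y \<noteq> 0" if "B \<noteq> 0"
    using v_poly_neg[OF P xF xP AB(2) that] assms(2,3) v_mult[OF D, of "poly B x" y] y_nz AB by (auto simp: algebra_simps)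
  have parity: "2 * Polynomial.degree A < 2 * Polynomial.degree B + 3 \<or> 2 * Polynomial.degree B + 3 < 2 * Polynomial.degree A"
    by presburger
  consider "B = 0" "A \<noteq> 0" | "A = 0" "B \<noteq> 0" | "A \<noteq> 0" "B \<noteq> 0" "2 * Polynomial.degree A < 2 * Polynomial.degree B + 3"
    | "A \<noteq> 0" "B \<noteq> 0" "2 * Polynomial.degree B + 3 < 2 * Polynomial.degree A"
    using AB(3) parity by blast
  thus ?thesis
  proof cases
    case 3
    have "v P (poly B x * y) < v P (poly A x)" using A B 3 assms(1) by (simp del: of_nat_add of_nat_mult)
    from v_add_less[OF D _ B(2) _ disjI2[OF this]] show ?thesis
      using 3 B AB by (simp add: deg2_def add.commute mult.commute del: of_nat_add of_nat_mult)
  next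
    case 4
    have "v P (poly A x) < v P (poly B x * y)" using A B 4 assms(1) by (simp del: of_nat_add of_nat_mult)
    from v_add_less[OF D _ A(2) _ disjI2[OF this]] show ?thesis
      using 4 A AB by (simp add: deg2_def mult.commute del: of_nat_add of_nat_mult)
  qed (use A B in \<open>auto simp: deg2_def\<close>)
qed

text \<open>By \<open>v_AB_aux\<close> every value at \<open>P\<close> is a multiple of
  \<open>k\<close>. As the value 1 occurs, \<open>k\<close> is -1.\<close>

lemma v_xy: "v P x = -2" "v P y = -3"
proof -
  have X: "v P x < 0" using V_iff_v[OF D xF x_nz] xP by simp
  have "even (v P x)" using v_rel by presburger
  then obtain k where k: "v P x = 2 * k" by blast
  hence k': "v P y = 3 * k" "k < 0" using v_rel X by auto
  have "k dvd v P f" if f: "f \<in> F" "f \<noteq> 0" for f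
  proof -
    obtain A B C where *: "A \<in> Kp" "B \<in> Kp" "C \<in> Kp" "C \<noteq> 0" "f = (poly A x + poly B x * y) / poly C x"
      using rep[OF f(1)] by blast
    have AB: "A \<noteq> 0 \<or> B \<noteq> 0" using f(2) *(5) by auto
    have "poly C x \<noteq> 0 \<and> v P (poly C x) = int (Polynomial.degree C) * v P x" using v_poly_neg[OF P xF xP *(3,4)] .
    hence "v P f = k * int (deg2 A B) - int (Polynomial.degree C) * (2 * k)"
      unfolding *(5) using v_AB_aux[OF k'(2) k k'(1) *(1,2) AB] * k
      by (subst v_divide[OF D]) auto
    thus ?thesis by simp
  qed
  moreover obtain t where "t \<in> P" "t \<noteq> 0" "v P t = 1" using v_ex1[OF D] by blast
  ultimately have "k dvd 1" using P_F[OF P] by metis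
  hence "k = -1" using k'(2) by (auto simp: zdvd1_eq)
  thus "v P x = -2" "v P y = -3" using k k' by auto
qed

lemma v_AB:
  assumes AB: "A \<in> Kp" "B \<in> Kp" "A \<noteq> 0 \<or> B \<noteq> 0"
  shows "poly A x + poly B x * y \<noteq> 0" "v P (poly A x + poly B x * y) = - int (deg2 A B)"
  using v_AB_aux[of "-1", OF _ _ _ AB] v_xy by auto

lemma v_ABC:
  assumes "A \<in> Kp" "B \<in> Kp" "A \<noteq> 0 \<or> B \<noteq> 0" "C \<in> Kp" "C \<noteq> 0"
  shows "v P ((poly A x + poly B x * y) / poly C x) = 2 * int (Polynomial.degree C) - int (deg2 A B)"
  using v_AB[OF assms(1-3)] v_poly_neg[OF P xF xP assms(4,5)] v_xy assms
  by (subst v_divide[OF D]) auto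

text \<open>For \<open>f\<close> of value 0 the polynomial \<open>A\<close> has the degree of
  \<open>C\<close> and dominates \<open>B(x) y\<close>; the ratio of the leading coefficients of
  \<open>A\<close> and \<open>C\<close> is the residue.\<close>

lemma rational_inf: "P \<in> rational_places K F"
  unfolding rational_iff[OF P]
proof
  fix f assume f: "f \<in> V P"
  show "\<exists>c\<in>K. f - c \<in> P"
  proof (cases "f \<in> P")
    case True thus ?thesis by (intro bexI[of _ 0]) auto
  next
    case False
    obtain A B C where *: "A \<in> Kp" "B \<in> Kp" "C \<in> Kp" "C \<noteq> 0" "f = (poly A x + poly B x * y) / poly C x"
      using rep[OF V_F[OF P f]] by blast
    have "f \<noteq> 0" using False P_zero[OF P] by blast
    hence AB: "A \<noteq> 0 \<or> B \<noteq> 0" using *(5) by auto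
    have "v P f = 0" using v_unit[OF D f False] .
    hence d: "deg2 A B = 2 * Polynomial.degree C" using v_ABC[OF *(1,2) AB *(3,4)] *(5) by simp
    hence A0: "A \<noteq> 0" "Polynomial.degree A = Polynomial.degree C" "B = 0 \<or> 2 * Polynomial.degree B + 3 < 2 * Polynomial.degree C"
      using AB unfolding deg2_def max_def by (auto split: if_splits) presburger+
    define c where "c = Polynomial.lead_coeff A / Polynomial.lead_coeff C"
    have c: "c \<in> K" using * by (simp add: c_def)
    define A' where "A' = A - Polynomial.smult c C"
    have A': "A' \<in> Kp" using * c by (simp add: A'_def)
    have fc: "f - c = (poly A' x + poly B x * y) / poly C x"
      using *(4,5) poly_x_nz[OF *(3,4)] by (simp add: A'_def field_simps)
    have dA': "A' = 0 \<or> Polynomial.degree A' < Polynomial.degree C"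
    proof -
      have "Polynomial.degree A' \<le> Polynomial.degree C" unfolding A'_def
        using A0 degree_smult_le[of c C] by (intro degree_diff_le) auto
      moreover have "Polynomial.coeff A' (Polynomial.degree C) = 0"
        using A0 *(4) by (simp add: A'_def c_def)
      ultimately show ?thesis by (metis le_neq_implies_less leading_coeff_0_iff)
    qed
    show ?thesis
    proof (cases "A' = 0 \<and> B = 0")
      case True thus ?thesis using fc c P_zero[OF P] by (intro bexI[of _ c]) auto
    next
      case False
      hence F': "A' \<noteq> 0 \<or> B \<noteq> 0" by blast
      have "deg2 A' B < 2 * Polynomial.degree C" using F' dA' A0(3) by (auto simp: deg2_def)
      hence "v P (f - c) > 0" unfolding fc using v_ABC[OF A' *(2) F' *(3,4)] by simp
      moreover have "f - c \<noteq> 0" unfolding fc using v_AB[OF A' *(2) F'] poly_x_nz[OF *(3,4)] by simp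
      ultimately have "f - c \<in> P" using P_iff_v[OF D, of "f - c"] V_F[OF P f] c by auto
      thus ?thesis using c by blast
    qed
  qed
qed

end

text \<open>\<open>v_ABC\<close> computes values at a pole of \<open>x\<close> from data that do not
  mention the place.\<close>

lemma inf_unique:
  assumes "P \<in> Pl" "x \<notin> V P" "Q \<in> Pl" "x \<notin> V Q"
  shows "P = Q"
proof (rule place_eqI[OF assms(1,3)])
  have "v P f = v Q f" if f: "f \<in> F" "f \<noteq> 0" for f
  proof -
    obtain A B C where *: "A \<in> Kp" "B \<in> Kp" "C \<in> Kp" "C \<noteq> 0" "f = (poly A x + poly B x * y) / poly C x"
      using rep[OF f(1)] by blast
    have AB: "A \<noteq> 0 \<or> B \<noteq> 0" using f(2) *(5) by auto
    show ?thesis using v_ABC[OF assms(1,2) *(1,2) AB *(3,4)] v_ABC[OF assms(3,4) *(1,2) AB *(3,4)] *(5) by simp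
  qed
  thus "V P = V Q" using V_iff_v[OF discrete[OF assms(1)]] V_iff_v[OF discrete[OF assms(3)]] V_F assms V_zero
    by (intro Set.set_eqI) metis
qed

definition "\<O> = infinite_place K F x y"

lemma inf_place: "\<O> \<in> Pl" "x \<notin> V \<O>"
proof -
  obtain P where P: "P \<in> Pl" "x \<notin> V P" using ex_pole[OF xF x_trans] by blast
  have "\<O> = P" unfolding \<O>_def infinite_place_def
  proof (rule the_equality)
    show "P \<in> Pl \<and> v P x < 0 \<and> v P y < 0" using P v_xy[OF P] by simp
    fix Q assume Q: "Q \<in> Pl \<and> v Q x < 0 \<and> v Q y < 0"
    have "x \<noteq> 0" using x_nz[OF P] .
    hence "x \<notin> V Q" using Q V_iff_v[OF discrete, of Q x] by auto
    thus "Q = P" using inf_unique Q P by blast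
  qed
  thus "\<O> \<in> Pl" "x \<notin> V \<O>" using P by auto
qed

lemmas v_inf = v_xy[OF inf_place]
lemmas O_rational = rational_inf[OF inf_place]
lemma inf_eqI: "P \<in> Pl \<Longrightarrow> x \<notin> V P \<Longrightarrow> P = \<O>" using inf_unique inf_place by blast

end


section \<open>Affine points and the places above them\<close>

context wcurve
begin

text \<open>The affine coordinate ring \<open>K[x, y]\<close>.\<close>

definition Rxy where "Rxy = {poly A x + poly B x * y | A B. A \<in> Kp \<and> B \<in> Kp}"

lemma Rxy_I: "A \<in> Kp \<Longrightarrow> B \<in> Kp \<Longrightarrow> poly A x + poly B x * y \<in> Rxy"
  by (auto simp: Rxy_def)

lemma y_square: "y * y = poly [:a6, a4, a2, 1:] x - poly [:a3, a1:] x * y"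
  using curve by (simp add: algebra_simps power2_eq_square power3_eq_cube)

sublocale Rxy: sring Rxy
proof
  show "1 \<in> Rxy" using Rxy_I[of 1 0] by simp
  fix f assume "f \<in> Rxy"
  then obtain A B where f: "A \<in> Kp" "B \<in> Kp" "f = poly A x + poly B x * y" unfolding Rxy_def by blast
  show "- f \<in> Rxy" using Rxy_I[of "- A" "- B"] f by simp
  fix g assume "g \<in> Rxy"
  then obtain C D where g: "C \<in> Kp" "D \<in> Kp" "g = poly C x + poly D x * y" unfolding Rxy_def by blast
  have "poly (A + C) x + poly (B + D) x * y \<in> Rxy" using f g by (intro Rxy_I) auto
  thus "f + g \<in> Rxy" using f g by (simp add: algebra_simps)
  have "poly (A * C + B * D * [:a6, a4, a2, 1:]) x + poly (A * D + B * C - B * D * [:a3, a1:]) x * y \<in> Rxy"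
    using f g by (intro Rxy_I) auto
  moreover have "f * g = poly A x * poly C x + (poly A x * poly D x + poly B x * poly C x) * y + poly B x * poly D x * (y * y)"
    unfolding f(3) g(3) by (simp add: algebra_simps)
  hence "f * g = poly (A * C + B * D * [:a6, a4, a2, 1:]) x + poly (A * D + B * C - B * D * [:a3, a1:]) x * y"
    unfolding y_square by (simp add: algebra_simps)
  ultimately show "f * g \<in> Rxy" by simp
qed

lemma Rxy_F: "f \<in> Rxy \<Longrightarrow> f \<in> F" by (auto simp: Rxy_def)
lemma Rxy_poly: "p \<in> Kp \<Longrightarrow> poly p x \<in> Rxy" using Rxy_I[of p 0] by simp
lemma Rxy_K: "c \<in> K \<Longrightarrow> c \<in> Rxy" using Rxy_poly[of "[:c:]"] by simp
lemma Rxy_x: "x \<in> Rxy" using Rxy_poly[of "[:0, 1:]"] by simp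
lemma Rxy_y: "y \<in> Rxy" using Rxy_I[of 0 1] by simp

lemma Rxy_rep: "f \<in> F \<Longrightarrow> \<exists>G\<in>Rxy. \<exists>H\<in>Rxy. H \<noteq> 0 \<and> f = G / H"
  using rep Rxy_I Rxy_poly poly_x_nz by metis

text \<open>\<open>P\<close> is centred at the affine point \<open>(a, b)\<close>.\<close>

definition place_at :: "'a set \<Rightarrow> 'a \<Rightarrow> 'a \<Rightarrow> bool" where
  "place_at P a b \<longleftrightarrow> P \<in> Pl \<and> a \<in> K \<and> b \<in> K \<and> x - a \<in> P \<and> y - b \<in> P"

lemma at_V: assumes "place_at P a b" shows "x \<in> V P" "y \<in> V P"
proof -
  have P: "P \<in> Pl" "a \<in> K" "b \<in> K" "x - a \<in> P" "y - b \<in> P" using assms by (auto simp: place_at_def)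
  have "(x - a) + a \<in> V P" "(y - b) + b \<in> V P"
    using V_add[OF P(1) P_V[OF P(1)] K_V[OF P(1)]] P by blast+
  thus "x \<in> V P" "y \<in> V P" by simp_all
qed

lemma Rxy_V: "P \<in> Pl \<Longrightarrow> x \<in> V P \<Longrightarrow> f \<in> Rxy \<Longrightarrow> f \<in> V P"
  using y_V[of P] by (auto simp: Rxy_def intro!: V_add V_mult poly_V)

lemma poly_root_diff:
  assumes "p \<in> Kp" "a \<in> K"
  shows "\<exists>q\<in>Kp. \<forall>z. poly p z - poly p a = (z - a) * poly q z"
proof -
  have "poly p a \<in> K" using assms by (auto intro!: K.poly_mem[of _ _ K])
  hence "p - [:poly p a:] \<in> Kp" using assms by auto
  then obtain q where q: "q \<in> Kp" "p - [:poly p a:] = [:- a, 1:] * q"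
    using K.polys_over_root[of "p - [:poly p a:]" a] assms by auto
  have "poly p z - poly p a = (z - a) * poly q z" for z
    using arg_cong[OF q(2), of "\<lambda>p. poly p z"] by (simp add: algebra_simps)
  thus ?thesis using q(1) by blast
qed

text \<open>First order expansion at \<open>(a, b)\<close>: since \<open>y\<close> occurs only
  linearly, the coefficient of \<open>y - b\<close> can be taken constant.\<close>

lemma Rxy_decomp:
  assumes "a \<in> K" "b \<in> K" "f \<in> Rxy"
  shows "\<exists>g\<in>Rxy. \<exists>\<beta>\<in>K. \<exists>c\<in>K. f = (x - a) * g + \<beta> * (y - b) + c"
proof -
  obtain A B where f: "A \<in> Kp" "B \<in> Kp" "f = poly A x + poly B x * y" using assms(3) unfolding Rxy_def by blast
  obtain A1 where A1: "A1 \<in> Kp" "poly A x - poly A a = (x - a) * poly A1 x" using poly_root_diff[OF f(1) assms(1)] by blast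
  obtain B1 where B1: "B1 \<in> Kp" "poly B x - poly B a = (x - a) * poly B1 x" using poly_root_diff[OF f(2) assms(1)] by blast
  have k: "poly A a \<in> K" "poly B a \<in> K" using f assms by (auto intro!: K.poly_mem[of _ _ K])
  have "f = (poly A x - poly A a) + (poly B x - poly B a) * y + poly B a * (y - b) + (poly A a + poly B a * b)"
    unfolding f(3) by (simp add: algebra_simps)
  hence "f = (x - a) * (poly A1 x + poly B1 x * y) + poly B a * (y - b) + (poly A a + poly B a * b)"
    unfolding A1(2) B1(2) by (simp add: algebra_simps)
  moreover have "poly A1 x + poly B1 x * y \<in> Rxy" using A1 B1 by (intro Rxy_I)
  ultimately show ?thesis using k assms by blast
qed

lemma Rxy_residue:
  assumes "a \<in> K" "b \<in> K" "f \<in> Rxy"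
  shows "\<exists>c\<in>K. \<forall>P. place_at P a b \<longrightarrow> f - c \<in> P"
proof -
  obtain g \<beta> c where *: "g \<in> Rxy" "\<beta> \<in> K" "c \<in> K" "f = (x - a) * g + \<beta> * (y - b) + c"
    using Rxy_decomp[OF assms] by blast
  have "f - c \<in> P" if "place_at P a b" for P
  proof -
    have P: "P \<in> Pl" "x - a \<in> P" "y - b \<in> P" using that by (auto simp: place_at_def)
    have "(x - a) * g + \<beta> * (y - b) \<in> P"
      using P_add[OF P(1) P_mult2[OF P(1,2) Rxy_V[OF P(1) at_V(1)[OF that] *(1)]] P_mult[OF P(1) K_V[OF P(1) *(2)] P(3)]] .
    thus ?thesis by (simp add: *(4))
  qed
  thus ?thesis using *(3) by blast
qed

text \<open>The residue given by \<open>Rxy_residue\<close> depends on the point alone.\<close>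

lemma Rxy_P_iff:
  assumes "place_at P a b" "place_at Q a b" "f \<in> Rxy"
  shows "f \<in> P \<longleftrightarrow> f \<in> Q"
proof -
  have ab: "a \<in> K" "b \<in> K" using assms by (auto simp: place_at_def)
  obtain c where c0: "c \<in> K" "\<forall>P. place_at P a b \<longrightarrow> f - c \<in> P" using Rxy_residue[OF ab assms(3)] by blast
  have c: "c \<in> K" "f - c \<in> P" "f - c \<in> Q" using c0(1) c0(2)[rule_format] assms(1,2) by simp_all
  have key: "f \<in> R \<longleftrightarrow> c = 0" if R: "f - c \<in> R" "R \<in> Pl" for R
  proof
    assume "f \<in> R"
    from P_diff[OF R(2) this R(1)] have "c \<in> R" by simp
    thus "c = 0" by (rule K_P[OF R(2) c(1)])
  next
    assume "c = 0" thus "f \<in> R" using R(1) by simp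
  qed
  have "P \<in> Pl" "Q \<in> Pl" using assms by (auto simp: place_at_def)
  thus ?thesis using key[OF c(2)] key[OF c(3)] by simp
qed

text \<open>The defect of \<open>(a, b)\<close> in the Weierstrass equation is a combination of
  \<open>x - a\<close> and \<open>y - b\<close>, so it lies in \<open>P\<close> and in
  \<open>K\<close>. The second identity is the difference of the equations at \<open>(x, y)\<close>
  and \<open>(a, b)\<close>.\<close>

lemma at_curve:
  assumes "place_at P a b"
  shows "b^2 + a1 * a * b + a3 * b = a^3 + a2 * a^2 + a4 * a + a6"
    and "(y - b) * (y + b + a1 * x + a3) = (x - a) * (x^2 + a * x + a^2 + a2 * (x + a) + a4 - a1 * b)"
proof -
  have P: "P \<in> Pl" "a \<in> K" "b \<in> K" "x - a \<in> P" "y - b \<in> P" using assms by (auto simp: place_at_def)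
  note xy = at_V[OF assms]
  define c where "c = b^2 + a1 * a * b + a3 * b - (a^3 + a2 * a^2 + a4 * a + a6)"
  define D where "D = y + b + a1 * x + a3"
  define N where "N = x^2 + a * x + a^2 + a2 * (x + a) + a4 - a1 * b"
  have e0: "(y - b) * D - (x - a) * N + c = (y^2 + a1 * x * y + a3 * y) - (x^3 + a2 * x^2 + a4 * x + a6)"
    by (simp add: c_def D_def N_def algebra_simps power2_eq_square power3_eq_cube)
  have e: "(y - b) * D - (x - a) * N + c = 0" unfolding e0 curve by simp
  have "D \<in> Rxy" "N \<in> Rxy" unfolding D_def N_def
    by (intro Rxy.diff_mem Rxy.add_mem Rxy.mult_mem Rxy.power_mem Rxy_x Rxy_y Rxy_K aK P)+
  hence "D \<in> V P" "N \<in> V P" using Rxy_V[OF P(1) xy(1)] by auto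
  hence "(y - b) * D - (x - a) * N \<in> P" by (intro P_diff[OF P(1)] P_mult2[OF P(1,5)] P_mult2[OF P(1,4)])
  from P_uminus[OF P(1) this] have "- ((y - b) * D - (x - a) * N) \<in> P" .
  moreover have "- ((y - b) * D - (x - a) * N) = c" using e by (rule minus_unique)
  ultimately have "c \<in> P" by (simp only:)
  hence c0: "c = 0" using K_P[OF P(1), of c] P by (auto simp: c_def)
  thus "b^2 + a1 * a * b + a3 * b = a^3 + a2 * a^2 + a4 * a + a6" by (simp add: c_def)
  show "(y - b) * (y + b + a1 * x + a3) = (x - a) * (x^2 + a * x + a^2 + a2 * (x + a) + a4 - a1 * b)"
    using e c0 by (simp add: D_def N_def)
qed

text \<open>A local parameter at \<open>(a, b)\<close>. The tested expression is the derivative of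
  the equation with respect to \<open>y\<close>, so \<open>x - a\<close> serves unless the tangent
  is vertical.\<close>

definition "lpar a b = (if 2 * b + a1 * a + a3 \<noteq> 0 then x - a else y - b)"

text \<open>The localisation of the coordinate ring at \<open>P\<close>.\<close>

definition "Loc P = {G / H | G H. G \<in> Rxy \<and> H \<in> Rxy \<and> H \<notin> P}"

lemma Loc_I: "G \<in> Rxy \<Longrightarrow> H \<in> Rxy \<Longrightarrow> H \<notin> P \<Longrightarrow> G / H \<in> Loc P"
  by (auto simp: Loc_def)

context
  fixes P a b assumes at: "place_at P a b"
begin

lemma at': "P \<in> Pl" "a \<in> K" "b \<in> K" "x - a \<in> P" "y - b \<in> P" using at by (auto simp: place_at_def)

lemmas Pl' = at'(1)

lemma Rxy_P_nz: "H \<notin> P \<Longrightarrow> H \<noteq> 0" using P_zero[OF Pl'] by blast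

lemma Loc_Rxy: "G \<in> Rxy \<Longrightarrow> G \<in> Loc P"
  using Loc_I[of G 1 P] P_one[OF Pl'] by simp

lemma Loc_V: "f \<in> Loc P \<Longrightarrow> f \<in> V P"
proof -
  assume "f \<in> Loc P"
  then obtain G H where *: "G \<in> Rxy" "H \<in> Rxy" "H \<notin> P" "f = G / H" unfolding Loc_def by blast
  show "f \<in> V P" unfolding *(4) divide_inverse
    using * unitV[OF Pl', of H] Rxy_V[OF Pl' at_V(1)[OF at]] by (intro V_mult[OF Pl']) auto
qed

lemma Loc_add_mult: 
  assumes "f \<in> Loc P" "g \<in> Loc P"
  shows "f + g \<in> Loc P" "f * g \<in> Loc P"
proof -
  obtain G H where 1: "G \<in> Rxy" "H \<in> Rxy" "H \<notin> P" "f = G / H" using assms(1) unfolding Loc_def by blast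
  obtain G' H' where 2: "G' \<in> Rxy" "H' \<in> Rxy" "H' \<notin> P" "g = G' / H'" using assms(2) unfolding Loc_def by blast
  have HH: "H * H' \<notin> P" using unit_mult[OF Pl', of H H'] Rxy_V[OF Pl' at_V(1)[OF at]] 1 2 by blast
  have "(G * H' + G' * H) / (H * H') \<in> Loc P" "(G * G') / (H * H') \<in> Loc P" using 1 2 HH by (auto intro!: Loc_I)
  moreover have "f + g = (G * H' + G' * H) / (H * H')"
    unfolding 1(4) 2(4) using Rxy_P_nz[OF 1(3)] Rxy_P_nz[OF 2(3)] by (rule add_frac_eq)
  moreover have "f * g = (G * G') / (H * H')" unfolding 1(4) 2(4) by simp
  ultimately show "f + g \<in> Loc P" "f * g \<in> Loc P" by metis+
qed

text \<open>In \<open>(y - b) * D = (x - a) * N\<close> the residues of \<open>D\<close> and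
  \<open>N\<close> at the point are, up to sign, the two partial derivatives. By smoothness one of
  them is a unit, so one of \<open>x - a\<close>, \<open>y - b\<close> is a multiple of the other in
  \<open>Loc P\<close>.\<close>

lemma lpar_gen:
  shows "lpar a b \<in> P" "lpar a b \<in> Rxy" "lpar a b \<noteq> 0"
    "\<exists>g\<in>Loc P. x - a = lpar a b * g" "\<exists>g\<in>Loc P. y - b = lpar a b * g"
proof -
  define D where "D = y + b + a1 * x + a3"
  define N where "N = x^2 + a * x + a^2 + a2 * (x + a) + a4 - a1 * b"
  have e: "(y - b) * D = (x - a) * N" using at_curve(2)[OF at] by (simp add: D_def N_def)
  have DN: "D \<in> Rxy" "N \<in> Rxy" unfolding D_def N_def
    by (intro Rxy.diff_mem Rxy.add_mem Rxy.mult_mem Rxy.power_mem Rxy_x Rxy_y Rxy_K aK at')+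
  have res: "D - (2 * b + a1 * a + a3) \<in> P" "N - (3 * a^2 + 2 * a2 * a + a4 - a1 * b) \<in> P"
  proof -
    have "(y - b) * 1 + (x - a) * a1 \<in> P"
      by (intro P_add[OF Pl'] P_mult2[OF Pl' at'(4)] P_mult2[OF Pl' at'(5)] K_V[OF Pl'] aK K.one_mem)
    moreover have "(y - b) * 1 + (x - a) * a1 = D - (2 * b + a1 * a + a3)" by (simp add: D_def algebra_simps)
    ultimately show "D - (2 * b + a1 * a + a3) \<in> P" by metis
    have "(x - a) * (x + 2 * a + a2) \<in> P"
      by (intro P_mult2[OF Pl' at'(4)] V_add[OF Pl'] V_mult[OF Pl'] at_V(1)[OF at] K_V[OF Pl'] at'(2,3) aK K.numeral_mem)
    moreover have "(x - a) * (x + 2 * a + a2) = N - (3 * a^2 + 2 * a2 * a + a4 - a1 * b)"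
      by (simp add: N_def algebra_simps power2_eq_square)
    ultimately show "N - (3 * a^2 + 2 * a2 * a + a4 - a1 * b) \<in> P" by metis
  qed
  have nonz: "f \<notin> P" if "f - c \<in> P" "c \<in> K" "c \<noteq> 0" for f c
  proof
    assume "f \<in> P"
    from P_diff[OF Pl' this that(1)] have "c \<in> P" by simp
    thus False using K_P[OF Pl' that(2)] that(3) by blast
  qed
  have xa: "x - a \<noteq> 0" using poly_x_nz[of "[:- a, 1:]"] at' by simp
  have g1: "1 \<in> Loc P" using Loc_Rxy by blast
  have R: "x - a \<in> Rxy" "y - b \<in> Rxy" using Rxy_x Rxy_y Rxy_K at' by auto
  show "lpar a b \<in> P" "lpar a b \<in> Rxy" using at' R by (auto simp: lpar_def)
  show "lpar a b \<noteq> 0" "\<exists>g\<in>Loc P. x - a = lpar a b * g" "\<exists>g\<in>Loc P. y - b = lpar a b * g"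
  proof (atomize (full), cases "2 * b + a1 * a + a3 = 0")
    case False
    have DP: "D \<notin> P" using nonz[OF res(1)] False at' by auto
    have y: "y - b = (x - a) * (N / D)" using e Rxy_P_nz[OF DP] by (simp add: field_simps)
    have l: "lpar a b = x - a" using False by (simp add: lpar_def)
    have "x - a = (x - a) * 1" by simp
    thus "lpar a b \<noteq> 0 \<and> (\<exists>g\<in>Loc P. x - a = lpar a b * g) \<and> (\<exists>g\<in>Loc P. y - b = lpar a b * g)"
      unfolding l using g1 Loc_I[OF DN(2,1) DP] xa y by blast
  next
    case True
    have "3 * a^2 + 2 * a2 * a + a4 - a1 * b \<noteq> 0"
      using smooth[OF at'(2,3) at_curve(1)[OF at]] True by auto
    hence NP: "N \<notin> P" using nonz[OF res(2)] at' by auto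
    have x: "x - a = (y - b) * (D / N)" using e Rxy_P_nz[OF NP] by (simp add: field_simps)
    hence yb: "y - b \<noteq> 0" using xa by auto
    have l: "lpar a b = y - b" using True by (simp add: lpar_def)
    have "y - b = (y - b) * 1" by simp
    thus "lpar a b \<noteq> 0 \<and> (\<exists>g\<in>Loc P. x - a = lpar a b * g) \<and> (\<exists>g\<in>Loc P. y - b = lpar a b * g)"
      unfolding l using g1 Loc_I[OF DN(1,2) NP] yb x by blast
  qed
qed

lemma Rxy_P_lpar:
  assumes "f \<in> Rxy" "f \<in> P"
  shows "\<exists>g\<in>Loc P. f = lpar a b * g"
proof -
  obtain g \<beta> c where *: "g \<in> Rxy" "\<beta> \<in> K" "c \<in> K" "f = (x - a) * g + \<beta> * (y - b) + c"
    using Rxy_decomp[OF at'(2,3) assms(1)] by blast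
  have "(x - a) * g + \<beta> * (y - b) \<in> P"
    using P_add[OF Pl' P_mult2[OF Pl' at'(4) Rxy_V[OF Pl' at_V(1)[OF at] *(1)]] P_mult[OF Pl' K_V[OF Pl' *(2)] at'(5)]] .
  from P_diff[OF Pl' assms(2) this] have "c = 0" using K_P[OF Pl' *(3)] by (simp add: *(4))
  obtain g1 g2 where g: "g1 \<in> Loc P" "x - a = lpar a b * g1" "g2 \<in> Loc P" "y - b = lpar a b * g2"
    using lpar_gen by blast
  have "f = lpar a b * (g1 * g + g2 * \<beta>)" using * \<open>c = 0\<close> g(2,4) by (simp add: algebra_simps)
  moreover have "g1 * g + g2 * \<beta> \<in> Loc P"
    by (intro Loc_add_mult Loc_Rxy[OF *(1)] Loc_Rxy[OF Rxy_K[OF *(2)]] g(1,3))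
  ultimately show ?thesis by blast
qed

text \<open>Each factor \<open>lpar a b\<close> that is split off lowers the value, which is a
  natural number because \<open>P\<close> is already known to be discrete.\<close>

lemma Loc_rep:
  assumes "g \<in> Loc P" "g \<noteq> 0"
  shows "\<exists>n. \<exists>G\<in>Rxy - P. \<exists>H\<in>Rxy - P. g = lpar a b ^ n * (G / H)"
  using assms
proof (induction "nat (v P g)" arbitrary: g rule: less_induct)
  case less
  obtain G H where *: "G \<in> Rxy" "H \<in> Rxy" "H \<notin> P" "g = G / H" using less.prems(1) unfolding Loc_def by blast
  show ?case
  proof (cases "G \<in> P")
    case False
    thus ?thesis using * by (intro exI[of _ 0]) auto
  next
    case True
    obtain g' where g': "g' \<in> Loc P" "G = lpar a b * g'" using Rxy_P_lpar[OF *(1) True] by blast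
    define h where "h = g' * (1 / H)"
    have h: "h \<in> Loc P" unfolding h_def using g' * Loc_I[of 1 H P] by (intro Loc_add_mult) auto
    have gh: "g = lpar a b * h" by (simp add: *(4) g'(2) h_def)
    have h0: "h \<noteq> 0" using gh less.prems by auto
    note D = discrete[OF Pl']
    have F: "h \<in> F" "lpar a b \<in> F" using V_F[OF Pl' Loc_V[OF h]] Rxy_F lpar_gen by auto
    have "v P g = v P (lpar a b) + v P h" unfolding gh using v_mult[OF D] F h0 lpar_gen(3) by blast
    moreover have "v P (lpar a b) > 0" using P_iff_v[OF D F(2)] lpar_gen by blast
    moreover have "v P h \<ge> 0" using V_iff_v[OF D F(1) h0] Loc_V[OF h] by blast
    ultimately have "nat (v P h) < nat (v P g)" by simp
    from less.hyps[OF this h h0] obtain n G' H' where "G' \<in> Rxy - P" "H' \<in> Rxy - P" "h = lpar a b ^ n * (G' / H')" by blast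
    moreover from this(3) have "g = lpar a b ^ Suc n * (G' / H')" by (simp add: gh)
    ultimately show ?thesis by blast
  qed
qed

lemma Rxy_unit_mult: "G \<in> Rxy - P \<Longrightarrow> H \<in> Rxy - P \<Longrightarrow> G * H \<in> Rxy - P"
  using unit_mult[OF Pl', of G H] Rxy_V[OF Pl' at_V(1)[OF at], of G] Rxy_V[OF Pl' at_V(1)[OF at], of H] by simp

lemma at_rep:
  assumes "f \<in> F" "f \<noteq> 0"
  shows "\<exists>n. \<exists>G\<in>Rxy - P. \<exists>H\<in>Rxy - P. f = lpar a b powi n * (G / H)"
proof -
  obtain A B where AB: "A \<in> Rxy" "B \<in> Rxy" "B \<noteq> 0" "f = A / B" using Rxy_rep[OF assms(1)] by blast
  have "A \<noteq> 0" using AB assms by auto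
  obtain n G H where 1: "G \<in> Rxy - P" "H \<in> Rxy - P" "A = lpar a b ^ n * (G / H)"
    using Loc_rep[OF Loc_Rxy[OF AB(1)] \<open>A \<noteq> 0\<close>] by blast
  obtain m G' H' where 2: "G' \<in> Rxy - P" "H' \<in> Rxy - P" "B = lpar a b ^ m * (G' / H')"
    using Loc_rep[OF Loc_Rxy[OF AB(2)] AB(3)] by blast
  have "f = lpar a b powi (int n - int m) * ((G * H') / (H * G'))"
    using lpar_gen(3) by (simp add: AB(4) 1(3) 2(3) power_int_diff mult_ac)
  moreover have "G * H' \<in> Rxy - P" "H * G' \<in> Rxy - P"
    using Rxy_unit_mult 1(1,2) 2(1,2) by blast+
  ultimately show ?thesis by blast
qed

lemma quot_unit: "G \<in> Rxy - P \<Longrightarrow> H \<in> Rxy - P \<Longrightarrow> G / H \<in> V P - P"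
  unfolding divide_inverse
  using unit_mult[OF Pl', of G "inverse H"] unitV[OF Pl', of H]
    Rxy_V[OF Pl' at_V(1)[OF at], of G] Rxy_V[OF Pl' at_V(1)[OF at], of H] by simp

lemma uniformizer_lpar: "uniformizer P (lpar a b)"
  unfolding uniformizer_def
proof (intro conjI ballI)
  fix f assume "f \<in> F - {0}"
  then obtain n G H where "G \<in> Rxy - P" "H \<in> Rxy - P" "f = lpar a b powi n * (G / H)" using at_rep[of f] by blast
  thus "\<exists>n. \<exists>u\<in>V P - P. f = lpar a b powi n * u" using quot_unit by blast
qed (use lpar_gen in auto)

lemma v_lpar: "v P (lpar a b) = 1"
  using v_uniformizer[OF discrete[OF Pl'] uniformizer_lpar] .

text \<open>A unit is a quotient of two coordinate functions with nonzero residues \<open>c\<close>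
  and \<open>d\<close>, so its residue is \<open>c / d\<close>.\<close>

lemma rational_at: "P \<in> rational_places K F"
  unfolding rational_iff[OF Pl']
proof
  fix f assume f: "f \<in> V P"
  show "\<exists>c\<in>K. f - c \<in> P"
  proof (cases "f \<in> P")
    case True thus ?thesis by (intro bexI[of _ 0]) auto
  next
    case False
    have fF: "f \<in> F" "f \<noteq> 0" using V_F[OF Pl' f] False P_zero[OF Pl'] by auto
    obtain n G H where *: "G \<in> Rxy - P" "H \<in> Rxy - P" "f = lpar a b powi n * (G / H)" using at_rep[OF fF] by blast
    have q: "G / H \<in> V P" "G / H \<notin> P" using quot_unit * by blast+
    have "n \<ge> 0" "\<not> n > 0"
      using powi_unit_cases[OF Pl' lpar_gen(1,3) q, of n] f False unfolding *(3) by simp_all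
    hence "n = 0" by simp
    hence fe: "f = G / H" using *(3) by simp
    obtain c where c: "c \<in> K" "G - c \<in> P" using Rxy_residue[OF at'(2,3), of G] *(1) at by blast
    obtain d where d: "d \<in> K" "H - d \<in> P" using Rxy_residue[OF at'(2,3), of H] *(2) at by blast
    note cd = c d
    have d0: "d \<noteq> 0" using d *(2) by auto
    have H0: "H \<noteq> 0" using * P_zero[OF Pl'] by auto
    have "inverse H \<in> V P" using unitV[OF Pl', of H] Rxy_V[OF Pl' at_V(1)[OF at], of H] *(2) by simp
    from P_mult[OF Pl' this P_diff[OF Pl' c(2) P_mult[OF Pl' K_V[OF Pl' K.divide_mem[OF c(1) d(1)]] d(2)]]]
    have "inverse H * ((G - c) - (c / d) * (H - d)) \<in> P" .
    also have "inverse H * ((G - c) - (c / d) * (H - d)) = f - c / d"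
      unfolding fe using d0 H0 by (simp add: field_simps)
    finally show ?thesis using K.divide_mem[OF c(1) d(1)] by blast
  qed
qed

end

text \<open>\<open>at_rep\<close> writes a function as a power of \<open>lpar a b\<close> times
  \<open>G / H\<close>, and by \<open>Rxy_P_iff\<close> both \<open>G\<close> and \<open>H\<close>
  are units at either place. The exponent therefore decides membership in both valuation
  rings.\<close>

lemma at_unique:
  assumes "place_at P a b" "place_at Q a b"
  shows "P = Q"
proof -
  have P: "P \<in> Pl" "Q \<in> Pl" using assms by (auto simp: place_at_def)
  have key: "f \<in> V P \<longleftrightarrow> f \<in> V Q" if f: "f \<in> F" "f \<noteq> 0" for f
  proof -
    obtain n G H where *: "G \<in> Rxy - P" "H \<in> Rxy - P" "f = lpar a b powi n * (G / H)" using at_rep[OF assms(1) f] by blast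
    have **: "G \<in> Rxy - Q" "H \<in> Rxy - Q" using Rxy_P_iff[OF assms] * by blast+
    have q: "G / H \<in> V P" "G / H \<notin> P" "G / H \<in> V Q" "G / H \<notin> Q" using quot_unit[OF assms(1)] quot_unit[OF assms(2)] * ** by blast+
    thus ?thesis unfolding *(3)
      using powi_unit_cases(1)[OF P(1) lpar_gen(1,3)[OF assms(1)] q(1,2)] powi_unit_cases(1)[OF P(2) lpar_gen(1,3)[OF assms(2)] q(3,4)]
      by simp
  qed
  have "f \<in> V P \<longleftrightarrow> f \<in> V Q" for f
    using key[of f] V_F[OF P(1), of f] V_F[OF P(2), of f] V_zero[OF P(1)] V_zero[OF P(2)] by (cases "f = 0") auto
  hence "V P = V Q" by (rule Set.set_eqI)
  with P show ?thesis by (rule place_eqI)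
qed

lemma rational_at_ex:
  assumes "P \<in> rational_places K F" "P \<noteq> \<O>"
  shows "\<exists>a b. place_at P a b"
proof -
  have P: "P \<in> Pl" using assms by (simp add: rational_places_def)
  have x: "x \<in> V P" using inf_eqI[OF P] assms(2) by blast
  have r: "\<exists>c\<in>K. z - c \<in> P" if "z \<in> V P" for z
    using assms(1) that unfolding rational_iff[OF P] by simp
  obtain a where "a \<in> K" "x - a \<in> P" using r[OF x] by blast
  moreover obtain b where "b \<in> K" "y - b \<in> P" using r[OF y_V[OF P x]] by blast
  ultimately show ?thesis unfolding place_at_def using P by blast
qed

lemma at_not_inf: "place_at P a b \<Longrightarrow> P \<noteq> \<O>"
  using at_V(1) inf_place by blast

end


section \<open>Homomorphisms, automorphisms and their action on places\<close>

text \<open>The target is a second type so that \<open>to_ac\<close> and composites with it are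
  covered.\<close>

definition hom_on :: "'a::field set \<Rightarrow> ('a \<Rightarrow> 'b::field) \<Rightarrow> bool" where
  "hom_on F \<phi> \<longleftrightarrow> \<phi> 1 = 1 \<and> (\<forall>a\<in>F. \<forall>b\<in>F. \<phi> (a + b) = \<phi> a + \<phi> b \<and> \<phi> (a * b) = \<phi> a * \<phi> b)"

context sfield
begin

context
  fixes \<phi> :: "'a \<Rightarrow> 'b::field" assumes hom: "hom_on K \<phi>"
begin

lemma hom_one [simp]: "\<phi> 1 = 1"
  and hom_add: "a \<in> K \<Longrightarrow> b \<in> K \<Longrightarrow> \<phi> (a + b) = \<phi> a + \<phi> b"
  and hom_mult: "a \<in> K \<Longrightarrow> b \<in> K \<Longrightarrow> \<phi> (a * b) = \<phi> a * \<phi> b"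
  using hom by (simp_all add: hom_on_def)

lemma hom_zero [simp]: "\<phi> 0 = 0"
proof -
  have "\<phi> 0 + \<phi> 0 = \<phi> 0 + 0" using hom_add[of 0 0] by (simp only: zero_mem add_0_right)
  thus ?thesis by (simp only: add_left_cancel)
qed

lemma hom_uminus: "a \<in> K \<Longrightarrow> \<phi> (- a) = - \<phi> a"
  using hom_add[of "- a" a] by (simp add: eq_neg_iff_add_eq_0)

lemma hom_diff: "a \<in> K \<Longrightarrow> b \<in> K \<Longrightarrow> \<phi> (a - b) = \<phi> a - \<phi> b"
  using hom_add[of a "- b"] hom_uminus[of b] by simp

lemma hom_power: "a \<in> K \<Longrightarrow> \<phi> (a ^ n) = \<phi> a ^ n"
  by (induction n) (simp_all add: hom_mult)

lemma hom_inverse: "a \<in> K \<Longrightarrow> \<phi> (inverse a) = inverse (\<phi> a)"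
proof (cases "a = 0")
  case False
  assume a: "a \<in> K"
  have "\<phi> a * \<phi> (inverse a) = 1" using hom_mult[of a "inverse a"] a False by simp
  thus ?thesis by (rule inverse_unique[symmetric])
qed simp

lemma hom_divide: "a \<in> K \<Longrightarrow> b \<in> K \<Longrightarrow> \<phi> (a / b) = \<phi> a / \<phi> b"
  by (simp add: divide_inverse hom_mult hom_inverse)

lemma hom_powi: "a \<in> K \<Longrightarrow> \<phi> (a powi n) = \<phi> a powi n"
  by (simp add: power_int_def hom_power hom_inverse)

lemma hom_eq_0: "a \<in> K \<Longrightarrow> \<phi> a = 0 \<longleftrightarrow> a = 0"
proof
  assume a: "a \<in> K" "\<phi> a = 0"
  show "a = 0"
  proof (rule ccontr)
    assume "a \<noteq> 0"
    thus False using hom_mult[of a "inverse a"] a by simp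
  qed
qed simp

lemma hom_eq_iff: "a \<in> K \<Longrightarrow> b \<in> K \<Longrightarrow> \<phi> a = \<phi> b \<longleftrightarrow> a = b"
  using hom_eq_0[of "a - b"] hom_diff[of a b] by simp

end

end

context fpair
begin

abbreviation "Aut \<equiv> field_auts K F"

lemma hom_poly:
  assumes "hom_on F \<phi>" "\<And>c. c \<in> K \<Longrightarrow> \<phi> c = c" "p \<in> polys_over K" "z \<in> F"
  shows "\<phi> (poly p z) = poly p (\<phi> z)"
  using assms(3)
proof (induction rule: K.polys_over_induct)
  case (pCons a p)
  have "a \<in> F" "poly p z \<in> F" using KF pCons assms(4) by (auto intro!: K.poly_mem[of _ _ F])
  thus ?case using pCons assms F.hom_add[OF assms(1)] F.hom_mult[OF assms(1)] by simp
qed (simp add: F.hom_zero[OF assms(1)])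

lemma aut_iff: "\<sigma> \<in> Aut \<longleftrightarrow> hom_on F \<sigma> \<and> \<sigma> ` F = F \<and> (\<forall>c\<in>K. \<sigma> c = c)"
proof -
  have "\<sigma> \<in> Aut \<longleftrightarrow> \<sigma> \<in> F \<rightarrow> F \<and> hom_on F \<sigma> \<and> bij_betw \<sigma> F F \<and> (\<forall>c\<in>K. \<sigma> c = c)"
    unfolding field_auts_def ring_iso_def ring_hom_def hom_on_def by (simp, blast)
  moreover have "inj_on \<sigma> F" if "hom_on F \<sigma>"
    by (rule inj_onI) (simp add: F.hom_eq_iff[OF that])
  moreover have "\<sigma> \<in> F \<rightarrow> F" if "\<sigma> ` F = F" using that by (simp add: image_subset_iff_funcset[symmetric])
  ultimately show ?thesis unfolding bij_betw_def by blast
qed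

lemma id_aut: "id \<in> Aut" by (simp add: aut_iff hom_on_def)

lemma comp_aut:
  assumes "\<sigma> \<in> Aut" "\<tau> \<in> Aut" shows "\<sigma> \<circ> \<tau> \<in> Aut"
proof -
  note S = assms(1)[unfolded aut_iff] and T = assms(2)[unfolded aut_iff]
  note s = S[THEN conjunct1] S[THEN conjunct2, THEN conjunct1] S[THEN conjunct2, THEN conjunct2]
  note t = T[THEN conjunct1] T[THEN conjunct2, THEN conjunct1] T[THEN conjunct2, THEN conjunct2]
  have tF: "\<tau> a \<in> F" if "a \<in> F" for a using imageI[OF that, of \<tau>] t(2) by simp
  have "hom_on F (\<sigma> \<circ> \<tau>)" unfolding hom_on_def
    using F.hom_one[OF s(1)] F.hom_one[OF t(1)]
    by (simp add: F.hom_add[OF s(1)] F.hom_add[OF t(1)] F.hom_mult[OF s(1)] F.hom_mult[OF t(1)] tF)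
  moreover have "(\<sigma> \<circ> \<tau>) ` F = F" by (simp only: image_comp[symmetric] s(2) t(2))
  moreover have "\<forall>c\<in>K. (\<sigma> \<circ> \<tau>) c = c" using s(3) t(3) by simp
  ultimately show ?thesis by (simp only: aut_iff simp_thms)
qed

context
  fixes \<sigma> assumes s: "\<sigma> \<in> Aut"
begin

lemma aut_hom: "hom_on F \<sigma>" and aut_K: "c \<in> K \<Longrightarrow> \<sigma> c = c" and aut_image: "\<sigma> ` F = F"
  using s by (auto simp: aut_iff)

lemma aut_F: "a \<in> F \<Longrightarrow> \<sigma> a \<in> F" using aut_image by blast

lemma aut_inj: "inj_on \<sigma> F" using F.hom_eq_iff[OF aut_hom] by (auto simp: inj_on_def)

lemmas aut_add = F.hom_add[OF aut_hom] and aut_mult = F.hom_mult[OF aut_hom]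
  and aut_zero = F.hom_zero[OF aut_hom] and aut_one = F.hom_one[OF aut_hom] and aut_uminus = F.hom_uminus[OF aut_hom]
  and aut_diff = F.hom_diff[OF aut_hom] and aut_inverse = F.hom_inverse[OF aut_hom] and aut_divide = F.hom_divide[OF aut_hom]
  and aut_power = F.hom_power[OF aut_hom] and aut_powi = F.hom_powi[OF aut_hom]
  and aut_eq_0 = F.hom_eq_0[OF aut_hom] and aut_eq_iff = F.hom_eq_iff[OF aut_hom]

lemma aut_mem_image: "A \<subseteq> F \<Longrightarrow> a \<in> F \<Longrightarrow> \<sigma> a \<in> \<sigma> ` A \<longleftrightarrow> a \<in> A"
  using inj_on_image_mem_iff[OF aut_inj] by blast

lemma ex_inv_aut: "\<exists>\<tau>\<in>Aut. (\<forall>f\<in>F. \<tau> (\<sigma> f) = f) \<and> (\<forall>f\<in>F. \<sigma> (\<tau> f) = f)"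
proof -
  define \<tau> where "\<tau> = inv_into F \<sigma>"
  have 1: "\<tau> (\<sigma> f) = f" if "f \<in> F" for f using that aut_inj by (simp add: \<tau>_def)
  have 2: "\<sigma> (\<tau> f) = f" "\<tau> f \<in> F" if "f \<in> F" for f
    using that aut_image by (auto simp: \<tau>_def f_inv_into_f inv_into_into)
  have "hom_on F \<tau>" unfolding hom_on_def
  proof (intro conjI ballI)
    show "\<tau> 1 = 1" using 1[of 1] aut_one by simp
    fix a b assume ab: "a \<in> F" "b \<in> F"
    have "\<sigma> (\<tau> a + \<tau> b) = a + b" "\<sigma> (\<tau> a * \<tau> b) = a * b" using 2 ab by (simp_all add: aut_add aut_mult)
    moreover have "\<tau> a + \<tau> b \<in> F" "\<tau> a * \<tau> b \<in> F" using 2 ab by auto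
    ultimately show "\<tau> (a + b) = \<tau> a + \<tau> b" "\<tau> (a * b) = \<tau> a * \<tau> b" using 1 by metis+
  qed
  moreover have "\<tau> ` F = F"
  proof
    show "\<tau> ` F \<subseteq> F" using 2 by auto
    show "F \<subseteq> \<tau> ` F"
    proof
      fix f assume f: "f \<in> F"
      thus "f \<in> \<tau> ` F" using 1[OF f] aut_F[OF f] by (intro image_eqI[of _ _ "\<sigma> f"]) auto
    qed
  qed
  moreover have "\<tau> c = c" if "c \<in> K" for c using 1[of c] aut_K[OF that] that KF by auto
  ultimately have "\<tau> \<in> Aut" by (simp add: aut_iff)
  thus ?thesis using 1 2 by blast
qed

lemma image_place:
  assumes P: "P \<in> Pl"
  shows "\<sigma> ` P \<in> Pl" "V (\<sigma> ` P) = \<sigma> ` V P"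
proof -
  define V' where "V' = \<sigma> ` V P"
  have VF: "V P \<subseteq> F" using V_F[OF P] by blast
  have mem: "\<sigma> a \<in> V' \<longleftrightarrow> a \<in> V P" if "a \<in> F" for a
    unfolding V'_def by (rule aut_mem_image[OF VF that])
  have V'F: "V' \<subseteq> F" using VF aut_F by (auto simp: V'_def)
  have sur: "\<exists>a\<in>F. z = \<sigma> a" if "z \<in> F" for z using aut_image that by auto
  have vr: "is_valuation_ring K F V'" unfolding valuation_ring_iff
  proof (intro conjI ballI)
    show "1 \<in> V'" using mem[of 1] aut_one V_one[OF P] by simp
    show "- a \<in> V'" if a: "a \<in> V'" for a
    proof -
      obtain a0 where "a0 \<in> V P" "a = \<sigma> a0" using a by (auto simp: V'_def)
      thus ?thesis using mem[of "- a0"] V_uminus[OF P] VF by (auto simp: aut_uminus)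
    qed
    show "a + b \<in> V'" "a * b \<in> V'" if ab: "a \<in> V'" "b \<in> V'" for a b
    proof -
      obtain a0 b0 where *: "a0 \<in> V P" "a = \<sigma> a0" "b0 \<in> V P" "b = \<sigma> b0" using ab by (auto simp: V'_def)
      have **: "a0 \<in> F" "b0 \<in> F" using * VF by auto
      show "a + b \<in> V'" using mem[of "a0 + b0"] V_add[OF P] * ** by (simp add: aut_add)
      show "a * b \<in> V'" using mem[of "a0 * b0"] V_mult[OF P] * ** by (simp add: aut_mult)
    qed
    show "K \<subset> V'"
    proof
      show "K \<subseteq> V'"
      proof
        fix c assume c: "c \<in> K"
        hence "\<sigma> c \<in> V'" using mem[of c] K_V[OF P c] KF by auto
        thus "c \<in> V'" using aut_K[OF c] by simp
      qed
      have "K \<subset> V P" using place_valuation_ring(1)[OF P] by (simp add: is_valuation_ring_def)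
      then obtain f where f: "f \<in> V P" "f \<notin> K" by blast
      \<comment> \<open>A value of \<sigma> in \<open>K\<close> is fixed by \<sigma>; injectivity
        then gives \<open>\<sigma> f = f\<close>, contradicting the choice of \<open>f\<close>
        outside \<open>K\<close>.\<close>
      have "\<sigma> f \<notin> K"
      proof
        assume k: "\<sigma> f \<in> K"
        hence "\<sigma> (\<sigma> f) = \<sigma> f" by (rule aut_K)
        hence "\<sigma> f = f" using aut_eq_iff[of "\<sigma> f" f] f VF aut_F by auto
        thus False using k f by simp
      qed
      moreover have "\<sigma> f \<in> V'" using f by (simp add: V'_def)
      ultimately show "K \<noteq> V'" by blast
    qed
    show "V' \<subset> F"
    proof
      obtain f where f: "f \<in> F" "f \<notin> V P" using V_psub[OF P] by blast
      hence "\<sigma> f \<in> F" "\<sigma> f \<notin> V'" using mem aut_F by auto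
      thus "V' \<noteq> F" by blast
    qed (rule V'F)
    fix z assume "z \<in> F"
    then obtain a where a: "a \<in> F" "z = \<sigma> a" using sur by blast
    thus "z \<in> V' \<or> inverse z \<in> V'" using mem[of a] mem[of "inverse a"] V_cases[OF P a(1)] by (auto simp: aut_inverse)
  qed
  have P': "\<sigma> ` P = {z \<in> V'. z = 0 \<or> inverse z \<notin> V'}"
  proof (intro Set.set_eqI iffI)
    fix z assume "z \<in> \<sigma> ` P"
    then obtain a where a: "a \<in> P" "z = \<sigma> a" by blast
    have aF: "a \<in> F" using P_F[OF P a(1)] .
    have "z \<in> V'" using a P_V[OF P] by (auto simp: V'_def)
    moreover have "z = 0 \<or> inverse z \<notin> V'"
      using a aF P_inverse[OF P a(1)] mem[of "inverse a"] aut_inverse[OF aF] aut_zero by auto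
    ultimately show "z \<in> {z \<in> V'. z = 0 \<or> inverse z \<notin> V'}" by simp
  next
    fix z assume z: "z \<in> {z \<in> V'. z = 0 \<or> inverse z \<notin> V'}"
    then obtain a where a: "a \<in> V P" "z = \<sigma> a" by (auto simp: V'_def)
    have aF: "a \<in> F" using a VF by auto
    have "a = 0 \<or> inverse a \<notin> V P" using z mem[of "inverse a"] aF a(2) aut_inverse[OF aF] aut_eq_0[OF aF] by auto
    hence "a \<in> P" using a P_iff[OF P] by blast
    thus "z \<in> \<sigma> ` P" using a by blast
  qed
  show "\<sigma> ` P \<in> Pl" unfolding places_iff by (intro exI[of _ V'] conjI vr P')
  show "V (\<sigma> ` P) = \<sigma> ` V P" using place_ring_eq[OF vr P'] by (simp add: V'_def)
qed

lemma image_place_mem: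
  assumes P: "P \<in> Pl" and f: "f \<in> F"
  shows "\<sigma> f \<in> \<sigma> ` P \<longleftrightarrow> f \<in> P" "\<sigma> f \<in> V (\<sigma> ` P) \<longleftrightarrow> f \<in> V P"
  using aut_mem_image[OF _ f, of P] aut_mem_image[OF _ f, of "V P"] P_F[OF P] V_F[OF P] image_place(2)[OF P] by auto

lemma image_rational:
  assumes "P \<in> rational_places K F"
  shows "\<sigma> ` P \<in> rational_places K F"
proof -
  have P: "P \<in> Pl" using assms by (simp add: rational_places_def)
  show ?thesis unfolding rational_iff[OF image_place(1)[OF P]]
  proof
    fix z assume "z \<in> V (\<sigma> ` P)"
    then obtain f where f: "f \<in> V P" "z = \<sigma> f" using image_place(2)[OF P] by auto
    obtain c where c: "c \<in> K" "f - c \<in> P" using assms f(1) unfolding rational_iff[OF P] by blast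
    have "\<sigma> (f - c) \<in> \<sigma> ` P" using c by blast
    moreover have "\<sigma> (f - c) = z - c" using aut_diff[of f c] aut_K[OF c(1)] f c KF V_F[OF P] by auto
    ultimately show "\<exists>c\<in>K. z - c \<in> \<sigma> ` P" using c by auto
  qed
qed

lemma image_uniformizer:
  assumes P: "P \<in> Pl" and t: "uniformizer P t"
  shows "uniformizer (\<sigma> ` P) (\<sigma> t)"
  unfolding uniformizer_def
proof (intro conjI ballI)
  have tF: "t \<in> F" "t \<in> P" "t \<noteq> 0" using P_F[OF P] t by (auto simp: uniformizer_def)
  show "\<sigma> t \<in> \<sigma> ` P" "\<sigma> t \<noteq> 0" using tF aut_eq_0 by auto
  fix z assume z: "z \<in> F - {0}"
  then obtain f where f: "f \<in> F" "z = \<sigma> f" using aut_image by auto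
  have "f \<noteq> 0" using f z aut_zero by auto
  then obtain n u where nu: "u \<in> V P" "u \<notin> P" "f = t powi n * u" using t_rep[OF P t f(1) \<open>f \<noteq> 0\<close>] by blast
  have uF: "u \<in> F" using V_F[OF P nu(1)] .
  have "z = \<sigma> t powi n * \<sigma> u" using f nu tF uF by (simp add: aut_mult aut_powi)
  moreover have "\<sigma> u \<in> V (\<sigma> ` P) - \<sigma> ` P" using image_place_mem[OF P uF] nu by simp
  ultimately show "\<exists>n. \<exists>u\<in>V (\<sigma> ` P) - \<sigma> ` P. z = \<sigma> t powi n * u" by blast
qed

lemma image_v:
  assumes D: "discrete P" and f: "f \<in> F" "f \<noteq> 0"
  shows "v (\<sigma> ` P) (\<sigma> f) = v P f"
proof -
  have P: "P \<in> Pl" using D by (simp add: discrete_def)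
  obtain t where t: "uniformizer P t" using D by (auto simp: discrete_def)
  have tF: "t \<in> F" using t P_F[OF P] by (auto simp: uniformizer_def)
  obtain n u where nu: "u \<in> V P" "u \<notin> P" "f = t powi n * u" using t_rep[OF P t f] by blast
  have uF: "u \<in> F" using V_F[OF P nu(1)] .
  have "v P f = n" unfolding nu(3) by (rule v_eqI[OF P t nu(1,2)])
  moreover have "\<sigma> f = \<sigma> t powi n * \<sigma> u" using nu tF uF by (simp add: aut_mult aut_powi)
  moreover have "v (\<sigma> ` P) (\<sigma> t powi n * \<sigma> u) = n"
    by (rule v_eqI[OF image_place(1)[OF P] image_uniformizer[OF P t]]) (use image_place_mem[OF P uF] nu in auto)
  ultimately show ?thesis by simp
qed

end

lemma image_cong_place:
  assumes P: "P \<in> Pl" and eq: "\<And>f. f \<in> F \<Longrightarrow> \<sigma> f = \<tau> f"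
  shows "\<sigma> ` P = \<tau> ` P"
proof (rule image_cong[OF refl])
  fix f assume "f \<in> P"
  from P_F[OF P this] show "\<sigma> f = \<tau> f" by (rule eq)
qed

end

context wcurve
begin

lemma hom_unique:
  fixes \<phi> \<psi> :: "'a \<Rightarrow> 'b::field"
  assumes "hom_on F \<phi>" "hom_on F \<psi>" "\<And>c. c \<in> K \<Longrightarrow> \<phi> c = \<psi> c" "\<phi> x = \<psi> x" "\<phi> y = \<psi> y" "f \<in> F"
  shows "\<phi> f = \<psi> f"
proof -
  have p: "\<phi> (poly p x) = \<psi> (poly p x)" if "p \<in> Kp" for p
    using that
  proof (induction rule: K.polys_over_induct)
    case (pCons a p)
    have e: "\<chi> (a + x * poly p x) = \<chi> a + \<chi> x * \<chi> (poly p x)" if "hom_on F \<chi>" for \<chi> :: "'a \<Rightarrow> 'b"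
      using pCons by (simp add: F.hom_add[OF that] F.hom_mult[OF that])
    show ?case using e[OF assms(1)] e[OF assms(2)] assms(3)[OF pCons(1)] assms(4) pCons(4) by simp
  qed (simp add: F.hom_zero[OF assms(1)] F.hom_zero[OF assms(2)])
  obtain A B C where *: "A \<in> Kp" "B \<in> Kp" "C \<in> Kp" "C \<noteq> 0" "f = (poly A x + poly B x * y) / poly C x"
    using rep[OF assms(6)] by blast
  have F: "poly A x \<in> F" "poly B x \<in> F" "poly C x \<in> F" using * by auto
  have "\<chi> ((poly A x + poly B x * y) / poly C x) = (\<chi> (poly A x) + \<chi> (poly B x) * \<chi> y) / \<chi> (poly C x)"
    if "hom_on F \<chi>" for \<chi> :: "'a \<Rightarrow> 'b"
    using F by (simp add: F.hom_divide[OF that] F.hom_add[OF that] F.hom_mult[OF that])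
  from this[OF assms(1)] this[OF assms(2)] show ?thesis
    unfolding *(5) by (simp only: p[OF *(1)] p[OF *(2)] p[OF *(3)] assms(5))
qed

text \<open>1 and \<open>y\<close> are independent over \<open>K(x)\<close>, because
  \<open>v_AB\<close> gives every nontrivial combination a definite pole order at \<O>.\<close>

lemma AB_zero:
  assumes "A \<in> Kp" "B \<in> Kp" "poly A x + poly B x * y = 0" shows "A = 0" "B = 0"
proof -
  have "\<not> (A \<noteq> 0 \<or> B \<noteq> 0)"
  proof
    assume "A \<noteq> 0 \<or> B \<noteq> 0"
    from v_AB(1)[OF inf_place assms(1,2) this] assms(3) show False by contradiction
  qed
  thus "A = 0" "B = 0" by simp_all
qed

text \<open>A point \<open>(x', y')\<close> of the curve in the function field itself defines a
  substitution. It is built as a relation \<open>R\<close> between fractions: \<open>AB_zero\<close>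
  makes the result independent of the representation, and transcendence of \<open>x'\<close> keeps
  denominators nonzero.\<close>

lemma ex_hom:
  assumes "x' \<in> F" "y' \<in> F" "y'^2 + a1 * x' * y' + a3 * y' = x'^3 + a2 * x'^2 + a4 * x' + a6"
    and tr: "\<And>p. p \<in> Kp \<Longrightarrow> poly p x' = 0 \<Longrightarrow> p = 0"
  shows "\<exists>\<phi>. hom_on F \<phi> \<and> \<phi> ` F \<subseteq> F \<and> (\<forall>c\<in>K. \<phi> c = c) \<and> \<phi> x = x' \<and> \<phi> y = y'"
proof -
  define R where "R f g \<longleftrightarrow> (\<exists>A\<in>Kp. \<exists>B\<in>Kp. \<exists>C\<in>Kp. C \<noteq> 0 \<and> f = (poly A x + poly B x * y) / poly C x
     \<and> g = (poly A x' + poly B x' * y') / poly C x')" for f g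
  have R_I: "R f g" if "A \<in> Kp" "B \<in> Kp" "C \<in> Kp" "C \<noteq> 0" "f = (poly A x + poly B x * y) / poly C x"
     "g = (poly A x' + poly B x' * y') / poly C x'" for A B C f g
    unfolding R_def using that by (intro bexI[of _ A] bexI[of _ B] bexI[of _ C] conjI)
  have y'_square: "y' * y' = poly [:a6, a4, a2, 1:] x' - poly [:a3, a1:] x' * y'"
    using assms(3) by (simp add: algebra_simps power2_eq_square power3_eq_cube)
  have tot: "\<exists>g. R f g" if f: "f \<in> F" for f
  proof -
    obtain A B C where "A \<in> Kp" "B \<in> Kp" "C \<in> Kp" "C \<noteq> 0" "f = (poly A x + poly B x * y) / poly C x"
      using rep[OF f] by blast
    from R_I[OF this refl] show ?thesis ..
  qed
  have RF: "g \<in> F" if "R f g" for f g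
    using that assms(1,2) unfolding R_def by (elim bexE conjE) simp
  have fn: "g = g'" if g: "R f g" and g': "R f g'" for f g g'
  proof -
    obtain A B C where 1: "A \<in> Kp" "B \<in> Kp" "C \<in> Kp" "C \<noteq> 0" "f = (poly A x + poly B x * y) / poly C x"
     "g = (poly A x' + poly B x' * y') / poly C x'" using g unfolding R_def by blast
    obtain A' B' C' where 2: "A' \<in> Kp" "B' \<in> Kp" "C' \<in> Kp" "C' \<noteq> 0" "f = (poly A' x + poly B' x * y) / poly C' x"
     "g' = (poly A' x' + poly B' x' * y') / poly C' x'" using g' unfolding R_def by blast
    have "(poly A x + poly B x * y) * poly C' x = (poly A' x + poly B' x * y) * poly C x"
      using 1(5) 2(5) poly_x_nz[OF 1(3,4)] poly_x_nz[OF 2(3,4)] by (simp add: frac_eq_eq)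
    hence "poly (A * C' - A' * C) x + poly (B * C' - B' * C) x * y = 0" by (simp add: algebra_simps)
    from AB_zero[OF _ _ this] have e: "A * C' = A' * C" "B * C' = B' * C" using 1 2 by auto
    have "(poly A x' + poly B x' * y') * poly C' x' = poly (A * C') x' + poly (B * C') x' * y'" by (simp add: algebra_simps)
    also have "\<dots> = (poly A' x' + poly B' x' * y') * poly C x'" unfolding e by (simp add: algebra_simps)
    finally show ?thesis unfolding 1(6) 2(6)
      using tr[OF 1(3)] tr[OF 2(3)] 1(4) 2(4) by (subst frac_eq_eq) auto
  qed
  have arith: "R (f + f') (g + g')" "R (f * f') (g * g')" if g: "R f g" and g': "R f' g'" for f g f' g'
  proof -
    obtain A B C where 1: "A \<in> Kp" "B \<in> Kp" "C \<in> Kp" "C \<noteq> 0" "f = (poly A x + poly B x * y) / poly C x"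
     "g = (poly A x' + poly B x' * y') / poly C x'" using g unfolding R_def by blast
    obtain A' B' C' where 2: "A' \<in> Kp" "B' \<in> Kp" "C' \<in> Kp" "C' \<noteq> 0" "f' = (poly A' x + poly B' x * y) / poly C' x"
     "g' = (poly A' x' + poly B' x' * y') / poly C' x'" using g' unfolding R_def by blast
    have nz: "poly C x \<noteq> 0" "poly C' x \<noteq> 0" "poly C x' \<noteq> 0" "poly C' x' \<noteq> 0"
      using poly_x_nz[OF 1(3,4)] poly_x_nz[OF 2(3,4)] tr[OF 1(3)] tr[OF 2(3)] 1(4) 2(4) by auto
    have add: "(poly A w + poly B w * u) / poly C w + (poly A' w + poly B' w * u) / poly C' w
       = (poly (A * C' + A' * C) w + poly (B * C' + B' * C) w * u) / poly (C * C') w"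
       if "poly C w \<noteq> 0" "poly C' w \<noteq> 0" for u w
      using that by (subst add_frac_eq) (simp_all add: algebra_simps)
    have CC: "C * C' \<in> Kp" "C * C' \<noteq> 0" using 1(3,4) 2(3,4) by simp_all
    show "R (f + f') (g + g')"
      by (rule R_I[OF _ _ CC add[where u = y, OF nz(1,2), folded 1(5) 2(5)] add[where u = y', OF nz(3,4), folded 1(6) 2(6)]])
         (use 1(1-3) 2(1-3) in simp_all)
    have mult: "((poly A w + poly B w * u) / poly C w) * ((poly A' w + poly B' w * u) / poly C' w)
       = (poly (A * A' + B * B' * [:a6, a4, a2, 1:]) w + poly (A * B' + B * A' - B * B' * [:a3, a1:]) w * u) / poly (C * C') w"
       if sq: "u * u = poly [:a6, a4, a2, 1:] w - poly [:a3, a1:] w * u" for u w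
    proof -
      have "(poly A w + poly B w * u) * (poly A' w + poly B' w * u) = poly A w * poly A' w
         + (poly A w * poly B' w + poly B w * poly A' w) * u + poly B w * poly B' w * (u * u)"
        by (simp add: algebra_simps)
      also have "\<dots> = poly (A * A' + B * B' * [:a6, a4, a2, 1:]) w + poly (A * B' + B * A' - B * B' * [:a3, a1:]) w * u"
        unfolding sq by (simp add: algebra_simps)
      finally show ?thesis by simp
    qed
    show "R (f * f') (g * g')"
      by (rule R_I[OF _ _ CC mult[OF y_square, folded 1(5) 2(5)] mult[OF y'_square, folded 1(6) 2(6)]])
         (intro K.polys_over_add K.polys_over_diff K.polys_over_mult 1(1,2) 2(1,2); simp)+
  qed
  define \<phi> where "\<phi> f = (THE g. R f g)" for f
  have phi: "\<phi> f = g" if "R f g" for f g unfolding \<phi>_def using that fn by blast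
  have phiR: "R f (\<phi> f)" if "f \<in> F" for f using tot[OF that] phi by blast
  have c: "\<phi> c = c" if "c \<in> K" for c by (rule phi, rule R_I[of "[:c:]" 0 1]) (use that in auto)
  have "hom_on F \<phi>" unfolding hom_on_def
    using c[of 1] phi[OF arith(1)[OF phiR phiR]] phi[OF arith(2)[OF phiR phiR]] by simp
  moreover have "\<phi> x = x'" by (rule phi, rule R_I[of "[:0, 1:]" 0 1]) auto
  moreover have "\<phi> y = y'" by (rule phi, rule R_I[of 0 1 1]) auto
  moreover have "\<phi> ` F \<subseteq> F" using phiR RF by blast
  ultimately show ?thesis using c by blast
qed

lemma aut_if_surj:
  assumes "hom_on F \<phi>" "\<phi> ` F \<subseteq> F" "\<And>c. c \<in> K \<Longrightarrow> \<phi> c = c" "x \<in> \<phi> ` F" "y \<in> \<phi> ` F"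
  shows "\<phi> \<in> Aut"
proof -
  obtain u where u: "u \<in> F" "\<phi> u = x" using assms(4) by auto
  obtain w where w: "w \<in> F" "\<phi> w = y" using assms(5) by auto
  have "F \<subseteq> \<phi> ` F"
  proof
    fix f assume "f \<in> F"
    then obtain A B C where *: "A \<in> Kp" "B \<in> Kp" "C \<in> Kp" "C \<noteq> 0" "f = (poly A x + poly B x * y) / poly C x"
      using rep by blast
    have p: "\<phi> (poly p u) = poly p x" "poly p u \<in> F" if "p \<in> Kp" for p
      using hom_poly[OF assms(1,3) that u(1)] u that by auto
    have "\<phi> ((poly A u + poly B u * w) / poly C u) = f"
      using * p w by (simp add: F.hom_divide[OF assms(1)] F.hom_add[OF assms(1)] F.hom_mult[OF assms(1)])
    moreover have "(poly A u + poly B u * w) / poly C u \<in> F" using * p w by auto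
    ultimately show "f \<in> \<phi> ` F" by blast
  qed
  thus ?thesis using assms by (auto simp: aut_iff)
qed

end


section \<open>Linear equivalences obtained from involutions\<close>

context fpair
begin

text \<open>Linear equivalence of the divisors A + B and C + D; sums of indicators allow for
  coinciding places.\<close>

definition leq :: "'a set \<Rightarrow> 'a set \<Rightarrow> 'a set \<Rightarrow> 'a set \<Rightarrow> bool" where
  "leq A B C D \<longleftrightarrow> (\<exists>f\<in>F - {0}. \<forall>R\<in>Pl.
     v R f = of_bool (R = A) + of_bool (R = B) - of_bool (R = C) - of_bool (R = D))"

end

context wcurve
begin

lemma v_in_places:
  assumes "R \<in> Pl" "f \<in> F" "f \<noteq> 0"
  shows "f \<in> R \<longleftrightarrow> v R f > 0" "f \<in> V R \<longleftrightarrow> v R f \<ge> 0"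
  using V_iff_v[OF discrete[OF assms(1)]] P_iff_v[OF discrete[OF assms(1)]] assms by simp_all

text \<open>Otherwise \<open>t\<close> would be a uniformizer fixed by \<open>\<iota>\<close>, and comparing \<open>t\<close>-adic expansions
  shows that \<open>\<iota>\<close> is trivial.\<close>

lemma unramified_fixed_place:
  assumes i: "\<iota> \<in> Aut" and P: "P \<in> rational_places K F" and inv: "\<iota> ` P = P"
    and t: "t \<in> F" "t \<noteq> 0" "\<iota> t = t" "v P t = 1" and f: "f \<in> V P"
  shows "\<iota> f = f"
proof (rule ccontr)
  assume ne: "\<iota> f \<noteq> f"
  have PP: "P \<in> Pl" using P by (simp add: rational_places_def)
  note D = discrete[OF PP]
  have iV: "\<iota> g \<in> V P" if g: "g \<in> V P" for g
    using image_place_mem(2)[OF i PP V_F[OF PP g]] g unfolding inv by simp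
  have ex: "\<exists>g\<in>V P. f - \<iota> f = t ^ N * g" if "f \<in> V P" for N f
    using that
  proof (induction N arbitrary: f)
    case 0
    have "f - \<iota> f \<in> V P" using V_diff[OF PP 0 iV[OF 0]] .
    thus ?case by (intro bexI[of _ "f - \<iota> f"]) simp_all
  next
    case (Suc N)
    obtain c where c: "c \<in> K" "f - c \<in> P" using P Suc.prems unfolding rational_iff[OF PP] by blast
    have fF: "f \<in> F" using V_F[OF PP Suc.prems] .
    have "\<exists>f1\<in>V P. f - c = t * f1"
    proof (cases "f - c = 0")
      case True thus ?thesis using V_zero[OF PP] by (intro bexI[of _ 0]) simp_all
    next
      case False
      have "v P (f - c) > 0" using v_in_places(1)[OF PP _ False] c fF by simp
      moreover have "v P ((f - c) / t) = v P (f - c) - 1" using v_divide[OF D _ False t(1,2)] c fF t(4) by simp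
      moreover have "(f - c) / t \<in> F" "(f - c) / t \<noteq> 0" using c(1) fF t False by simp_all
      ultimately have "(f - c) / t \<in> V P" using v_in_places(2)[OF PP, of "(f - c) / t"] by simp
      thus ?thesis using t(2) by (intro bexI[of _ "(f - c) / t"]) simp_all
    qed
    then obtain f1 where f1: "f1 \<in> V P" "f - c = t * f1" by blast
    have f1F: "f1 \<in> F" using V_F[OF PP f1(1)] .
    have "\<iota> (f - c) = t * \<iota> f1" unfolding f1(2) using aut_mult[OF i t(1) f1F] t(3) by simp
    hence "\<iota> f - c = t * \<iota> f1" using aut_diff[OF i fF K_F[OF c(1)]] aut_K[OF i c(1)] by simp
    hence e: "f - \<iota> f = t * (f1 - \<iota> f1)" using f1(2) by (simp add: algebra_simps)
    obtain g where "g \<in> V P" "f1 - \<iota> f1 = t ^ N * g" using Suc.IH[OF f1(1)] by blast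
    thus ?case unfolding e by (intro bexI[of _ g]) (simp_all add: mult.assoc)
  qed
  have d: "f - \<iota> f \<noteq> 0" "f - \<iota> f \<in> F" using ne V_F[OF PP] f iV[OF f] by auto
  define N where "N = nat (v P (f - \<iota> f) + 1)"
  obtain g where g: "g \<in> V P" "f - \<iota> f = t ^ N * g" using ex[OF f] by blast
  have gn: "g \<noteq> 0" using d(1) g(2) by auto
  have "v P (f - \<iota> f) = int N + v P g"
    unfolding g(2) using v_mult[OF D _ _ V_F[OF PP g(1)] gn, of "t ^ N"] v_power[OF D t(1,2)] t by simp
  moreover have "v P g \<ge> 0" using v_in_places(2)[OF PP V_F[OF PP g(1)] gn] g(1) by simp
  ultimately show False unfolding N_def by linarith
qed

text \<open>Let \<gamma> be the residue of \<open>w\<close> at \<open>P\<close>. The norm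
  \<open>(w - \<gamma>) * (\<iota> w - \<gamma>)\<close> is divisible by \<open>z - c\<close> (H1),
  so at a zero of \<open>z - c\<close> one of its factors vanishes; since \<open>z\<close> and
  \<open>w\<close> together separate places (H2), that zero is \<open>P\<close> or its image. The
  multiplicity comes from comparing values in this factorisation, where one of \<open>z - c\<close>,
  \<open>w - \<gamma>\<close> is a local parameter (H3). If \<open>P\<close> is not fixed, the
  second factor is a unit. If \<open>P\<close> is fixed, \<open>unramified_fixed_place\<close>
  excludes multiplicity 1, so \<open>w - \<gamma>\<close> is the parameter and the multiplicity is
  2.\<close>

lemma div_involution:
  assumes i: "\<iota> \<in> Aut" and ii: "\<And>f. f \<in> F \<Longrightarrow> \<iota> (\<iota> f) = f" and z: "z \<in> F" "\<iota> z = z" and w: "w \<in> F" "\<iota> w \<noteq> w"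
    and P: "P \<in> rational_places K F" and c: "c \<in> K" "z - c \<in> P" "z - c \<noteq> 0"
    and H0: "\<And>R. R \<in> Pl \<Longrightarrow> z - c \<in> R \<Longrightarrow> w \<in> V R"
    and H1: "\<And>\<gamma>. \<gamma> \<in> K \<Longrightarrow> \<exists>g\<in>Kp. (w - \<gamma>) * (\<iota> w - \<gamma>) = poly g z"
    and H2: "\<And>\<gamma> R R'. \<gamma> \<in> K \<Longrightarrow> R \<in> Pl \<Longrightarrow> z - c \<in> R \<Longrightarrow> w - \<gamma> \<in> R \<Longrightarrow> R' \<in> Pl \<Longrightarrow> z - c \<in> R' \<Longrightarrow> w - \<gamma> \<in> R' \<Longrightarrow> R = R'"
    and H3: "\<And>\<gamma> R. \<gamma> \<in> K \<Longrightarrow> R \<in> Pl \<Longrightarrow> z - c \<in> R \<Longrightarrow> w - \<gamma> \<in> R \<Longrightarrow> v R (z - c) = 1 \<or> v R (w - \<gamma>) = 1"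
    and R: "R \<in> Pl" "z \<in> V R"
  shows "v R (z - c) = of_bool (R = P) + of_bool (R = \<iota> ` P)"
proof -
  have PP: "P \<in> Pl" using P by (simp add: rational_places_def)
  have PP': "\<iota> ` P \<in> Pl" using image_place(1)[OF i PP] .
  note D = discrete[OF PP]
  have zc: "z - c \<in> F" "\<iota> (z - c) = z - c"
    using z c(1) aut_diff[OF i z(1) K_F[OF c(1)]] aut_K[OF i c(1)] by simp_all
  have iwF: "\<iota> w \<in> F" using aut_F[OF i w(1)] .
  have wg: "w - \<gamma> \<noteq> 0" if "\<gamma> \<in> K" for \<gamma>
    using aut_K[OF i that] w(2) by auto
  have bk: "\<iota> ` (\<iota> ` S) = S" if S: "S \<in> Pl" for S
  proof -
    have "(\<lambda>f. \<iota> (\<iota> f)) ` S = id ` S" by (rule image_cong_place[OF S]) (simp add: ii)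
    thus ?thesis by (simp add: image_image)
  qed
  have zS: "z - c \<in> \<iota> ` S" if "S \<in> Pl" "z - c \<in> S" for S
    using image_place_mem(1)[OF i that(1) zc(1)] that(2) zc(2) by simp
  have iwV: "\<iota> w \<in> V S" if S: "S \<in> Pl" "z - c \<in> S" for S
    using image_place_mem(2)[OF i S(1) iwF] H0[OF image_place(1)[OF i S(1)] zS[OF S]] ii[OF w(1)] by simp
  obtain \<gamma> where g: "\<gamma> \<in> K" "w - \<gamma> \<in> P" using P H0[OF PP c(2)] unfolding rational_iff[OF PP] by blast
  obtain \<delta> where d: "\<delta> \<in> K" "\<iota> w - \<delta> \<in> P" using P iwV[OF PP c(2)] unfolding rational_iff[OF PP] by blast
  have iwg: "\<iota> (\<iota> w - \<gamma>') = w - \<gamma>'" "\<iota> (w - \<gamma>') = \<iota> w - \<gamma>'" "\<iota> w - \<gamma>' \<in> F" "w - \<gamma>' \<in> F" if "\<gamma>' \<in> K" for \<gamma>'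
    using aut_diff[OF i iwF K_F[OF that]] aut_diff[OF i w(1) K_F[OF that]] aut_K[OF i that] ii[OF w(1)] iwF w(1) that by simp_all
  have iwn: "\<iota> w - \<gamma>' \<noteq> 0" if "\<gamma>' \<in> K" for \<gamma>'
    using wg[OF that] iwg(1)[OF that] aut_zero[OF i] by metis
  obtain p where p: "p \<in> Kp" "(w - \<gamma>) * (\<iota> w - \<gamma>) = poly p z" using H1[OF g(1)] by blast
  obtain q where q: "q \<in> Kp" "\<And>u. poly p u - poly p c = (u - c) * poly q u" using poly_root_diff[OF p(1) c(1)] by blast
  have zV: "z \<in> V S" if S: "S \<in> Pl" "z - c \<in> S" for S
    using V_add[OF S(1) P_V[OF S] K_V[OF S(1) c(1)]] by simp
  \<comment> \<open>The norm lies in \<open>P\<close> and is congruent to the constant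
    \<open>poly p c\<close> there.\<close>
  have "poly p c = 0"
  proof -
    have "(w - \<gamma>) * (\<iota> w - \<gamma>) \<in> P"
      using P_mult2[OF PP g(2) V_diff[OF PP iwV[OF PP c(2)] K_V[OF PP g(1)]]] .
    moreover have "(z - c) * poly q z \<in> P" using P_mult2[OF PP c(2) poly_V[OF PP q(1) zV[OF PP c(2)]]] .
    ultimately have "poly p z - (z - c) * poly q z \<in> P" using P_diff[OF PP] p(2) by simp
    moreover have "poly p z - (z - c) * poly q z = poly p c" using q(2)[of z] by (simp add: algebra_simps)
    moreover have "poly p c \<in> K" using p(1) c(1) by (intro K.poly_mem[of _ _ K]) simp_all
    ultimately show ?thesis using K_P[OF PP] by simp
  qed
  hence factor: "(w - \<gamma>) * (\<iota> w - \<gamma>) = (z - c) * poly q z" using q(2)[of z] p(2) by simp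
  have hn: "poly q z \<noteq> 0" using factor wg[OF g(1)] iwn[OF g(1)] c(3) by auto
  have hF: "poly q z \<in> F" using q(1) z(1) by simp
  have PR: "R = P \<or> R = \<iota> ` P" if zR: "z - c \<in> R"
  proof -
    have "(w - \<gamma>) * (\<iota> w - \<gamma>) \<in> R" unfolding factor using P_mult2[OF R(1) zR poly_V[OF R(1) q(1) R(2)]] .
    moreover have "w - \<gamma> \<in> V R" "\<iota> w - \<gamma> \<in> V R"
      using V_diff[OF R(1) H0[OF R(1) zR] K_V[OF R(1) g(1)]] V_diff[OF R(1) iwV[OF R(1) zR] K_V[OF R(1) g(1)]] by simp_all
    ultimately consider "w - \<gamma> \<in> R" | "\<iota> w - \<gamma> \<in> R" using P_prime[OF R(1)] by blast
    thus ?thesis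
    proof cases
      case 1
      show ?thesis using H2[OF g(1) R(1) zR 1 PP c(2) g(2)] by simp
    next
      case 2
      have "w - \<gamma> \<in> \<iota> ` R" using image_place_mem(1)[OF i R(1) iwg(3)[OF g(1)]] 2 iwg(1)[OF g(1)] by simp
      from H2[OF g(1) image_place(1)[OF i R(1)] zS[OF R(1) zR] this PP c(2) g(2)] have "\<iota> ` R = P" .
      thus ?thesis using bk[OF R(1)] by simp
    qed
  qed
  have vsum: "v P (w - \<gamma>) + v P (\<iota> w - \<gamma>) = v P (z - c) + v P (poly q z)"
    using v_mult[OF D iwg(4)[OF g(1)] wg[OF g(1)] iwg(3)[OF g(1)] iwn[OF g(1)]] v_mult[OF D zc(1) c(3) hF hn] factor by simp
  have vh: "v P (poly q z) \<ge> 0" using v_in_places(2)[OF PP hF hn] poly_V[OF PP q(1) zV[OF PP c(2)]] by simp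
  have vz: "v P (z - c) \<ge> 1" using v_in_places(1)[OF PP zc(1) c(3)] c(2) by simp
  have val: "v P (z - c) = (if \<iota> ` P = P then 2 else 1)"
  proof (cases "\<iota> ` P = P")
    case False
    have "\<gamma> \<noteq> \<delta>"
    proof
      assume e: "\<gamma> = \<delta>"
      have "w - \<gamma> \<in> \<iota> ` P" using image_place_mem(1)[OF i PP iwg(3)[OF d(1)]] d(2) iwg(1)[OF d(1)] e by simp
      from H2[OF g(1) PP' zS[OF PP c(2)] this PP c(2) g(2)] show False using False by simp
    qed
    have "\<iota> w - \<gamma> \<notin> P"
    proof
      assume "\<iota> w - \<gamma> \<in> P"
      from P_diff[OF PP d(2) this] have "\<gamma> - \<delta> \<in> P" by simp
      hence "\<gamma> - \<delta> = 0" using K_P[OF PP, of "\<gamma> - \<delta>"] g(1) d(1) by simp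
      thus False using \<open>\<gamma> \<noteq> \<delta>\<close> by simp
    qed
    hence "v P (\<iota> w - \<gamma>) = 0" using v_unit[OF D V_diff[OF PP iwV[OF PP c(2)] K_V[OF PP g(1)]]] by simp
    moreover have "v P (z - c) = 1 \<or> v P (w - \<gamma>) = 1" using H3[OF g(1) PP c(2) g(2)] .
    ultimately show ?thesis using vsum vh vz False by auto
  next
    case True
    have "v P (z - c) \<noteq> 1"
      using unramified_fixed_place[OF i P True zc(1) c(3) zc(2) _ H0[OF PP c(2)]] w(2) by blast
    moreover from this have w1: "v P (w - \<gamma>) = 1" using H3[OF g(1) PP c(2) g(2)] by blast
    moreover have "v P (\<iota> w - \<gamma>) = 1"
      using image_v[OF i D iwg(4)[OF g(1)] wg[OF g(1)]] iwg(2)[OF g(1)] True w1 by simp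
    ultimately show ?thesis using vsum vh vz True by auto
  qed
  have val': "v (\<iota> ` P) (z - c) = v P (z - c)" using image_v[OF i D zc(1) c(3)] zc(2) by simp
  show ?thesis
  proof (cases "z - c \<in> R")
    case True
    from PR[OF this] show ?thesis
    proof
      assume r: "R = P"
      show ?thesis unfolding r val by (cases "\<iota> ` P = P") auto
    next
      assume r: "R = \<iota> ` P"
      show ?thesis unfolding r val' val by (cases "\<iota> ` P = P") auto
    qed
  next
    case False
    have "R \<noteq> P" "R \<noteq> \<iota> ` P" using False c(2) zS[OF PP c(2)] by auto
    moreover have "v R (z - c) = 0"
      using v_unit[OF discrete[OF R(1)] V_diff[OF R(1,2) K_V[OF R(1) c(1)]] False] .
    ultimately show ?thesis by simp
  qed
qed

lemma leq_involution:
  assumes i: "\<iota> \<in> Aut" and ii: "\<And>f. f \<in> F \<Longrightarrow> \<iota> (\<iota> f) = f" and z: "z \<in> F" "\<iota> z = z" "z \<notin> K" and w: "w \<in> F" "\<iota> w \<noteq> w"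
    and poles: "\<And>R. R \<in> Pl \<Longrightarrow> z \<notin> V R \<longleftrightarrow> R = \<O> \<or> R = Q"
       "\<And>R. R \<in> Pl \<Longrightarrow> z \<notin> V R \<Longrightarrow> v R z = - of_bool (R = \<O>) - of_bool (R = Q)"
    and Q: "Q \<in> Pl" "\<iota> ` \<O> = Q" "\<iota> ` Q = \<O>"
    and H0: "\<And>R c. R \<in> Pl \<Longrightarrow> c \<in> K \<Longrightarrow> z - c \<in> R \<Longrightarrow> w \<in> V R"
    and H1: "\<And>\<gamma>. \<gamma> \<in> K \<Longrightarrow> \<exists>g\<in>Kp. (w - \<gamma>) * (\<iota> w - \<gamma>) = poly g z"
    and H2: "\<And>c \<gamma> R R'. c \<in> K \<Longrightarrow> \<gamma> \<in> K \<Longrightarrow> R \<in> Pl \<Longrightarrow> z - c \<in> R \<Longrightarrow> w - \<gamma> \<in> R \<Longrightarrow> R' \<in> Pl \<Longrightarrow> z - c \<in> R' \<Longrightarrow> w - \<gamma> \<in> R' \<Longrightarrow> R = R'"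
    and H3: "\<And>c \<gamma> R. c \<in> K \<Longrightarrow> \<gamma> \<in> K \<Longrightarrow> R \<in> Pl \<Longrightarrow> z - c \<in> R \<Longrightarrow> w - \<gamma> \<in> R \<Longrightarrow> v R (z - c) = 1 \<or> v R (w - \<gamma>) = 1"
    and P: "P \<in> rational_places K F"
  shows "leq P (\<iota> ` P) \<O> Q"
proof -
  have PP: "P \<in> Pl" using P by (simp add: rational_places_def)
  show ?thesis
  proof (cases "z \<in> V P")
    case False
    hence "P = \<O> \<or> P = Q" using poles(1)[OF PP] by simp
    hence "P = \<O> \<and> \<iota> ` P = Q \<or> P = Q \<and> \<iota> ` P = \<O>" using Q(2,3) by blast
    hence "of_bool (R = P) + of_bool (R = \<iota> ` P) - of_bool (R = \<O>) - of_bool (R = Q) = (0::int)" for R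
      by (elim disjE conjE) simp_all
    thus ?thesis unfolding leq_def using v_one[OF discrete] by (intro bexI[of _ 1]) simp_all
  next
    case True
    obtain c where c: "c \<in> K" "z - c \<in> P" using P True unfolding rational_iff[OF PP] by blast
    have zn: "z - c \<noteq> 0" using c(1) z(3) by (metis right_minus_eq)
    have zF: "z - c \<in> F" using z(1) c(1) by simp
    have "v R (z - c) = of_bool (R = P) + of_bool (R = \<iota> ` P) - of_bool (R = \<O>) - of_bool (R = Q)" if R: "R \<in> Pl" for R
    proof (cases "z \<in> V R")
      case True
      hence "R \<noteq> \<O>" "R \<noteq> Q" using poles(1)[OF R] by auto
      moreover have "v R (z - c) = of_bool (R = P) + of_bool (R = \<iota> ` P)"
      proof (rule div_involution[OF i _ z(1,2) w P c zn _ _ _ _ R True])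
        show "\<iota> (\<iota> f) = f" if "f \<in> F" for f using ii[OF that] .
        show "w \<in> V S" if "S \<in> Pl" "z - c \<in> S" for S using H0[OF that(1) c(1) that(2)] .
        show "\<exists>g\<in>Kp. (w - \<gamma>) * (\<iota> w - \<gamma>) = poly g z" if "\<gamma> \<in> K" for \<gamma> using H1[OF that] .
        show "S = S'" if "\<gamma> \<in> K" "S \<in> Pl" "z - c \<in> S" "w - \<gamma> \<in> S" "S' \<in> Pl" "z - c \<in> S'" "w - \<gamma> \<in> S'" for \<gamma> S S'
          using H2[OF c(1) that] .
        show "v S (z - c) = 1 \<or> v S (w - \<gamma>) = 1" if "\<gamma> \<in> K" "S \<in> Pl" "z - c \<in> S" "w - \<gamma> \<in> S" for \<gamma> S
          using H3[OF c(1) that] .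
      qed
      ultimately show ?thesis by simp
    next
      case False
      have z0: "z \<noteq> 0" using False V_zero[OF R] by auto
      have vz: "v R z < 0" using v_in_places(2)[OF R z(1) z0] False by simp
      have cc: "- c = 0 \<or> v R z < v R (- c)" using v_K[OF discrete[OF R], of "- c"] vz c(1) by (cases "c = 0") simp_all
      have "v R (z + - c) = v R z" by (rule v_add_less(2)[OF discrete[OF R] z(1) z0 _ cc]) (use c(1) in simp)
      moreover have "R \<noteq> P" using False \<open>z \<in> V P\<close> by auto
      moreover have "R \<noteq> \<iota> ` P"
      proof
        assume e: "R = \<iota> ` P"
        have "z \<in> V R" unfolding e using image_place_mem(2)[OF i PP z(1)] \<open>z \<in> V P\<close> z(2) by simp
        thus False using False by simp
      qed
      ultimately show ?thesis using poles(2)[OF R False] by simp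
    qed
    thus ?thesis unfolding leq_def using zF zn by (intro bexI[of _ "z - c"]) simp_all
  qed
qed

lemma involution_if:
  assumes i: "\<iota> \<in> Aut" "\<iota> (\<iota> x) = x" "\<iota> (\<iota> y) = y" "f \<in> F"
  shows "\<iota> (\<iota> f) = f"
proof -
  have h: "hom_on F (\<iota> \<circ> \<iota>)" using comp_aut[OF i(1) i(1)] by (rule aut_hom)
  have "(\<iota> \<circ> \<iota>) f = id f"
    by (rule hom_unique[OF h aut_hom[OF id_aut]]) (use i aut_K[OF i(1)] in simp_all)
  thus ?thesis by simp
qed

text \<open>\<open>leq_involution\<close> with \<open>z = x\<close> and \<open>w = y\<close>:
  conjugation over \<open>K(x)\<close> fixes \<open>x\<close>, whose only pole \<O> is
  double.\<close>

lemma ex_negation: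
  "\<exists>\<iota>\<in>Aut. \<iota> x = x \<and> \<iota> y = - y - a1 * x - a3 \<and> (\<forall>f\<in>F. \<iota> (\<iota> f) = f)
     \<and> \<iota> ` \<O> = \<O> \<and> (\<forall>P\<in>rational_places K F. leq P (\<iota> ` P) \<O> \<O>)"
proof -
  define y' where "y' = - y - a1 * x - a3"
  have y'F: "y' \<in> F" by (simp add: y'_def)
  have "y'^2 + a1 * x * y' + a3 * y' = y^2 + a1 * x * y + a3 * y"
    by (simp add: y'_def algebra_simps power2_eq_square)
  hence eq: "y'^2 + a1 * x * y' + a3 * y' = x^3 + a2 * x^2 + a4 * x + a6" using curve by simp
  obtain \<phi> where f: "hom_on F \<phi>" "\<phi> ` F \<subseteq> F" "\<forall>c\<in>K. \<phi> c = c" "\<phi> x = x" "\<phi> y = y'"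
    using ex_hom[OF xF y'F eq x_trans] by blast
  have yy: "\<phi> y' = y"
    using f(3-5) unfolding y'_def
    by (simp add: F.hom_diff[OF f(1)] F.hom_uminus[OF f(1)] F.hom_mult[OF f(1)])
  have i: "\<phi> \<in> Aut"
  proof (rule aut_if_surj[OF f(1,2)])
    show "\<phi> c = c" if "c \<in> K" for c using f(3) that by simp
    show "x \<in> \<phi> ` F" by (rule image_eqI[of _ _ x]) (simp_all add: f(4))
    show "y \<in> \<phi> ` F" by (rule image_eqI[of _ _ y']) (simp_all add: yy y'F)
  qed
  have ii: "\<phi> (\<phi> g) = g" if "g \<in> F" for g
    by (rule involution_if[OF i _ _ that]) (simp_all add: f(4,5) yy)
  \<comment> \<open>A fixed \<open>y\<close> would give \<open>2 * y + a1 * x + a3 = 0\<close>, so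
    all three coefficients would vanish.\<close>
  have ne: "\<phi> y \<noteq> y"
  proof
    assume "\<phi> y = y"
    hence "poly [:a3, a1:] x + poly [:2:] x * y = 0" using f(5) unfolding y'_def by (simp add: algebra_simps)
    from AB_zero[OF _ _ this] have "[:a3, a1:] = 0" "[:2::'a:] = 0" by simp_all
    thus False using separable by simp
  qed
  have inv: "\<phi> ` \<O> = \<O>"
  proof (rule inf_eqI[OF image_place(1)[OF i inf_place(1)]])
    show "x \<notin> V (\<phi> ` \<O>)" using image_place_mem(2)[OF i inf_place(1) xF] f(4) inf_place(2) by simp
  qed
  have xK: "x \<notin> K"
  proof
    assume "x \<in> K"
    hence "[:- x, 1:] \<in> Kp" by simp
    thus False using x_trans[of "[:- x, 1:]"] by simp
  qed
  have "leq P (\<phi> ` P) \<O> \<O>" if P: "P \<in> rational_places K F" for P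
  proof (rule leq_involution[OF i ii xF f(4) xK yF ne])
    fix R assume R: "R \<in> Pl"
    show "x \<notin> V R \<longleftrightarrow> R = \<O> \<or> R = \<O>" using inf_eqI[OF R] inf_place(2) by auto
    assume "x \<notin> V R"
    thus "v R x = - of_bool (R = \<O>) - of_bool (R = \<O>)" using v_xy(1)[OF R] inf_eqI[OF R] by simp
  next
    show "y \<in> V R" if R: "R \<in> Pl" "c \<in> K" "x - c \<in> R" for R c
      using y_V[OF R(1)] V_add[OF R(1) P_V[OF R(1,3)] K_V[OF R(1,2)]] by simp
  next
    fix \<gamma> assume g: "\<gamma> \<in> K"
    have "(y - \<gamma>) * (\<phi> y - \<gamma>) = \<gamma>^2 + \<gamma> * (a1 * x + a3) - (y^2 + a1 * x * y + a3 * y)"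
      unfolding f(5) y'_def by (simp add: algebra_simps power2_eq_square)
    also have "\<dots> = poly [:\<gamma>^2 + \<gamma> * a3 - a6, \<gamma> * a1 - a4, - a2, - 1:] x"
      unfolding curve by (simp add: algebra_simps power2_eq_square power3_eq_cube)
    finally show "\<exists>g\<in>Kp. (y - \<gamma>) * (\<phi> y - \<gamma>) = poly g x" 
      by (rule bexI) (use g in simp)
  next
    fix c \<gamma> R R'
    assume *: "c \<in> K" "\<gamma> \<in> K" "R \<in> Pl" "x - c \<in> R" "y - \<gamma> \<in> R" "R' \<in> Pl" "x - c \<in> R'" "y - \<gamma> \<in> R'"
    show "R = R'" by (rule at_unique[of R c \<gamma> R']) (simp_all add: place_at_def *)
  next
    fix c \<gamma> R
    assume *: "c \<in> K" "\<gamma> \<in> K" "R \<in> Pl" "x - c \<in> R" "y - \<gamma> \<in> R"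
    have "place_at R c \<gamma>" by (simp add: place_at_def *)
    from v_lpar[OF this] show "v R (x - c) = 1 \<or> v R (y - \<gamma>) = 1" unfolding lpar_def by (auto split: if_splits)
  qed (use inf_place(1) inv P in simp_all)
  thus ?thesis using i f(4,5) ii inv unfolding y'_def by blast
qed

end


section \<open>Lines through a point and the translations\<close>

context wcurve
begin

lemma curve_diff:
  assumes "b^2 + a1 * a * b + a3 * b = a^3 + a2 * a^2 + a4 * a + a6"
  shows "(y - b) * (y + b + a1 * x + a3) = (x - a) * (x^2 + a * x + a^2 + a2 * (x + a) + a4 - a1 * b)"
proof -
  have "(y - b) * (y + b + a1 * x + a3) - (x - a) * (x^2 + a * x + a^2 + a2 * (x + a) + a4 - a1 * b)
    = (y^2 + a1 * x * y + a3 * y) - (x^3 + a2 * x^2 + a4 * x + a6)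
      - ((b^2 + a1 * a * b + a3 * b) - (a^3 + a2 * a^2 + a4 * a + a6))"
    by (simp add: algebra_simps power2_eq_square power3_eq_cube)
  also have "\<dots> = 0" unfolding curve assms by simp
  finally show ?thesis by simp
qed

text \<open>The Weierstrass equation restricted to the line of slope \<open>z\<close> through
  \<open>(a, -b)\<close>, expanded in the distance \<open>t\<close> of the abscissa from
  \<open>a\<close>. The constant term is the defect at that point; when it vanishes, a quadratic in
  \<open>t\<close> remains.\<close>

lemma line_identity:
  fixes a b z t :: 'a
  shows "(z * t - b)^2 + a1 * (a + t) * (z * t - b) + a3 * (z * t - b) - ((a + t)^3 + a2 * (a + t)^2 + a4 * (a + t) + a6)
    = (b^2 - a1 * a * b - a3 * b - (a^3 + a2 * a^2 + a4 * a + a6))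
      + t * (z * (a1 * a + a3 - 2 * b) - (a1 * b + 3 * a^2 + 2 * a2 * a + a4) + t * (z^2 + a1 * z - 3 * a - a2 - t))"
  by (simp add: algebra_simps power2_eq_square power3_eq_cube)

text \<open>The line of slope \<open>chord_z a b\<close> through \<open>(a, -b - a1 a - a3)\<close> and \<open>(x, y)\<close> meets the curve
  in the third point \<open>(chord_x a b, chord_y a b)\<close>.\<close>

definition "chord_z a b = (y + (b + a1 * a + a3)) / (x - a)"
definition "chord_x a b = chord_z a b ^ 2 + a1 * chord_z a b - a2 - a - x"
definition "chord_y a b = chord_z a b * (chord_x a b - a) - (b + a1 * a + a3)"

lemma x_not_K: "x \<notin> K"
proof
  assume "x \<in> K"
  hence "[:- x, 1:] \<in> Kp" by simp
  thus False using x_trans[of "[:- x, 1:]"] by simp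
qed

lemma trans_shift:
  assumes "c \<in> K" "\<And>p. p \<in> Kp \<Longrightarrow> poly p (h - c) = 0 \<Longrightarrow> p = 0" "p \<in> Kp" "poly p h = 0"
  shows "p = 0"
proof -
  have "pcompose p [:c, 1:] \<in> Kp" using assms(3)
  proof (induction rule: K.polys_over_induct)
    case (pCons a p)
    have "[:c, 1:] \<in> Kp" using assms(1) by simp
    from K.polys_over_mult[OF this pCons(4)] show ?case unfolding pcompose_pCons
      using pCons(1) by (intro K.polys_over_add) simp_all
  qed simp
  moreover have "poly (pcompose p [:c, 1:]) (h - c) = 0" using assms(4) by (simp add: poly_pcompose)
  ultimately have "pcompose p [:c, 1:] = 0" by (rule assms(2))
  thus ?thesis by (subst (asm) pcompose_eq_0_iff) simp_all
qed

context
  fixes a b assumes ab: "a \<in> K" "b \<in> K" "b^2 + a1 * a * b + a3 * b = a^3 + a2 * a^2 + a4 * a + a6"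
begin

lemma xa_nz: "x - a \<noteq> 0"
  using x_not_K ab(1) by (metis right_minus_eq)

lemma chord_F [simp]: "chord_z a b \<in> F" "chord_x a b \<in> F" "chord_y a b \<in> F"
  using ab by (simp_all add: chord_z_def chord_x_def chord_y_def)

lemma y_chord: "y = chord_z a b * (x - a) - (b + a1 * a + a3)"
  using xa_nz by (simp add: chord_z_def)

lemma conj_curve: "(b + a1 * a + a3)^2 - a1 * a * (b + a1 * a + a3) - a3 * (b + a1 * a + a3) - (a^3 + a2 * a^2 + a4 * a + a6) = 0"
proof -
  have "(b + a1 * a + a3)^2 - a1 * a * (b + a1 * a + a3) - a3 * (b + a1 * a + a3) = b^2 + a1 * a * b + a3 * b"
    by (simp add: algebra_simps power2_eq_square)
  thus ?thesis using ab(3) by simp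
qed

text \<open>Up to sign, the derivative of the equation with respect to \<open>x\<close> at the
  conjugate point \<open>(a, -b - a1 * a - a3)\<close>.\<close>

definition "tang = a1 * (b + a1 * a + a3) + 3 * a^2 + 2 * a2 * a + a4"

lemma tang_K [simp]: "tang \<in> K" using ab by (simp add: tang_def)

text \<open>\<open>x - a\<close> and \<open>chord_x a b - a\<close> are the two roots of the
  quadratic left by \<open>line_identity\<close>. Their sum is built into \<open>chord_x\<close>;
  this is their product.\<close>

lemma chord_prod: "(x - a) * (chord_x a b - a) = chord_z a b * (2 * b + a1 * a + a3) + tang"
proof -
  define b' where "b' = b + a1 * a + a3"
  define z where "z = chord_z a b"
  define t where "t = x - a"
  have y: "y = z * t - b'" using y_chord by (simp only: z_def t_def b'_def)
  have x: "x = a + t" by (simp add: t_def)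
  have "t * (z * (a1 * a + a3 - 2 * b') - (a1 * b' + 3 * a^2 + 2 * a2 * a + a4) + t * (z^2 + a1 * z - 3 * a - a2 - t)) = 0"
    using line_identity[of z t b' a] curve conj_curve unfolding b'_def[symmetric] y[symmetric] x[symmetric] by simp
  hence e1: "z * (a1 * a + a3 - 2 * b') - (a1 * b' + 3 * a^2 + 2 * a2 * a + a4) + t * (z^2 + a1 * z - 3 * a - a2 - t) = 0"
    using xa_nz t_def by simp
  have e3: "t * (z^2 + a1 * z - 3 * a - a2 - t) = t * (chord_x a b - a)"
    by (simp add: chord_x_def z_def[symmetric] t_def algebra_simps)
  have e2: "z * (a1 * a + a3 - 2 * b') = - (z * (2 * b + a1 * a + a3))" by (simp add: b'_def algebra_simps)
  have gen: "r - (q + s) = 0" if "p - s + u = 0" "u = r" "p = - q" for p q r s u :: 'a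
    using that by (simp add: algebra_simps)
  from gen[OF e1 e3 e2] show ?thesis by (simp add: tang_def t_def z_def b'_def)
qed

text \<open>The second root of the quadratic also gives a point of the curve.\<close>

lemma chord_curve: "chord_y a b ^ 2 + a1 * chord_x a b * chord_y a b + a3 * chord_y a b
    = chord_x a b ^ 3 + a2 * chord_x a b ^ 2 + a4 * chord_x a b + a6"
proof -
  define b' where "b' = b + a1 * a + a3"
  define z where "z = chord_z a b"
  define t where "t = chord_x a b - a"
  have y: "chord_y a b = z * t - b'" by (simp add: chord_y_def z_def t_def b'_def)
  have x: "chord_x a b = a + t" by (simp add: t_def)
  have e: "z^2 + a1 * z - 3 * a - a2 - t = x - a" by (simp add: t_def chord_x_def z_def algebra_simps)
  have "z * (a1 * a + a3 - 2 * b') - (a1 * b' + 3 * a^2 + 2 * a2 * a + a4) + t * (z^2 + a1 * z - 3 * a - a2 - t)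
     = (x - a) * t - (z * (2 * b + a1 * a + a3) + tang)"
    unfolding e by (simp add: b'_def tang_def algebra_simps)
  also have "\<dots> = 0" unfolding z_def t_def chord_prod by simp
  finally have "chord_y a b ^ 2 + a1 * chord_x a b * chord_y a b + a3 * chord_y a b
    - (chord_x a b ^ 3 + a2 * chord_x a b ^ 2 + a4 * chord_x a b + a6) = 0"
    using line_identity[of z t b' a] conj_curve unfolding b'_def[symmetric] y[symmetric] x[symmetric] by simp
  thus ?thesis by simp
qed

lemma chord_z_not_K: "chord_z a b \<notin> K"
proof
  assume z: "chord_z a b \<in> K"
  have "poly [:chord_z a b * a + (b + a1 * a + a3), - chord_z a b:] x + poly [:1:] x * y = 0"
    using y_chord by (simp add: algebra_simps)
  from AB_zero(2)[OF _ _ this] z ab show False by simp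
qed

text \<open>Otherwise \<open>chord_prod\<close> is a linear equation for the slope over
  \<open>K\<close>. If its leading coefficient is nonzero, the slope would be constant; if it is
  zero, both partial derivatives vanish at \<open>(a, b)\<close>.\<close>

lemma chord_x_nz: "chord_x a b - a \<noteq> 0"
proof
  assume "chord_x a b - a = 0"
  hence e: "chord_z a b * (2 * b + a1 * a + a3) + tang = 0" using chord_prod by simp
  show False
  proof (cases "2 * b + a1 * a + a3 = 0")
    case True
    hence bb: "b + a1 * a + a3 = - b" by (simp add: eq_neg_iff_add_eq_0 algebra_simps)
    have "tang = (3 * a^2 + 2 * a2 * a + a4) - a1 * b" unfolding tang_def bb by simp
    hence "a1 * b = 3 * a^2 + 2 * a2 * a + a4" using e unfolding True by simp
    thus False using smooth[OF ab] True by simp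
  next
    case False
    have "chord_z a b * (2 * b + a1 * a + a3) = - tang" using e by (simp only: eq_neg_iff_add_eq_0)
    hence "chord_z a b = - tang / (2 * b + a1 * a + a3)" by (simp only: nonzero_eq_divide_eq[OF False])
    moreover have "- tang / (2 * b + a1 * a + a3) \<in> K" using ab by simp
    ultimately show False using chord_z_not_K by simp
  qed
qed

lemma v_inf_chord: "v \<O> (x - a) = - 2" "chord_z a b \<noteq> 0" "v \<O> (chord_z a b) = - 1"
proof -
  note D = discrete[OF inf_place(1)]
  show xa: "v \<O> (x - a) = - 2" using v_poly_neg[OF inf_place(1) xF inf_place(2), of "[:- a, 1:]"] v_inf ab by simp
  have bK: "[:b + a1 * a + a3:] \<in> Kp" "[:1:] \<in> Kp" using ab by simp_all
  have nz: "[:b + a1 * a + a3:] \<noteq> 0 \<or> [:1:] \<noteq> (0 :: 'a poly)" by simp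
  have yb: "poly [:b + a1 * a + a3:] x + poly [:1:] x * y \<noteq> 0"
    "v \<O> (poly [:b + a1 * a + a3:] x + poly [:1:] x * y) = - int (deg2 [:b + a1 * a + a3:] [:1::'a:])"
    by (rule v_AB[OF inf_place bK nz])+
  have e: "poly [:b + a1 * a + a3:] x + poly [:1:] x * y = y + (b + a1 * a + a3)" by simp
  have d: "deg2 [:b + a1 * a + a3:] [:1::'a:] = 3" by (simp add: deg2_def)
  show "chord_z a b \<noteq> 0" using yb(1) xa_nz unfolding e chord_z_def by simp
  show "v \<O> (chord_z a b) = - 1" unfolding chord_z_def
    using v_divide[OF D _ yb(1)[unfolded e] _ xa_nz] yb(2) xa ab unfolding e d by simp
qed

text \<open>As the moving point tends to \<O>, the line tends to the vertical line through the
  conjugate of \<open>(a, b)\<close>, whose third intersection is \<open>(a, b)\<close>. In terms of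
  values, \<open>u\<close> has value 2 and \<open>z * u\<close> has value 1 at \<O>.\<close>

lemma inf_chord: "chord_x a b - a \<in> \<O>" "chord_y a b - b \<in> \<O>"
proof -
  note D = discrete[OF inf_place(1)]
  define u where "u = inverse (x - a)"
  define z where "z = chord_z a b"
  define W where "W = 2 * b + a1 * a + a3"
  have WK: "W \<in> K" using ab by (simp add: W_def)
  have uF: "u \<in> F" "u \<noteq> 0" using xa_nz ab by (simp_all add: u_def)
  have zF: "z \<in> F" "z \<noteq> 0" using v_inf_chord(2) ab by (simp_all add: z_def)
  have vu: "v \<O> u = 2" using v_inverse[OF D _ xa_nz] v_inf_chord(1) ab by (simp add: u_def)
  have uO: "u \<in> \<O>" using v_in_places(1)[OF inf_place(1) uF] vu by simp
  have "v \<O> (z * u) = 1" using v_mult[OF D zF uF] vu v_inf_chord(3) by (simp add: z_def)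
  hence zuO: "z * u \<in> \<O>" using v_in_places(1)[OF inf_place(1), of "z * u"] zF uF by simp
  note PO = inf_place(1)
  have ux: "u * (x - a) = 1" using xa_nz by (simp add: u_def)
  have m: "c \<in> K \<Longrightarrow> g \<in> \<O> \<Longrightarrow> g * c \<in> \<O>" for c g using P_mult2[OF PO _ K_V[OF PO]] by simp
  have xa': "chord_x a b - a = z * u * W + u * tang"
  proof -
    have "chord_x a b - a = u * (x - a) * (chord_x a b - a)" unfolding ux by simp
    also have "\<dots> = u * (z * W + tang)" unfolding mult.assoc chord_prod z_def W_def ..
    also have "\<dots> = z * u * W + u * tang" by (simp add: algebra_simps)
    finally show ?thesis .
  qed
  show 1: "chord_x a b - a \<in> \<O>" unfolding xa' by (intro P_add[OF PO] m WK tang_K uO zuO)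
  \<comment> \<open>The square of the slope grows like \<open>x - a\<close>, so
    \<open>z * (z * u)\<close> is 1 modulo \<O>.\<close>
  have zz: "z * (z * u) - 1 = (chord_x a b - a) * u - z * u * a1 + u * (3 * a + a2)"
  proof -
    have "z^2 = (x - a) + (chord_x a b - a) - a1 * z + (3 * a + a2)" by (simp add: chord_x_def z_def algebra_simps)
    hence "u * z^2 = u * ((x - a) + (chord_x a b - a) - a1 * z + (3 * a + a2))" by simp
    also have "\<dots> = u * (x - a) + ((chord_x a b - a) * u - z * u * a1 + u * (3 * a + a2))"
      by (simp add: algebra_simps)
    finally show ?thesis unfolding ux by (simp add: power2_eq_square mult_ac)
  qed
  have zzO: "z * (z * u) - 1 \<in> \<O>" unfolding zz
    by (intro P_add[OF PO] P_diff[OF PO] P_mult2[OF PO 1 P_V[OF PO uO]] m uO zuO aK K.add_mem K.mult_mem K.numeral_mem ab)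
  have "chord_y a b - b = (z * (z * u) - 1) * W + z * u * tang"
    unfolding chord_y_def z_def[symmetric] xa' by (simp add: W_def algebra_simps)
  thus "chord_y a b - b \<in> \<O>" using P_add[OF PO m[OF WK zzO] m[OF tang_K zuO]] by simp
qed

text \<open>Exchanging the two moving points of a line through the conjugate of
  \<open>(a, b)\<close> preserves its slope. So \<open>leq_involution\<close> applies with
  \<open>z = chord_z a b\<close> and \<open>w = x\<close>: the numerator of the slope cancels the
  zero of \<open>x - a\<close> at the conjugate point, leaving simple poles at \<O> and at the place
  above \<open>(a, b)\<close>, which is the image of \<O>.\<close>

lemma ex_chord_involution:
  "\<exists>\<iota>\<in>Aut. \<iota> x = chord_x a b \<and> \<iota> y = chord_y a b \<and> place_at (\<iota> ` \<O>) a b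
     \<and> (\<forall>P\<in>rational_places K F. leq P (\<iota> ` P) \<O> (\<iota> ` \<O>))"
proof -
  have tr: "p = 0" if "p \<in> Kp" "poly p (chord_x a b) = 0" for p
    by (rule trans_shift[OF ab(1) h_trans[OF inf_place(1) inf_chord(1) chord_x_nz] that])
  obtain \<phi> where f: "hom_on F \<phi>" "\<phi> ` F \<subseteq> F" "\<forall>c\<in>K. \<phi> c = c" "\<phi> x = chord_x a b" "\<phi> y = chord_y a b"
    using ex_hom[OF chord_F(2,3) chord_curve tr] by blast
  have fK: "\<phi> c = c" if "c \<in> K" for c using f(3) that by simp
  have cz: "\<phi> (chord_z a b) = chord_z a b"
  proof -
    have "\<phi> (chord_z a b) = (chord_y a b + (b + a1 * a + a3)) / (chord_x a b - a)"
      unfolding chord_z_def using ab f(4,5)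
      by (simp add: F.hom_divide[OF f(1)] F.hom_add[OF f(1)] F.hom_diff[OF f(1)] F.hom_mult[OF f(1)] fK)
    thus ?thesis using chord_x_nz by (simp add: chord_y_def)
  qed
  have cx: "\<phi> (chord_x a b) = x"
  proof -
    have "\<phi> (z ^ 2 + a1 * z - a2 - a - x) = z ^ 2 + a1 * z - a2 - a - \<phi> x" if "z \<in> F" "\<phi> z = z" for z
      using ab that by (simp add: F.hom_power[OF f(1)] F.hom_add[OF f(1)] F.hom_diff[OF f(1)] F.hom_mult[OF f(1)] fK)
    from this[OF chord_F(1) cz] have "\<phi> (chord_x a b) = chord_z a b ^ 2 + a1 * chord_z a b - a2 - a - \<phi> x"
      by (simp only: chord_x_def)
    hence "\<phi> (chord_x a b) = chord_z a b ^ 2 + a1 * chord_z a b - a2 - a - chord_x a b" by (simp only: f(4))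
    thus ?thesis by (simp add: chord_x_def)
  qed
  have cy: "\<phi> (chord_y a b) = y"
  proof -
    have "\<phi> (chord_y a b) = chord_z a b * (x - a) - (b + a1 * a + a3)"
      unfolding chord_y_def using ab cx cz
      by (simp add: F.hom_add[OF f(1)] F.hom_diff[OF f(1)] F.hom_mult[OF f(1)] fK)
    thus ?thesis using y_chord by simp
  qed
  have i: "\<phi> \<in> Aut"
  proof (rule aut_if_surj[OF f(1,2) fK])
    show "x \<in> \<phi> ` F" by (rule image_eqI[of _ _ "chord_x a b"]) (simp_all add: cx)
    show "y \<in> \<phi> ` F" by (rule image_eqI[of _ _ "chord_y a b"]) (simp_all add: cy)
  qed
  have ii: "\<phi> (\<phi> g) = g" if "g \<in> F" for g
    by (rule involution_if[OF i _ _ that]) (simp_all add: f(4,5) cx cy)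
  note PO = inf_place(1)
  define Q where "Q = \<phi> ` \<O>"
  have QP: "Q \<in> Pl" unfolding Q_def by (rule image_place(1)[OF i PO])
  have Qat: "place_at Q a b" unfolding place_at_def
  proof (intro conjI QP ab(1,2))
    have "\<phi> (chord_x a b - a) = x - a" using ab cx by (simp add: F.hom_diff[OF f(1)] fK)
    moreover have "\<phi> (chord_x a b - a) \<in> Q" unfolding Q_def using inf_chord(1) by (rule imageI)
    ultimately show "x - a \<in> Q" by simp
    have "\<phi> (chord_y a b - b) = y - b" using ab cy by (simp add: F.hom_diff[OF f(1)] fK)
    moreover have "\<phi> (chord_y a b - b) \<in> Q" unfolding Q_def using inf_chord(2) by (rule imageI)
    ultimately show "y - b \<in> Q" by simp
  qed
  have QO: "\<phi> ` Q = \<O>"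
  proof -
    have "(\<lambda>f. \<phi> (\<phi> f)) ` \<O> = id ` \<O>" by (rule image_cong_place[OF PO]) (simp add: ii)
    thus ?thesis by (simp add: image_image Q_def)
  qed
  have ne: "\<phi> x \<noteq> x"
  proof
    assume e: "\<phi> x = x"
    have "x \<notin> V Q" unfolding Q_def using image_place_mem(2)[OF i PO xF] e inf_place(2) by simp
    thus False using at_V(1)[OF Qat] by simp
  qed
  have OQ: "\<O> \<noteq> Q" using at_not_inf[OF Qat] by simp
  have vzO: "v \<O> (chord_z a b) = - 1" by (rule v_inf_chord(3))
  have vzQ: "v Q (chord_z a b) = - 1"
    unfolding Q_def using image_v[OF i discrete[OF PO] chord_F(1) v_inf_chord(2)] cz vzO by simp
  have zO: "chord_z a b \<notin> V \<O>" "chord_z a b \<notin> V Q"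
    using v_in_places(2)[OF PO chord_F(1) v_inf_chord(2)] v_in_places(2)[OF QP chord_F(1) v_inf_chord(2)] vzO vzQ by simp_all
  have poles: "R = \<O> \<or> R = Q" if R: "R \<in> Pl" "chord_z a b \<notin> V R" for R
  proof (cases "x \<in> V R")
    case False thus ?thesis using inf_eqI[OF R(1)] by simp
  next
    case True
    note yR = y_V[OF R(1) True]
    have xaV: "x - a \<in> V R" using V_diff[OF R(1) True K_V[OF R(1) ab(1)]] .
    have ybV: "y + (b + a1 * a + a3) \<in> V R" using ab by (intro V_add[OF R(1) yR] K_V[OF R(1)]) simp
    have xa: "x - a \<in> R"
    proof (rule ccontr)
      assume "x - a \<notin> R"
      hence "inverse (x - a) \<in> V R" using unitV[OF R(1) xaV] by simp
      hence "chord_z a b \<in> V R" unfolding chord_z_def divide_inverse using V_mult[OF R(1) ybV] by simp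
      thus False using R(2) by simp
    qed
    \<comment> \<open>\<open>g\<close> is \<open>(y - b) * chord_z a b\<close> and is regular
      wherever \<open>x\<close> is, so a pole of the slope there forces \<open>y - b\<close> into
      \<open>R\<close>.\<close>
    define g where "g = (x^2 + a * x + a^2 + a2 * (x + a) + a4 - a1 * b) - a1 * (y - b)"
    have gV: "g \<in> V R"
    proof -
      have "g \<in> Rxy" unfolding g_def
        by (intro Rxy.diff_mem Rxy.add_mem Rxy.mult_mem Rxy.power_mem Rxy_x Rxy_y Rxy_K aK ab)
      thus ?thesis by (rule Rxy_V[OF R(1) True])
    qed
    have "(y - b) * (y + (b + a1 * a + a3)) = (y - b) * (y + b + a1 * x + a3) - (x - a) * (a1 * (y - b))"
      by (simp add: algebra_simps)
    also have "\<dots> = (x - a) * g" unfolding curve_diff[OF ab(3)] g_def by (simp only: right_diff_distrib)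
    finally have "(y - b) * chord_z a b = g" unfolding chord_z_def using xa_nz by (simp add: field_simps)
    hence "y - b = g * inverse (chord_z a b)" using v_inf_chord(2) by (auto simp: field_simps)
    hence "y - b \<in> R" using P_mult[OF R(1) gV notV[OF R(1) chord_F(1) R(2)]] by simp
    hence "place_at R a b" using R(1) xa ab by (simp add: place_at_def)
    thus ?thesis using at_unique[OF _ Qat] by simp
  qed
  have zx: "x \<in> V R" if R: "R \<in> Pl" "c \<in> K" "chord_z a b - c \<in> R" for R c
  proof (rule ccontr)
    assume "x \<notin> V R"
    hence "R = \<O>" using inf_eqI[OF R(1)] by simp
    moreover have "chord_z a b \<in> V R" using V_add[OF R(1) P_V[OF R(1,3)] K_V[OF R(1,2)]] by simp
    ultimately show False using zO by simp
  qed
  \<comment> \<open>On the line of slope \<open>c\<close>, a value of \<open>x\<close> determines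
    that of \<open>y\<close>: the values of the slope and of \<open>x\<close> together fix an affine
    point.\<close>
  have yform: "y - (c * (\<gamma> - a) - (b + a1 * a + a3)) = chord_z a b * (x - \<gamma>) + (chord_z a b - c) * (\<gamma> - a)" for c \<gamma>
    by (subst y_chord) (simp add: algebra_simps)
  have at: "place_at R \<gamma> (c * (\<gamma> - a) - (b + a1 * a + a3))"
    if R: "c \<in> K" "\<gamma> \<in> K" "R \<in> Pl" "chord_z a b - c \<in> R" "x - \<gamma> \<in> R" for c \<gamma> R
  proof -
    have zV: "chord_z a b \<in> V R" using V_add[OF R(3) P_V[OF R(3,4)] K_V[OF R(3,1)]] by simp
    have "y - (c * (\<gamma> - a) - (b + a1 * a + a3)) \<in> R" unfolding yform
      using R ab by (intro P_add[OF R(3)] P_mult[OF R(3) zV] P_mult2[OF R(3,4)] K_V[OF R(3)]) simp_all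
    thus ?thesis using R ab by (simp add: place_at_def)
  qed
  have "leq P (\<phi> ` P) \<O> Q" if P: "P \<in> rational_places K F" for P
  proof (rule leq_involution[OF i ii chord_F(1) cz chord_z_not_K xF ne])
    fix R assume R: "R \<in> Pl"
    show "chord_z a b \<notin> V R \<longleftrightarrow> R = \<O> \<or> R = Q" using poles[OF R] zO by auto
    assume "chord_z a b \<notin> V R"
    with poles[OF R this] show "v R (chord_z a b) = - of_bool (R = \<O>) - of_bool (R = Q)"
      using vzO vzQ OQ by auto
  next
    show "x \<in> V R" if "R \<in> Pl" "c \<in> K" "chord_z a b - c \<in> R" for R c using zx[OF that] .
  next
    fix \<gamma> assume g: "\<gamma> \<in> K"
    define W where "W = 2 * b + a1 * a + a3"
    have WK: "W \<in> K" using ab by (simp add: W_def)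
    \<comment> \<open>The norm is a polynomial in the slope, because \<open>chord_prod\<close> and
      \<open>chord_x_def\<close> express the shifted product and the sum of \<open>x\<close> and
      \<open>\<phi> x\<close> through it.\<close>
    have "(x - \<gamma>) * (\<phi> x - \<gamma>) = (x - a) * (chord_x a b - a) + (a - \<gamma>) * (x + chord_x a b) - a^2 + \<gamma>^2"
      unfolding f(4) by (simp add: algebra_simps power2_eq_square)
    also have "\<dots> = chord_z a b * W + tang + (a - \<gamma>) * (chord_z a b ^ 2 + a1 * chord_z a b - a2 - a) - a^2 + \<gamma>^2"
      unfolding chord_prod W_def by (simp add: chord_x_def)
    also have "\<dots> = poly [:tang + (a - \<gamma>) * (- a2 - a) - a^2 + \<gamma>^2, W + (a - \<gamma>) * a1, a - \<gamma>:] (chord_z a b)"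
      by (simp add: algebra_simps power2_eq_square)
    finally show "\<exists>g\<in>Kp. (x - \<gamma>) * (\<phi> x - \<gamma>) = poly g (chord_z a b)"
      by (rule bexI) (use g ab WK in simp)
  next
    fix c \<gamma> R R'
    assume *: "c \<in> K" "\<gamma> \<in> K" "R \<in> Pl" "chord_z a b - c \<in> R" "x - \<gamma> \<in> R" "R' \<in> Pl" "chord_z a b - c \<in> R'" "x - \<gamma> \<in> R'"
    show "R = R'" by (rule at_unique[OF at[OF *(1-5)] at[OF *(1,2,6,7,8)]])
  next
    fix c \<gamma> R
    assume *: "c \<in> K" "\<gamma> \<in> K" "R \<in> Pl" "chord_z a b - c \<in> R" "x - \<gamma> \<in> R"
    note D = discrete[OF *(3)]
    define \<beta> where "\<beta> = c * (\<gamma> - a) - (b + a1 * a + a3)"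
    have cz0: "chord_z a b - c \<noteq> 0" using chord_z_not_K *(1) by (metis right_minus_eq)
    have xg0: "x - \<gamma> \<noteq> 0" using x_not_K *(2) by (metis right_minus_eq)
    have F: "chord_z a b - c \<in> F" "x - \<gamma> \<in> F" "\<gamma> - a \<in> F" using * ab by simp_all
    have zV: "chord_z a b \<in> V R" using V_add[OF *(3) P_V[OF *(3,4)] K_V[OF *(3,1)]] by simp
    have vz: "v R (chord_z a b) \<ge> 0" using v_in_places(2)[OF *(3) chord_F(1) v_inf_chord(2)] zV by simp
    have pos: "v R (chord_z a b - c) \<ge> 1" "v R (x - \<gamma>) \<ge> 1"
      using v_in_places(1)[OF *(3) F(1) cz0] v_in_places(1)[OF *(3) F(2) xg0] *(4,5) by simp_all
    have v1: "v R (chord_z a b * (x - \<gamma>)) \<ge> v R (x - \<gamma>)"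
      using v_mult[OF D chord_F(1) v_inf_chord(2) F(2) xg0] vz by simp
    show "v R (chord_z a b - c) = 1 \<or> v R (x - \<gamma>) = 1"
    proof (rule ccontr)
      \<comment> \<open>If neither is a local parameter, both have value at least 2; by
        \<open>yform\<close> so has \<open>y - \<beta>\<close>, and then
        \<open>lpar \<gamma> \<beta>\<close> could not have value 1.\<close>
      assume no: "\<not> (v R (chord_z a b - c) = 1 \<or> v R (x - \<gamma>) = 1)"
      hence two: "v R (chord_z a b - c) \<ge> 2" "v R (x - \<gamma>) \<ge> 2" using pos by linarith+
      have l: "v R (lpar \<gamma> \<beta>) = 1" "lpar \<gamma> \<beta> \<noteq> 0" using v_lpar[OF at[OF *]] lpar_gen(3)[OF at[OF *]] by (simp_all add: \<beta>_def)
      hence yb: "lpar \<gamma> \<beta> = y - \<beta>" using two unfolding lpar_def by (auto split: if_splits)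
      have e: "y - \<beta> = chord_z a b * (x - \<gamma>) + (chord_z a b - c) * (\<gamma> - a)" unfolding \<beta>_def by (rule yform)
      have "v R (y - \<beta>) \<ge> 2"
      proof (cases "\<gamma> - a = 0")
        case True
        thus ?thesis unfolding e using v1 two by simp
      next
        case False
        have "v R ((chord_z a b - c) * (\<gamma> - a)) = v R (chord_z a b - c)"
          using v_mult[OF D F(1) cz0 F(3) False] v_K[OF D K.diff_mem[OF *(2) ab(1)] False] by simp
        thus ?thesis unfolding e
          using F cz0 xg0 False v_inf_chord(2) two v1 l(2) yb e
          by (intro v_add_ge[OF D]) simp_all
      qed
      thus False using l(1) yb by simp
    qed
  qed (use QP QO P in \<open>simp_all add: Q_def[symmetric]\<close>)
  thus ?thesis using i f(4,5) Qat unfolding Q_def by blast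
qed

text \<open>Compose the involutions: from P + \<nu>P ~ 2\<O> and \<nu>P + \<iota>\<nu>P ~ \<O> + Q,
  dividing the two functions gives \<iota>\<nu>P + \<O> ~ P + Q. As \<nu> fixes \<O>, the composite
  sends \<O> to Q.\<close>

lemma ex_translation_at:
  "\<exists>\<tau>\<in>Aut. \<tau> x = chord_x a b \<and> \<tau> y = - chord_y a b - a1 * chord_x a b - a3 \<and> place_at (\<tau> ` \<O>) a b
     \<and> (\<forall>P\<in>rational_places K F. leq (\<tau> ` P) \<O> P (\<tau> ` \<O>))"
proof -
  obtain \<iota> where i: "\<iota> \<in> Aut" "\<iota> x = chord_x a b" "\<iota> y = chord_y a b" "place_at (\<iota> ` \<O>) a b"
     "\<forall>P\<in>rational_places K F. leq P (\<iota> ` P) \<O> (\<iota> ` \<O>)" using ex_chord_involution by blast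
  obtain \<nu> where n: "\<nu> \<in> Aut" "\<nu> x = x" "\<nu> y = - y - a1 * x - a3" "\<nu> ` \<O> = \<O>"
     "\<forall>P\<in>rational_places K F. leq P (\<nu> ` P) \<O> \<O>" using ex_negation by blast
  define \<tau> where "\<tau> = \<iota> \<circ> \<nu>"
  have im: "\<tau> ` S = \<iota> ` (\<nu> ` S)" for S by (simp add: \<tau>_def image_comp)
  have tO: "\<tau> ` \<O> = \<iota> ` \<O>" unfolding im n(4) ..
  have "leq (\<tau> ` P) \<O> P (\<tau> ` \<O>)" if P: "P \<in> rational_places K F" for P
  proof -
    obtain f where f: "f \<in> F - {0}" "\<forall>R\<in>Pl. v R f = of_bool (R = P) + of_bool (R = \<nu> ` P) - of_bool (R = \<O>) - of_bool (R = \<O>)"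
      using n(5) P unfolding leq_def by blast
    have "leq (\<nu> ` P) (\<iota> ` (\<nu> ` P)) \<O> (\<iota> ` \<O>)" using i(5) image_rational[OF n(1) P] by simp
    then obtain g where g: "g \<in> F - {0}" "\<forall>R\<in>Pl. v R g = of_bool (R = \<nu> ` P) + of_bool (R = \<tau> ` P) - of_bool (R = \<O>) - of_bool (R = \<tau> ` \<O>)"
      unfolding leq_def tO im[of P] by blast
    have "v R (g / f) = of_bool (R = \<tau> ` P) + of_bool (R = \<O>) - of_bool (R = P) - of_bool (R = \<tau> ` \<O>)" if R: "R \<in> Pl" for R
      using v_divide[OF discrete[OF R], of g f] f g R by simp
    moreover have "g / f \<in> F - {0}" using f(1) g(1) by simp
    ultimately show ?thesis unfolding leq_def by blast
  qed
  moreover have "\<tau> \<in> Aut" unfolding \<tau>_def by (rule comp_aut[OF i(1) n(1)])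
  moreover have "\<tau> x = chord_x a b" "\<tau> y = - chord_y a b - a1 * chord_x a b - a3"
    unfolding \<tau>_def using n(2,3) i(2,3) aut_K[OF i(1)]
    by (simp_all add: aut_diff[OF i(1)] aut_uminus[OF i(1)] aut_mult[OF i(1)])
  ultimately show ?thesis using i(4) unfolding tO[symmetric] by blast
qed

end

lemma ex_translation:
  assumes "Q \<in> rational_places K F"
  shows "\<exists>\<tau>\<in>Aut. \<tau> ` \<O> = Q \<and> (\<forall>P\<in>rational_places K F. leq (\<tau> ` P) \<O> P Q)"
proof (cases "Q = \<O>")
  case True
  have "\<forall>P\<in>rational_places K F. leq (id ` P) \<O> P Q" unfolding leq_def
    using v_one[OF discrete] by (intro ballI bexI[of _ 1]) (simp_all add: True)
  thus ?thesis using True by (intro bexI[OF _ id_aut]) simp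
next
  case False
  then obtain a b where ab: "place_at Q a b" using rational_at_ex[OF assms] by blast
  have *: "a \<in> K" "b \<in> K" using ab by (simp_all add: place_at_def)
  obtain \<tau> where t: "\<tau> \<in> Aut" "place_at (\<tau> ` \<O>) a b" "\<forall>P\<in>rational_places K F. leq (\<tau> ` P) \<O> P (\<tau> ` \<O>)"
    using ex_translation_at[OF * at_curve(1)[OF ab]] by blast
  have "\<tau> ` \<O> = Q" using at_unique[OF t(2) ab] .
  thus ?thesis using t by blast
qed

end


section \<open>Uniqueness of sums of places\<close>

context wcurve
begin

text \<open>Subtracting \<open>c * f ^ n\<close>, with \<open>c\<close> the residue of
  \<open>g / f ^ n\<close> at \<O>, lowers the pole order; without a pole,
  \<open>no_poles_const\<close> leaves a constant.\<close>

lemma poly_in_simple_pole: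
  assumes f: "f \<in> F" "f \<noteq> 0" "v \<O> f = - 1" "\<And>R. R \<in> Pl \<Longrightarrow> R \<noteq> \<O> \<Longrightarrow> f \<in> V R"
    and g: "g \<in> F" "\<And>R. R \<in> Pl \<Longrightarrow> R \<noteq> \<O> \<Longrightarrow> g \<in> V R" "g = 0 \<or> v \<O> g \<ge> - int n"
  shows "\<exists>p\<in>Kp. Polynomial.degree p \<le> n \<and> g = poly p f"
  using g
proof (induction n arbitrary: g)
  case 0
  note PO = inf_place(1)
  have "g \<in> V \<O>"
  proof (cases "g = 0")
    case False
    thus ?thesis using v_in_places(2)[OF PO 0(1) False] 0(3) by simp
  qed (simp add: V_zero[OF PO])
  hence "g \<in> V R" if "R \<in> Pl" for R using 0(2)[OF that] by (cases "R = \<O>") simp_all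
  hence "g \<in> K" by (rule no_poles_const[OF O_rational 0(1)])
  thus ?case by (intro bexI[of _ "[:g:]"]) simp_all
next
  case (Suc n)
  note PO = inf_place(1)
  note D = discrete[OF PO]
  define h where "h = g / f ^ Suc n"
  have fn: "f ^ Suc n \<in> F" "f ^ Suc n \<noteq> 0" using f by (simp_all del: power_Suc)
  have vfn: "v \<O> (f ^ Suc n) = - int (Suc n)" using v_power[OF D f(1,2), of "Suc n"] f(3) by simp
  have hF: "h \<in> F" using fn Suc.prems(1) by (simp add: h_def del: power_Suc)
  have gh: "g = h * f ^ Suc n" using fn by (simp add: h_def del: power_Suc)
  have "h \<in> V \<O>"
  proof (cases "g = 0")
    case False
    have "h \<noteq> 0" using gh False by auto
    moreover have "v \<O> h = v \<O> g + int (Suc n)" unfolding h_def using v_divide[OF D Suc.prems(1) False fn] vfn by simp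
    ultimately show ?thesis using v_in_places(2)[OF PO hF] Suc.prems(3) False by simp
  qed (simp add: h_def V_zero[OF PO])
  then obtain c where c: "c \<in> K" "h - c \<in> \<O>" using O_rational unfolding rational_iff[OF PO] by blast
  define g' where "g' = g - c * f ^ Suc n"
  have g'h: "g' = (h - c) * f ^ Suc n" unfolding g'_def gh by (simp only: left_diff_distrib)
  have "\<exists>p\<in>Kp. Polynomial.degree p \<le> n \<and> g' = poly p f"
  proof (rule Suc.IH)
    show "g' \<in> F" using Suc.prems(1) c(1) fn by (simp add: g'_def del: power_Suc)
    show "g' \<in> V R" if R: "R \<in> Pl" "R \<noteq> \<O>" for R
      unfolding g'_def by (intro V_diff[OF R(1)] V_mult[OF R(1)] V_power[OF R(1)] K_V[OF R(1) c(1)] f(4)[OF R] Suc.prems(2)[OF R])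
    show "g' = 0 \<or> - int n \<le> v \<O> g'"
    proof (cases "h - c = 0")
      case False
      have hc: "h - c \<in> F" using hF c(1) by simp
      have "v \<O> (h - c) \<ge> 1" using v_in_places(1)[OF PO hc False] c(2) by simp
      thus ?thesis unfolding g'h using v_mult[OF D hc False fn] vfn by simp
    qed (simp add: g'h)
  qed
  then obtain p where p: "p \<in> Kp" "Polynomial.degree p \<le> n" "g' = poly p f" by blast
  have "g = poly (p + Polynomial.monom c (Suc n)) f" using p(3) by (simp add: g'_def poly_monom algebra_simps)
  moreover have "Polynomial.degree (p + Polynomial.monom c (Suc n)) \<le> Suc n"
    using p(2) by (intro degree_add_le) (simp_all add: degree_monom_le)
  moreover have "p + Polynomial.monom c (Suc n) \<in> Kp" using p(1) c(1) by simp
  ultimately show ?case by blast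
qed

text \<open>A function with a single simple pole would parametrise the curve by polynomials of degree
  2 and 3; such a curve has a rational singular point.\<close>

lemma no_simple_pole:
  assumes f: "f \<in> F" "f \<noteq> 0" "v \<O> f = - 1" "\<And>R. R \<in> Pl \<Longrightarrow> R \<noteq> \<O> \<Longrightarrow> f \<in> V R"
  shows False
proof -
  note PO = inf_place(1)
  have fV: "f \<notin> V \<O>" using v_in_places(2)[OF PO f(1,2)] f(3) by simp
  have vp: "poly p f \<noteq> 0 \<and> v \<O> (poly p f) = - int (Polynomial.degree p)" if "p \<in> Kp" "p \<noteq> 0" for p
    using v_poly_neg[OF PO f(1) fV that] f(3) by simp
  have xV: "x \<in> V R" if "R \<in> Pl" "R \<noteq> \<O>" for R using inf_eqI[OF that(1)] that(2) by blast
  have "\<exists>p\<in>Kp. Polynomial.degree p \<le> 2 \<and> x = poly p f"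
    by (rule poly_in_simple_pole[OF f]) (use xV v_inf in simp_all)
  then obtain A where A: "A \<in> Kp" "x = poly A f" by blast
  have "\<exists>p\<in>Kp. Polynomial.degree p \<le> 3 \<and> y = poly p f"
    by (rule poly_in_simple_pole[OF f]) (use y_V xV v_inf in simp_all)
  then obtain B where B: "B \<in> Kp" "y = poly B f" by blast
  have "A \<noteq> 0" using A x_nz[OF inf_place] by auto
  hence dA: "Polynomial.degree A = 2" using vp[OF A(1)] v_inf(1) A(2) by simp
  have "B \<noteq> 0" using B y_nz[OF inf_place] by auto
  hence dB: "Polynomial.degree B = 3" using vp[OF B(1)] v_inf(2) B(2) by simp
  define c c1 c0 where "c = Polynomial.coeff A 2" and "c1 = Polynomial.coeff A 1" and "c0 = Polynomial.coeff A 0"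
  define d d2 d1 d0 where "d = Polynomial.coeff B 3" and "d2 = Polynomial.coeff B 2"
     and "d1 = Polynomial.coeff B 1" and "d0 = Polynomial.coeff B 0"
  have cK: "c \<in> K" "c1 \<in> K" "c0 \<in> K" "d \<in> K" "d2 \<in> K" "d1 \<in> K" "d0 \<in> K"
    using A(1) B(1) by (simp_all add: c_def c1_def c0_def d_def d2_def d1_def d0_def)
  have cn: "c \<noteq> 0" "d \<noteq> 0" using leading_coeff_neq_0[OF \<open>A \<noteq> 0\<close>] leading_coeff_neq_0[OF \<open>B \<noteq> 0\<close>] dA dB
    by (simp_all add: c_def d_def)
  have xf: "x = c * f^2 + c1 * f + c0"
    unfolding A(2) poly_altdef dA c_def c1_def c0_def by (simp add: eval_nat_numeral algebra_simps)
  have yf: "y = d * f^3 + d2 * f^2 + d1 * f + d0"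
    unfolding B(2) poly_altdef dB d_def d2_def d1_def d0_def by (simp add: eval_nat_numeral algebra_simps)
  \<comment> \<open>The quadratic \<open>m\<close> below has as roots the two parameters that meet
    in the singular point. The choice of \<open>s\<close> makes \<open>x - x0\<close> a multiple of
    \<open>m\<close>; the choice of \<open>r\<close> makes the remainder of \<open>y\<close> modulo
    \<open>m\<close> the constant \<open>y0\<close>.\<close>
  define s where "s = - (c1 / c)"
  define e where "e = d2 + s * d"
  define r where "r = (d1 + s * e) / d"
  define x0 where "x0 = c0 - c * r"
  define y0 where "y0 = d0 - r * e"
  have K0: "s \<in> K" "e \<in> K" "r \<in> K" "x0 \<in> K" "y0 \<in> K"
    using cK by (simp_all add: s_def e_def r_def x0_def y0_def)
  define m where "m = f^2 - s * f + r"
  define l where "l = d * f + e"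
  have cs: "c * s = - c1" using cn by (simp add: s_def)
  have dr: "d * r = d1 + s * e" using cn by (simp add: r_def)
  have xm: "x = x0 + c * m"
  proof -
    have "x0 + c * m = c * f^2 - (c * s) * f + c0" by (simp add: x0_def m_def algebra_simps)
    thus ?thesis unfolding cs xf by simp
  qed
  have yl: "y = y0 + m * l"
  proof -
    have "y0 + m * l = d * f^3 + (e - s * d) * f^2 + (d * r - s * e) * f + d0"
      by (simp add: y0_def m_def l_def algebra_simps power2_eq_square power3_eq_cube)
    thus ?thesis unfolding dr yf by (simp add: e_def)
  qed
  \<comment> \<open>\<open>W0\<close>, \<alpha> and \<beta> are the equation and its derivatives at
    \<open>(x0, y0)\<close>, the last one times \<open>c\<close>. Substitution turns the curve
    equation into \<open>W0 + Mp * (\<alpha> * Lp + \<beta> + Mp * Np) = 0\<close> at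
    \<open>f\<close>. As \<open>f\<close> is transcendental this holds for polynomials, and
    comparing degrees with \<open>deg Mp = 2\<close> makes every part vanish.\<close>
  define W0 where "W0 = (y0^2 + a1 * x0 * y0 + a3 * y0) - (x0^3 + a2 * x0^2 + a4 * x0 + a6)"
  define \<alpha> where "\<alpha> = 2 * y0 + a1 * x0 + a3"
  define \<beta> where "\<beta> = (a1 * y0 - (3 * x0^2 + 2 * a2 * x0 + a4)) * c"
  define Mp where "Mp = [:r, - s, 1:]"
  define Lp where "Lp = [:e, d:]"
  define Np where "Np = Lp * Lp + Polynomial.smult (a1 * c) Lp - [:(3 * x0 + a2) * c^2:] - Polynomial.smult (c^3) Mp"
  define Qp where "Qp = Polynomial.smult \<alpha> Lp + [:\<beta>:] + Mp * Np"
  have WK: "W0 \<in> K" "\<alpha> \<in> K" "\<beta> \<in> K" using K0 cK by (simp_all add: W0_def \<alpha>_def \<beta>_def)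
  have PK: "Mp \<in> Kp" "Lp \<in> Kp" using K0 cK by (simp_all add: Mp_def Lp_def)
  have NK: "Np \<in> Kp" unfolding Np_def
    using K0 cK by (intro K.polys_over_add K.polys_over_diff K.polys_over_mult K.polys_over_smult PK) simp_all
  have QK: "Qp \<in> Kp" unfolding Qp_def
    using WK by (intro K.polys_over_add K.polys_over_mult K.polys_over_smult PK NK) simp_all
  have pm: "poly Mp f = m" by (simp add: Mp_def m_def algebra_simps power2_eq_square)
  have pl: "poly Lp f = l" by (simp add: Lp_def l_def algebra_simps)
  have pn: "poly Np f = l * l + a1 * c * l - (3 * x0 + a2) * c^2 - c^3 * m" by (simp add: Np_def pl pm)
  have "poly ([:W0:] + Mp * Qp) f = W0 + m * (\<alpha> * l + \<beta> + m * (l * l + a1 * c * l - (3 * x0 + a2) * c^2 - c^3 * m))"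
    by (simp add: Qp_def pm pl pn)
  also have "\<dots> = ((y0 + m * l)^2 + a1 * (x0 + c * m) * (y0 + m * l) + a3 * (y0 + m * l))
     - ((x0 + c * m)^3 + a2 * (x0 + c * m)^2 + a4 * (x0 + c * m) + a6)"
    by (simp add: W0_def \<alpha>_def \<beta>_def algebra_simps power2_eq_square power3_eq_cube)
  also have "\<dots> = 0" unfolding xm[symmetric] yl[symmetric] curve by simp
  finally have "poly ([:W0:] + Mp * Qp) f = 0" .
  moreover have "[:W0:] + Mp * Qp \<in> Kp" using WK QK PK by simp
  ultimately have z: "[:W0:] + Mp * Qp = 0" using vp by blast
  have dM: "Polynomial.degree Mp = 2" "Mp \<noteq> 0" by (simp_all add: Mp_def)
  have Q0: "Qp = 0"
  proof (rule ccontr)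
    assume n: "Qp \<noteq> 0"
    have "Mp * Qp = - [:W0:]" using z by (simp only: eq_neg_iff_add_eq_0 add.commute)
    hence "Polynomial.degree (Mp * Qp) = 0" by simp
    thus False using degree_mult_eq[OF dM(2) n] dM(1) by simp
  qed
  hence W0: "W0 = 0" using z by simp
  have N0: "Np = 0"
  proof (rule ccontr)
    assume n: "Np \<noteq> 0"
    have "Mp * Np = - (Polynomial.smult \<alpha> Lp + [:\<beta>:])" using Q0 unfolding Qp_def by (simp only: eq_neg_iff_add_eq_0 add.commute)
    hence "Polynomial.degree (Mp * Np) = Polynomial.degree (Polynomial.smult \<alpha> Lp + [:\<beta>:])" by (simp only: degree_minus)
    also have "\<dots> \<le> 1" by (simp add: Lp_def)
    finally show False using degree_mult_eq[OF dM(2) n] dM(1) by simp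
  qed
  have "[:\<alpha> * e + \<beta>, \<alpha> * d:] = 0" using Q0 unfolding Qp_def N0 Lp_def by simp
  hence "\<alpha> = 0" "\<beta> = 0" using cn by auto
  hence "2 * y0 + a1 * x0 + a3 = 0" "a1 * y0 = 3 * x0^2 + 2 * a2 * x0 + a4" using cn by (simp_all add: \<alpha>_def \<beta>_def)
  moreover have "y0^2 + a1 * x0 * y0 + a3 * y0 = x0^3 + a2 * x0^2 + a4 * x0 + a6" using W0 by (simp add: W0_def)
  ultimately show False using smooth[OF K0(4,5)] by blast
qed

text \<open>A translation moves the pole \<open>B\<close> to \<O>, where
  \<open>no_simple_pole\<close> applies.\<close>

lemma principal_difference:
  assumes A: "A \<in> rational_places K F" and B: "B \<in> rational_places K F" and f: "f \<in> F" "f \<noteq> 0"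
    and vf: "\<And>R. R \<in> Pl \<Longrightarrow> v R f = of_bool (R = A) - of_bool (R = B)"
  shows "A = B"
proof (rule ccontr)
  assume ne: "A \<noteq> B"
  have BP: "B \<in> Pl" using B by (simp add: rational_places_def)
  obtain \<tau> where t: "\<tau> \<in> Aut" "\<tau> ` \<O> = B" using ex_translation[OF B] by blast
  obtain \<rho> where r: "\<rho> \<in> Aut" "\<forall>f\<in>F. \<rho> (\<tau> f) = f" "\<forall>f\<in>F. \<tau> (\<rho> f) = f" using ex_inv_aut[OF t(1)] by blast
  have rt: "\<rho> ` (\<tau> ` R) = R" if R: "R \<in> Pl" for R
  proof -
    have "(\<lambda>f. \<rho> (\<tau> f)) ` R = id ` R" by (rule image_cong_place[OF R]) (simp add: r(2))
    thus ?thesis by (simp add: image_image)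
  qed
  have v: "v R (\<rho> f) = of_bool (\<tau> ` R = A) - of_bool (\<tau> ` R = B)" if R: "R \<in> Pl" for R
    using image_v[OF r(1) discrete[OF image_place(1)[OF t(1) R]] f] rt[OF R] vf[OF image_place(1)[OF t(1) R]] by simp
  have rf: "\<rho> f \<in> F" "\<rho> f \<noteq> 0" using aut_F[OF r(1) f(1)] aut_eq_0[OF r(1) f(1)] f(2) by simp_all
  show False
  proof (rule no_simple_pole[OF rf])
    show "v \<O> (\<rho> f) = - 1" using v[OF inf_place(1)] t(2) ne by simp
    fix R assume R: "R \<in> Pl" "R \<noteq> \<O>"
    have "\<tau> ` R \<noteq> B"
    proof
      assume "\<tau> ` R = B"
      hence "\<rho> ` (\<tau> ` R) = \<rho> ` (\<tau> ` \<O>)" using t(2) by simp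
      thus False using rt[OF R(1)] rt[OF inf_place(1)] R(2) by simp
    qed
    hence "v R (\<rho> f) \<ge> 0" using v[OF R(1)] by simp
    thus "\<rho> f \<in> V R" using v_in_places(2)[OF R(1) rf] by simp
  qed
qed

lemma leq_unique:
  assumes "R \<in> rational_places K F" "S \<in> rational_places K F" "leq R \<O> A B" "leq S \<O> A B"
  shows "R = S"
proof -
  obtain f where f: "f \<in> F - {0}" "\<forall>T\<in>Pl. v T f = of_bool (T = R) + of_bool (T = \<O>) - of_bool (T = A) - of_bool (T = B)"
    using assms(3) unfolding leq_def by blast
  obtain g where g: "g \<in> F - {0}" "\<forall>T\<in>Pl. v T g = of_bool (T = S) + of_bool (T = \<O>) - of_bool (T = A) - of_bool (T = B)"
    using assms(4) unfolding leq_def by blast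
  show ?thesis
  proof (rule principal_difference[OF assms(1,2)])
    show "f / g \<in> F" "f / g \<noteq> 0" using f(1) g(1) by simp_all
    show "v T (f / g) = of_bool (T = R) - of_bool (T = S)" if T: "T \<in> Pl" for T
      using v_divide[OF discrete[OF T], of f g] f g T by simp
  qed
qed

lemma leq_sym:
  assumes "leq A B C D" shows "leq C D A B"
proof -
  obtain f where f: "f \<in> F - {0}" "\<forall>T\<in>Pl. v T f = of_bool (T = A) + of_bool (T = B) - of_bool (T = C) - of_bool (T = D)"
    using assms unfolding leq_def by blast
  have "v T (inverse f) = of_bool (T = C) + of_bool (T = D) - of_bool (T = A) - of_bool (T = B)" if T: "T \<in> Pl" for T
    using v_inverse[OF discrete[OF T], of f] f T by simp
  thus ?thesis unfolding leq_def using f(1) by (intro bexI[of _ "inverse f"]) simp_all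
qed

text \<open>Composition of the two translations adds the points.\<close>

lemma leq_trans:
  assumes "leq R \<O> S P" "leq S \<O> T Q" "leq U \<O> P Q" shows "leq R \<O> T U"
proof -
  obtain f where f: "f \<in> F - {0}" "\<forall>W\<in>Pl. v W f = of_bool (W = R) + of_bool (W = \<O>) - of_bool (W = S) - of_bool (W = P)"
    using assms(1) unfolding leq_def by blast
  obtain g where g: "g \<in> F - {0}" "\<forall>W\<in>Pl. v W g = of_bool (W = S) + of_bool (W = \<O>) - of_bool (W = T) - of_bool (W = Q)"
    using assms(2) unfolding leq_def by blast
  obtain h where h: "h \<in> F - {0}" "\<forall>W\<in>Pl. v W h = of_bool (W = U) + of_bool (W = \<O>) - of_bool (W = P) - of_bool (W = Q)"
    using assms(3) unfolding leq_def by blast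
  have "v W (f * g / h) = of_bool (W = R) + of_bool (W = \<O>) - of_bool (W = T) - of_bool (W = U)" if W: "W \<in> Pl" for W
    using v_divide[OF discrete[OF W], of "f * g" h] v_mult[OF discrete[OF W], of f g] f g h W by simp
  thus ?thesis unfolding leq_def using f(1) g(1) h(1) by (intro bexI[of _ "f * g / h"]) simp_all
qed

lemma leq_image:
  assumes s: "\<sigma> \<in> Aut" and l: "leq A B C D" and P: "A \<in> Pl" "B \<in> Pl" "C \<in> Pl" "D \<in> Pl"
  shows "leq (\<sigma> ` A) (\<sigma> ` B) (\<sigma> ` C) (\<sigma> ` D)"
proof -
  obtain f where f: "f \<in> F - {0}" "\<forall>T\<in>Pl. v T f = of_bool (T = A) + of_bool (T = B) - of_bool (T = C) - of_bool (T = D)"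
    using l unfolding leq_def by blast
  obtain \<rho> where r: "\<rho> \<in> Aut" "\<forall>f\<in>F. \<rho> (\<sigma> f) = f" "\<forall>f\<in>F. \<sigma> (\<rho> f) = f" using ex_inv_aut[OF s] by blast
  have sr: "\<sigma> ` (\<rho> ` R) = R" "\<rho> ` (\<sigma> ` R) = R" if R: "R \<in> Pl" for R
  proof -
    have "(\<lambda>f. \<sigma> (\<rho> f)) ` R = id ` R" by (rule image_cong_place[OF R]) (simp add: r(3))
    thus "\<sigma> ` (\<rho> ` R) = R" by (simp add: image_image)
    have "(\<lambda>f. \<rho> (\<sigma> f)) ` R = id ` R" by (rule image_cong_place[OF R]) (simp add: r(2))
    thus "\<rho> ` (\<sigma> ` R) = R" by (simp add: image_image)
  qed
  have eq: "T = \<sigma> ` S \<longleftrightarrow> \<rho> ` T = S" if "T \<in> Pl" "S \<in> Pl" for T S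
    using sr[OF that(1)] sr[OF that(2)] by auto
  have "v T (\<sigma> f) = of_bool (T = \<sigma> ` A) + of_bool (T = \<sigma> ` B) - of_bool (T = \<sigma> ` C) - of_bool (T = \<sigma> ` D)" if T: "T \<in> Pl" for T
  proof -
    have "v (\<sigma> ` (\<rho> ` T)) (\<sigma> f) = v (\<rho> ` T) f"
      using image_v[OF s discrete[OF image_place(1)[OF r(1) T]]] f(1) by simp
    thus ?thesis using f(2) image_place(1)[OF r(1) T] sr(1)[OF T] eq[OF T P(1)] eq[OF T P(2)] eq[OF T P(3)] eq[OF T P(4)] by simp
  qed
  moreover have "\<sigma> f \<in> F - {0}" using f(1) aut_F[OF s] aut_eq_0[OF s] by simp
  ultimately show ?thesis unfolding leq_def by blast
qed

lemma linearly_equivalent_iff: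
  assumes "A \<in> Pl" "B \<in> Pl" "C \<in> Pl" "D \<in> Pl"
  shows "linearly_equivalent K F (frag_of A + frag_of B) (frag_of C + frag_of D) \<longleftrightarrow> leq A B C D"
proof -
  have keys: "Poly_Mapping.keys (frag_of P + frag_of Q) \<subseteq> Pl" if "P \<in> Pl" "Q \<in> Pl" for P Q
    using keys_add[of "frag_of P" "frag_of Q"] that by auto
  have "Poly_Mapping.lookup (frag_of A + frag_of B - (frag_of C + frag_of D)) R
      = of_bool (R = A) + of_bool (R = B) - of_bool (R = C) - of_bool (R = D)" for R
    by (simp add: lookup_minus lookup_add lookup_single when_def)
  thus ?thesis unfolding linearly_equivalent_def leq_def using keys assms by (simp add: eq_commute)
qed

abbreviation "Rat \<equiv> rational_places K F"

lemma Rat_Pl: "P \<in> Rat \<Longrightarrow> P \<in> Pl" by (simp add: rational_places_def)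

lemma place_add_eqI:
  assumes "P \<in> Rat" "Q \<in> Rat" "R \<in> Rat" "leq R \<O> P Q"
  shows "place_add K F \<O> P Q = R"
  unfolding place_add_def
proof (rule the_equality)
  note lin = linearly_equivalent_iff[OF Rat_Pl[OF assms(1)] Rat_Pl[OF assms(2)] Rat_Pl inf_place(1)]
  show "R \<in> Rat \<and> linearly_equivalent K F (frag_of P + frag_of Q) (frag_of R + frag_of \<O>)"
    using assms(3) leq_sym[OF assms(4)] lin[OF assms(3)] by simp
  fix S assume S: "S \<in> Rat \<and> linearly_equivalent K F (frag_of P + frag_of Q) (frag_of S + frag_of \<O>)"
  hence "leq P Q S \<O>" using lin[of S] by simp
  from leq_unique[OF _ assms(3) leq_sym[OF this] assms(4)] S show "S = R" by simp
qed

text \<open>Existence comes from the translation: the image of \<open>P\<close> under the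
  translation by \<open>Q\<close> is a sum.\<close>

lemma place_add:
  assumes "P \<in> Rat" "Q \<in> Rat"
  shows "place_add K F \<O> P Q \<in> Rat" "leq (place_add K F \<O> P Q) \<O> P Q"
proof -
  obtain \<tau> where t: "\<tau> \<in> Aut" "\<tau> ` \<O> = Q" "\<forall>P\<in>Rat. leq (\<tau> ` P) \<O> P Q" using ex_translation[OF assms(2)] by blast
  have "\<tau> ` P \<in> Rat" "leq (\<tau> ` P) \<O> P Q" using image_rational[OF t(1) assms(1)] t(3) assms(1) by simp_all
  thus "place_add K F \<O> P Q \<in> Rat" "leq (place_add K F \<O> P Q) \<O> P Q" using place_add_eqI[OF assms] by simp_all
qed

end

section \<open>Automorphisms over an algebraically closed constant field\<close>

text \<open>Two consequences of an algebraically closed constant field: infinitely many abscissae,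
  and a rational point above each.\<close>

locale wcurve_closed = wcurve +
  assumes infinite_K: "infinite K"
    and ex_point: "a \<in> K \<Longrightarrow> \<exists>b\<in>K. b^2 + a1 * a * b + a3 * b = a^3 + a2 * a^2 + a4 * a + a6"
begin

text \<open>The norm of the numerator is a nonzero polynomial \<open>N\<close> in \<open>x\<close>.
  At a rational point whose abscissa is not one of its finitely many roots, \<open>f\<close> cannot
  vanish.\<close>

lemma zero_if_all_zeros:
  assumes f: "f \<in> F" and all: "\<And>P. P \<in> Rat \<Longrightarrow> P \<noteq> \<O> \<Longrightarrow> f \<in> P"
  shows "f = 0"
proof (rule ccontr)
  assume fn: "f \<noteq> 0"
  obtain A B C where *: "A \<in> Kp" "B \<in> Kp" "C \<in> Kp" "C \<noteq> 0" "f = (poly A x + poly B x * y) / poly C x"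
    using rep[OF f] by blast
  define g where "g = poly A x + poly B x * y"
  have gF: "g \<in> F" using * by (simp add: g_def)
  have fg: "g = f * poly C x" using poly_x_nz[OF *(3,4)] by (simp add: *(5) g_def)
  hence gn: "g \<noteq> 0" using fn poly_x_nz[OF *(3,4)] by simp
  define g' where "g' = poly A x + poly B x * (- y - a1 * x - a3)"
  obtain \<nu> where n: "\<nu> \<in> Aut" "\<nu> x = x" "\<nu> y = - y - a1 * x - a3" using ex_negation by blast
  have "\<nu> g = g'"
    unfolding g_def g'_def using * n(2,3) hom_poly[OF aut_hom[OF n(1)] aut_K[OF n(1)] _ xF]
    by (simp add: aut_add[OF n(1)] aut_mult[OF n(1)])
  hence g'n: "g' \<noteq> 0" using aut_eq_0[OF n(1) gF] gn by simp
  define N where "N = A * A - A * B * [:a3, a1:] - B * B * [:a6, a4, a2, 1:]"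
  have NK: "N \<in> Kp" unfolding N_def
    by (intro K.polys_over_diff K.polys_over_mult *(1,2)) simp_all
  have "g * g' = poly A x * poly A x - poly A x * poly B x * (a1 * x + a3) - poly B x * poly B x * (y^2 + a1 * x * y + a3 * y)"
    by (simp add: g_def g'_def algebra_simps power2_eq_square)
  also have "\<dots> = poly N x" unfolding curve N_def by (simp add: algebra_simps power2_eq_square power3_eq_cube)
  finally have gN: "g * g' = poly N x" .
  hence "N \<noteq> 0" using gn g'n by auto
  hence "finite {a. poly N a = 0}" by (rule poly_roots_finite)
  then obtain a where a: "a \<in> K" "poly N a \<noteq> 0" using infinite_K finite_subset[of K "{a. poly N a = 0}"] by blast
  obtain b where b: "b \<in> K" "b^2 + a1 * a * b + a3 * b = a^3 + a2 * a^2 + a4 * a + a6" using ex_point[OF a(1)] by blast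
  obtain \<tau> where t: "\<tau> \<in> Aut" "place_at (\<tau> ` \<O>) a b" using ex_translation_at[OF a(1) b] by blast
  define R where "R = \<tau> ` \<O>"
  have R: "place_at R a b" using t(2) by (simp add: R_def)
  have RP: "R \<in> Pl" "x - a \<in> R" using R by (simp_all add: place_at_def)
  have xR: "x \<in> V R" using at_V(1)[OF R] .
  have "f \<in> R" using all[OF rational_at[OF R] at_not_inf[OF R]] .
  hence "g \<in> R" unfolding fg using P_mult2[OF RP(1) _ poly_V[OF RP(1) *(3) xR]] by simp
  moreover have "g' \<in> V R"
  proof -
    have "g' \<in> Rxy" unfolding g'_def
      by (intro Rxy.add_mem Rxy.mult_mem Rxy.diff_mem Rxy.uminus_mem Rxy_poly *(1,2) Rxy_x Rxy_y Rxy_K aK)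
    thus ?thesis by (rule Rxy_V[OF RP(1) xR])
  qed
  ultimately have "poly N x \<in> R" using P_mult2[OF RP(1)] gN by metis
  moreover obtain q where q: "q \<in> Kp" "\<forall>z. poly N z - poly N a = (z - a) * poly q z" using poly_root_diff[OF NK a(1)] by blast
  have "(x - a) * poly q x \<in> R" using P_mult2[OF RP poly_V[OF RP(1) q(1) xR]] .
  hence "poly N x - poly N a \<in> R" using q(2) by simp
  ultimately have "poly N x - (poly N x - poly N a) \<in> R" by (rule P_diff[OF RP(1)])
  hence "poly N a \<in> R" by simp
  moreover have "poly N a \<in> K" using NK a(1) by (intro K.poly_mem[of _ _ K]) simp_all
  ultimately show False using K_P[OF RP(1)] a(2) by blast
qed

text \<open>The inverse of \<tau> composed with \<sigma> fixes every rational place, hence the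
  residues of \<open>x\<close> and \<open>y\<close> there. So it moves \<open>x\<close> and
  \<open>y\<close> by functions vanishing at all affine points, which are 0.\<close>

lemma aut_eqI:
  assumes s: "\<sigma> \<in> Aut" and t: "\<tau> \<in> Aut" and eq: "\<And>P. P \<in> Rat \<Longrightarrow> \<sigma> ` P = \<tau> ` P" and f: "f \<in> F"
  shows "\<sigma> f = \<tau> f"
proof -
  obtain \<rho> where r: "\<rho> \<in> Aut" "\<forall>f\<in>F. \<rho> (\<tau> f) = f" "\<forall>f\<in>F. \<tau> (\<rho> f) = f" using ex_inv_aut[OF t] by blast
  define \<phi> where "\<phi> = \<rho> \<circ> \<sigma>"
  have p: "\<phi> \<in> Aut" unfolding \<phi>_def by (rule comp_aut[OF r(1) s])
  have fixes': "\<phi> ` P = P" if P: "P \<in> Rat" for P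
  proof -
    have "\<phi> ` P = \<rho> ` (\<tau> ` P)" unfolding \<phi>_def image_comp[symmetric] eq[OF P] ..
    also have "\<dots> = (\<lambda>f. \<rho> (\<tau> f)) ` P" by (simp add: image_image)
    also have "\<dots> = id ` P" by (rule image_cong_place[OF Rat_Pl[OF P]]) (simp add: r(2))
    finally show ?thesis by simp
  qed
  have diff: "\<phi> g = g" if g: "g \<in> F" and pt: "\<And>P. P \<in> Rat \<Longrightarrow> P \<noteq> \<O> \<Longrightarrow> \<exists>c\<in>K. g - c \<in> P" for g
  proof -
    have "\<phi> g - g = 0"
    proof (rule zero_if_all_zeros)
      show "\<phi> g - g \<in> F" using aut_F[OF p g] g by simp
      fix P assume P: "P \<in> Rat" "P \<noteq> \<O>"
      obtain c where c: "c \<in> K" "g - c \<in> P" using pt[OF P] by blast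
      have "\<phi> (g - c) \<in> \<phi> ` P" using c(2) by (rule imageI)
      hence "\<phi> g - c \<in> P" using fixes'[OF P(1)] aut_diff[OF p g K_F[OF c(1)]] aut_K[OF p c(1)] by simp
      from P_diff[OF Rat_Pl[OF P(1)] this c(2)] show "\<phi> g - g \<in> P" by simp
    qed
    thus ?thesis by simp
  qed
  have xy: "\<phi> x = x" "\<phi> y = y"
  proof -
    have "\<exists>a b. place_at P a b" if "P \<in> Rat" "P \<noteq> \<O>" for P using rational_at_ex[OF that] .
    hence "\<exists>c\<in>K. x - c \<in> P" "\<exists>c\<in>K. y - c \<in> P" if "P \<in> Rat" "P \<noteq> \<O>" for P
      using that unfolding place_at_def by blast+
    thus "\<phi> x = x" "\<phi> y = y" using diff[OF xF] diff[OF yF] by blast+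
  qed
  have "\<phi> f = id f"
    by (rule hom_unique[OF aut_hom[OF p] aut_hom[OF id_aut]]) (use xy f aut_K[OF p] in simp_all)
  hence "\<rho> (\<sigma> f) = f" by (simp add: \<phi>_def)
  hence "\<tau> (\<rho> (\<sigma> f)) = \<tau> f" by simp
  thus ?thesis using r(3) aut_F[OF s f] by simp
qed

end


section \<open>Elements algebraic over a finite field\<close>

definition alg :: "'a::field set \<Rightarrow> 'a \<Rightarrow> bool" where
  "alg K z \<longleftrightarrow> (\<exists>p\<in>polys_over K. p \<noteq> 0 \<and> poly p z = 0)"

lemma rta_pow [simp]: "z [^]\<^bsub>(ring_of_type_algebra :: 'a::field ring)\<^esub> (n::nat) = z ^ n"
proof -
  interpret R: Ring.field "ring_of_type_algebra :: 'a ring" by (rule field_rta)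
  show ?thesis by (induction n) (simp_all add: mult.commute)
qed

lemma eval_rta: "ring.eval (ring_of_type_algebra :: 'a::field ring) l z = poly (Poly (rev l)) z"
proof -
  interpret R: Ring.field "ring_of_type_algebra :: 'a ring" by (rule field_rta)
  show ?thesis
  proof (induction l)
    case (Cons a l)
    thus ?case by (simp add: Poly_append poly_monom)
  qed simp
qed

lemma algebraic_rta_iff:
  assumes "set_field (K :: 'a::field set)"
  shows "(ring.transcendental (ring_of_type_algebra :: 'a ring) over K) z \<longleftrightarrow> \<not> alg K z"
proof -
  interpret R: Ring.field "ring_of_type_algebra :: 'a ring" by (rule field_rta)
  interpret sfield K by standard (rule assms)
  have sr: "subring K (ring_of_type_algebra :: 'a ring)"
    using subfieldE(1) assms subfield_rta_iff by blast
  have "(R.algebraic over K) z \<longleftrightarrow> alg K z"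
  proof
    assume "(R.algebraic over K) z"
    from R.algebraicE[OF sr _ this] obtain l where l: "l \<in> carrier (univ_poly ring_of_type_algebra K)" "l \<noteq> []" "R.eval l z = 0"
      by auto
    have l': "set l \<subseteq> K" "hd l \<noteq> 0" using l(1,2) by (auto simp: univ_poly_def polynomial_def)
    have "Poly (rev l) \<noteq> 0"
    proof
      assume "Poly (rev l) = 0"
      then obtain n where n: "rev l = replicate n 0" by (auto simp: Poly_eq_0)
      hence "l = replicate n 0" by (metis rev_replicate rev_rev_ident)
      thus False using l(2) l'(2) by (cases n) auto
    qed
    moreover have "Poly (rev l) \<in> polys_over K" unfolding polys_over_def
    proof (intro CollectI allI)
      fix i
      show "Polynomial.coeff (Poly (rev l)) i \<in> K"
      proof (cases "i < length l")
        case True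
        hence "rev l ! i \<in> set (rev l)" by (intro nth_mem) simp
        thus ?thesis using l'(1) True by (auto simp: coeff_Poly_eq nth_default_def)
      qed (simp add: coeff_Poly_eq nth_default_def)
    qed
    ultimately show "alg K z" unfolding alg_def using l(3) eval_rta[of l z] by auto
  next
    assume "alg K z"
    then obtain p where p: "p \<in> polys_over K" "p \<noteq> 0" "poly p z = 0" unfolding alg_def by blast
    define l where "l = rev (coeffs p)"
    have "l \<noteq> []" using p(2) by (simp add: l_def)
    moreover have "hd l \<noteq> 0" using p(2) by (simp add: l_def hd_rev last_coeffs_eq_coeff_degree)
    moreover have "set l \<subseteq> K" using p(1) unfolding l_def by (auto simp: coeffs_def)
    ultimately have "l \<in> carrier (univ_poly ring_of_type_algebra K)" by (simp add: univ_poly_def polynomial_def)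
    moreover have "R.eval l z = 0" using p(3) by (simp add: eval_rta l_def)
    ultimately show "(R.algebraic over K) z" using R.algebraicI[of l K z] \<open>l \<noteq> []\<close> by simp
  qed
  thus ?thesis by (auto simp: over_def)
qed

lemma alg_mono: "alg K z \<Longrightarrow> K \<subseteq> S \<Longrightarrow> alg S z"
  unfolding alg_def polys_over_def by blast

lemma finite_sring_sfield:
  assumes "sring S" "finite S"
  shows "set_field S"
proof -
  interpret sring S by fact
  have "inverse u \<in> S" if u: "u \<in> S" for u
  proof (cases "u = 0")
    case False
    have "(\<lambda>w. u * w) ` S = S"
      using assms(2) u False by (intro endo_inj_surj) (auto intro!: inj_onI)
    then obtain w where "w \<in> S" "1 = u * w" using one_mem by blast
    moreover from this(2) have "inverse u = w" by (intro inverse_unique) simp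
    ultimately show ?thesis by simp
  qed simp
  thus ?thesis by (simp add: set_field_def)
qed

lemma finite_bounded_degree:
  fixes K :: "'a::field set"
  assumes "finite K" shows "finite {r\<in>polys_over K. length (coeffs r) \<le> n}"
proof (rule finite_subset)
  show "{r\<in>polys_over K. length (coeffs r) \<le> n} \<subseteq> Poly ` {l. set l \<subseteq> K \<and> length l \<le> n}"
  proof
    fix r assume r: "r \<in> {r\<in>polys_over K. length (coeffs r) \<le> n}"
    hence "set (coeffs r) \<subseteq> K" by (auto simp: polys_over_def coeffs_def)
    thus "r \<in> Poly ` {l. set l \<subseteq> K \<and> length l \<le> n}"
      using r by (intro image_eqI[of _ _ "coeffs r"]) simp_all
  qed
  show "finite (Poly ` {l. set l \<subseteq> K \<and> length l \<le> n})" using finite_lists_length_le[OF assms] by simp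
qed

text \<open>Polynomial values at \<open>z\<close> are values of remainders modulo an equation of
  \<open>z\<close>; there are finitely many, and a finite subring is a field.\<close>

lemma finite_extension:
  fixes K :: "'a::field set"
  assumes K: "set_field K" "finite K" and z: "alg K z"
  shows "\<exists>S. set_field S \<and> finite S \<and> K \<subseteq> S \<and> z \<in> S"
proof -
  interpret sfield K by standard fact
  obtain p where p: "p \<in> polys_over K" "p \<noteq> 0" "poly p z = 0" using z unfolding alg_def by blast
  define S where "S = (\<lambda>p. poly p z) ` polys_over K"
  have "S \<subseteq> (\<lambda>r. poly r z) ` {r\<in>polys_over K. length (coeffs r) \<le> Suc (Polynomial.degree p)}"
  proof
    fix s assume "s \<in> S"
    then obtain g where g: "g \<in> polys_over K" "s = poly g z" unfolding S_def by blast
    obtain q r where qr: "q \<in> polys_over K" "r \<in> polys_over K" "g = q * p + r" "r = 0 \<or> Polynomial.degree r < Polynomial.degree p"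
      using polys_over_division[OF g(1) p(1,2)] by blast
    have "s = poly r z" unfolding g(2) qr(3) using p(3) by simp
    moreover have "length (coeffs r) \<le> Suc (Polynomial.degree p)" using qr(4) by (cases "r = 0") (auto simp: length_coeffs_degree)
    ultimately show "s \<in> (\<lambda>r. poly r z) ` {r\<in>polys_over K. length (coeffs r) \<le> Suc (Polynomial.degree p)}"
      using qr(2) by (intro image_eqI[of _ _ r]) simp_all
  qed
  hence fin: "finite S" using finite_surj[OF finite_bounded_degree[OF K(2)]] by blast
  have "sring S" unfolding S_def by (rule sring_adjoin)
  hence "set_field S" using fin by (rule finite_sring_sfield)
  moreover have "K \<subseteq> S"
  proof
    fix c assume "c \<in> K" thus "c \<in> S" unfolding S_def by (intro image_eqI[of _ _ "[:c:]"]) simp_all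
  qed
  moreover have "z \<in> S" unfolding S_def by (intro image_eqI[of _ _ "[:0, 1:]"]) simp_all
  ultimately show ?thesis using fin by blast
qed

lemma finite_field_power:
  assumes "set_field S" "finite S" "(z::'a::field) \<in> S" "z \<noteq> 0"
  shows "\<exists>n>0. z ^ n = 1"
proof -
  interpret sfield S by standard fact
  have "\<not> inj (\<lambda>n. z ^ n)"
  proof
    assume "inj (\<lambda>n. z ^ n)"
    hence "infinite (range (\<lambda>n. z ^ n))" by (rule range_inj_infinite)
    moreover have "range (\<lambda>n. z ^ n) \<subseteq> S" using assms(3) by auto
    ultimately show False using assms(2) finite_subset by blast
  qed
  then obtain i j where ij: "z ^ i = z ^ j" "i \<noteq> j" unfolding inj_def by blast
  have *: "\<exists>n>0. z ^ n = 1" if "z ^ i = z ^ j" "i < j" for i j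
  proof -
    have "z ^ i * z ^ (j - i) = z ^ j" unfolding power_add[symmetric] using that(2) by simp
    hence "z ^ i * z ^ (j - i) = z ^ i * 1" using that(1) by simp
    hence "z ^ (j - i) = 1" using assms(4) by simp
    thus ?thesis using that(2) by (intro exI[of _ "j - i"]) simp
  qed
  show ?thesis using *[of i j] *[of j i] ij by (cases "i < j") auto
qed

lemma alg_root_of_unity:
  assumes "set_field K" "z ^ n = 1" "n > 0"
  shows "alg K z"
proof -
  interpret sfield K by standard fact
  have "Polynomial.monom 1 n - 1 \<in> polys_over K" by simp
  moreover have "poly (Polynomial.monom 1 n - 1) z = 0" using assms(2) by (simp add: poly_monom)
  moreover have "Polynomial.monom 1 n - 1 \<noteq> (0 :: 'a poly)"
  proof
    assume "Polynomial.monom 1 n - 1 = (0 :: 'a poly)"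
    hence "poly (Polynomial.monom 1 n - 1) 0 = (0 :: 'a)" by simp
    thus False using assms(3) by (simp add: poly_monom zero_power)
  qed
  ultimately show ?thesis unfolding alg_def by blast
qed

text \<open>Nonzero elements of a finite field are roots of unity, and these are algebraic over any
  subfield, whether or not it lies in \<open>S\<close>.\<close>

lemma alg_finite_field:
  assumes "set_field S" "finite S" "z \<in> S" "set_field K"
  shows "alg K z"
proof (cases "z = 0")
  case True
  interpret K: sfield K by standard fact
  show ?thesis unfolding alg_def using True by (intro bexI[of _ "[:0, 1:]"]) simp_all
next
  case False
  thus ?thesis using finite_field_power[OF assms(1-3)] alg_root_of_unity[OF assms(4)] by blast
qed

text \<open>The elements algebraic over a finite field form the directed union of its finite extensions,
  so no general theory of algebraic closures is needed.\<close>

locale finite_base = sfield k for k :: "'a::field set" +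
  assumes finite_k: "finite k"
begin

definition "alg_elts = {z. alg k z}"

lemma alg_elts_iff: "z \<in> alg_elts \<longleftrightarrow> (\<exists>S. set_field S \<and> finite S \<and> k \<subseteq> S \<and> z \<in> S)"
proof
  assume "z \<in> alg_elts"
  thus "\<exists>S. set_field S \<and> finite S \<and> k \<subseteq> S \<and> z \<in> S"
    using finite_extension[OF set_field finite_k] by (simp add: alg_elts_def)
next
  assume "\<exists>S. set_field S \<and> finite S \<and> k \<subseteq> S \<and> z \<in> S"
  then obtain S where "set_field S" "finite S" "z \<in> S" by blast
  from alg_finite_field[OF this set_field] show "z \<in> alg_elts" by (simp add: alg_elts_def)
qed

lemma extend:
  assumes "set_field S" "finite S" "k \<subseteq> S" "alg S z"
  shows "\<exists>S'. set_field S' \<and> finite S' \<and> k \<subseteq> S' \<and> S \<subseteq> S' \<and> z \<in> S'"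
  using finite_extension[OF assms(1,2,4)] assms(3) by blast

lemma k_alg: "k \<subseteq> alg_elts"
  using alg_elts_iff set_field finite_k by blast

sublocale A: sfield alg_elts
proof
  have two: "\<exists>S. set_field S \<and> finite S \<and> k \<subseteq> S \<and> z \<in> S \<and> w \<in> S" if zw: "z \<in> alg_elts" "w \<in> alg_elts" for z w
  proof -
    obtain S where S: "set_field S" "finite S" "k \<subseteq> S" "z \<in> S" using zw(1) alg_elts_iff by blast
    have "alg S w" using alg_mono[OF _ S(3)] zw(2) by (simp add: alg_elts_def)
    from extend[OF S(1-3) this] S(4) show ?thesis by blast
  qed
  have op: "f \<in> alg_elts" if zw: "z \<in> alg_elts" "w \<in> alg_elts" and f: "\<And>S. set_field S \<Longrightarrow> z \<in> S \<Longrightarrow> w \<in> S \<Longrightarrow> f \<in> S" for f z w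
  proof -
    obtain S where "set_field S" "finite S" "k \<subseteq> S" "z \<in> S" "w \<in> S" using two[OF zw] by blast
    thus ?thesis using f[of S] alg_elts_iff by blast
  qed
  show "set_field alg_elts" unfolding set_field_def[of alg_elts]
  proof (intro conjI ballI)
    show "1 \<in> alg_elts" using k_alg one_mem by blast
    show "- a \<in> alg_elts" if "a \<in> alg_elts" for a by (rule op[OF that that]) (simp add: set_field_def)
    show "inverse a \<in> alg_elts" if "a \<in> alg_elts" for a by (rule op[OF that that]) (simp add: set_field_def)
    show "a + b \<in> alg_elts" if "a \<in> alg_elts" "b \<in> alg_elts" for a b by (rule op[OF that]) (simp add: set_field_def)
    show "a * b \<in> alg_elts" if "a \<in> alg_elts" "b \<in> alg_elts" for a b by (rule op[OF that]) (simp add: set_field_def)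
  qed
qed

lemma poly_finite_field:
  assumes "p \<in> polys_over alg_elts"
  shows "\<exists>S. set_field S \<and> finite S \<and> k \<subseteq> S \<and> p \<in> polys_over S"
  using assms
proof (induction rule: A.polys_over_induct)
  case 0
  show ?case using set_field finite_k by (intro exI[of _ k]) simp
next
  case (pCons a p)
  then obtain S where S: "set_field S" "finite S" "k \<subseteq> S" "p \<in> polys_over S" by blast
  have "alg S a" using alg_mono[OF _ S(3)] pCons(1) by (simp add: alg_elts_def)
  from extend[OF S(1-3) this] obtain S' where S': "set_field S'" "finite S'" "k \<subseteq> S'" "S \<subseteq> S'" "a \<in> S'" by blast
  interpret S': sfield S' by standard fact
  have "p \<in> polys_over S'" using S(4) S'(4) unfolding polys_over_def by blast
  hence "pCons a p \<in> polys_over S'" using S'(5) by simp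
  with S'(1-3) show ?case by (intro exI[of _ S'] conjI)
qed

lemma root_alg:
  assumes "p \<in> polys_over alg_elts" "p \<noteq> 0" "poly p z = 0"
  shows "z \<in> alg_elts"
proof -
  obtain S where S: "set_field S" "finite S" "k \<subseteq> S" "p \<in> polys_over S" using poly_finite_field[OF assms(1)] by blast
  have "alg S z" unfolding alg_def by (rule bexI[OF _ S(4)]) (use assms(2,3) in simp)
  from extend[OF S(1-3) this] obtain S' where "set_field S'" "finite S'" "k \<subseteq> S'" "z \<in> S'" by blast
  thus ?thesis unfolding alg_elts_iff by (intro exI[of _ S'] conjI)
qed

end

lemma (in sfield) polys_over_prod:
  "(\<And>a. a \<in> I \<Longrightarrow> f a \<in> polys_over K) \<Longrightarrow> prod f I \<in> polys_over K"
  by (induction I rule: infinite_finite_induct) auto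

locale finite_base_closed = finite_base k for k :: "'a::alg_closed_field set"
begin

lemma ex_root:
  assumes "p \<in> polys_over alg_elts" "Polynomial.degree p > 0"
  shows "\<exists>z\<in>alg_elts. poly p z = 0"
proof -
  obtain z where "poly p z = 0" using alg_closed_imp_poly_has_root[OF assms(2)] by blast
  moreover have "p \<noteq> 0" using assms(2) by auto
  ultimately show ?thesis using root_alg[OF assms(1)] by blast
qed

text \<open>As in Euclid's argument: one plus the product of all \<open>X - a\<close> would have a
  root that is none of the \<open>a\<close>.\<close>

lemma infinite_alg_elts: "infinite alg_elts"
proof
  assume fin: "finite alg_elts"
  define q where "q = (\<Prod>a\<in>alg_elts. [:- a, 1:])"
  have q: "q \<in> polys_over alg_elts" unfolding q_def by (rule A.polys_over_prod) simp
  have dq: "Polynomial.degree q = card alg_elts" unfolding q_def by (subst degree_prod_eq_sum_degree) simp_all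
  have c: "card alg_elts > 0" unfolding card_gt_0_iff using fin A.one_mem by blast
  have "Polynomial.degree (q + 1) = Polynomial.degree q" by (rule degree_add_eq_left) (use dq c in simp)
  hence "Polynomial.degree (q + 1) > 0" using dq c by simp
  moreover have "q + 1 \<in> polys_over alg_elts" using q by simp
  ultimately obtain z where z: "z \<in> alg_elts" "poly (q + 1) z = 0" using ex_root by blast
  have "poly q z = 0" unfolding q_def poly_prod by (rule prod_zero[OF fin bexI[OF _ z(1)]]) simp
  thus False using z(2) by simp
qed

end

section \<open>The elliptic function field and its constant field extension as Weierstrass
  fields\<close>

context sfield
begin

text \<open>The field \<open>K(x, y)\<close> for \<open>y\<close> quadratic over \<open>K(x)\<close>.\<close>

lemma set_field_quadratic:
  assumes yy: "y * y = poly G x - poly H x * y" "G \<in> polys_over K" "H \<in> polys_over K"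
    and tr: "\<And>p. p \<in> polys_over K \<Longrightarrow> poly p x = 0 \<Longrightarrow> p = 0"
  defines "R \<equiv> {(poly A x + poly B x * y) / poly C x | A B C. A \<in> polys_over K \<and> B \<in> polys_over K \<and> C \<in> polys_over K \<and> C \<noteq> 0}"
  shows "set_field R"
proof -
  have nz: "poly p x \<noteq> 0" if "p \<in> polys_over K" "p \<noteq> 0" for p using tr that by blast
  have R_I: "f \<in> R" if "A \<in> polys_over K" "B \<in> polys_over K" "C \<in> polys_over K" "C \<noteq> 0" "f = (poly A x + poly B x * y) / poly C x" for A B C f
    unfolding R_def mem_Collect_eq
    by (rule exI[of _ A], rule exI[of _ B], rule exI[of _ C], intro conjI that)
  have one: "1 \<in> R" by (rule R_I[OF polys_over_1 polys_over_0 polys_over_1]) simp_all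
  have un: "- f \<in> R \<and> inverse f \<in> R" if fR: "f \<in> R" for f
  proof -
    obtain A B C where *: "A \<in> polys_over K" "B \<in> polys_over K" "C \<in> polys_over K" "C \<noteq> 0" "f = (poly A x + poly B x * y) / poly C x"
      using fR unfolding R_def by blast
    have "- f = (poly (- A) x + poly (- B) x * y) / poly C x" unfolding *(5) by (simp add: minus_divide_left)
    hence 1: "- f \<in> R" by (rule R_I[OF polys_over_uminus[OF *(1)] polys_over_uminus[OF *(2)] *(3,4)])
    define g where "g = poly A x + poly B x * y"
    define g' where "g' = poly (A - B * H) x + poly (- B) x * y"
    define N where "N = A * A - A * B * H - B * B * G"
    have NK: "N \<in> polys_over K" unfolding N_def by (intro polys_over_diff polys_over_mult *(1,2) yy(2,3))
    have "g * g' = poly A x * (poly A x - poly B x * poly H x) - poly B x * poly B x * poly H x * y - poly B x * poly B x * (y * y)"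
      by (simp add: g_def g'_def algebra_simps)
    also have "\<dots> = poly N x" unfolding yy(1) N_def by (simp add: algebra_simps)
    finally have gN: "g * g' = poly N x" .
    have "inverse f \<in> R"
    proof (cases "g = 0")
      case True
      hence "inverse f = 0" by (simp add: *(5) g_def)
      thus ?thesis by (intro R_I[OF polys_over_0 polys_over_0 polys_over_1]) simp_all
    next
      case gn: False
      show ?thesis
      proof (cases "g' = 0")
        case False
        hence N0: "N \<noteq> 0" using gN gn by auto
        have "inverse f = poly C x * g' / poly N x" unfolding *(5) g_def[symmetric] gN[symmetric] using gn False by simp
        also have "\<dots> = (poly (C * (A - B * H)) x + poly (C * (- B)) x * y) / poly N x" by (simp add: g'_def algebra_simps)
        finally show ?thesis by (rule R_I[OF _ _ NK N0, rotated 2]) (intro polys_over_mult polys_over_diff polys_over_uminus *(1-3) yy(3))+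
      next
        \<comment> \<open>The conjugate may vanish without \<open>g\<close>, since \<open>y\<close>
          is not assumed to lie outside \<open>K(x)\<close>. Then \<open>poly B x * y\<close> is a
          polynomial in \<open>x\<close>, and so is \<open>g\<close>.\<close>
        case True
        have "poly B x * y = poly (A - B * H) x" using True by (simp add: g'_def)
        hence g: "g = poly (A + A - B * H) x" by (simp add: g_def)
        have "A + A - B * H \<noteq> 0"
        proof
          assume "A + A - B * H = 0"
          with g have "g = poly 0 x" by (simp only:)
          thus False using gn by simp
        qed
        moreover have "A + A - B * H \<in> polys_over K" by (intro polys_over_add polys_over_diff polys_over_mult *(1,2) yy(3))
        moreover have "inverse f = (poly C x + poly 0 x * y) / poly (A + A - B * H) x"
          unfolding *(5) g_def[symmetric] g by simp
        ultimately show ?thesis using R_I[OF *(3) polys_over_0, of "A + A - B * H" "inverse f"] by simp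
      qed
    qed
    thus ?thesis using 1 by simp
  qed
  have bin: "f + f' \<in> R \<and> f * f' \<in> R" if fR: "f \<in> R" "f' \<in> R" for f f'
  proof -
    obtain A B C where 1: "A \<in> polys_over K" "B \<in> polys_over K" "C \<in> polys_over K" "C \<noteq> 0" "f = (poly A x + poly B x * y) / poly C x"
      using fR(1) unfolding R_def by blast
    obtain A' B' C' where 2: "A' \<in> polys_over K" "B' \<in> polys_over K" "C' \<in> polys_over K" "C' \<noteq> 0" "f' = (poly A' x + poly B' x * y) / poly C' x"
      using fR(2) unfolding R_def by blast
    have CC: "C * C' \<in> polys_over K" "C * C' \<noteq> 0" using 1(3,4) 2(3,4) by simp_all
    have "f + f' = (poly (A * C' + A' * C) x + poly (B * C' + B' * C) x * y) / poly (C * C') x"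
      unfolding 1(5) 2(5) using nz[OF 1(3,4)] nz[OF 2(3,4)] by (subst add_frac_eq) (simp_all add: algebra_simps)
    hence a: "f + f' \<in> R" by (rule R_I[OF _ _ CC, rotated 2]) (intro polys_over_mult polys_over_add 1(1-3) 2(1-3))+
    have "(poly A x + poly B x * y) * (poly A' x + poly B' x * y) = poly A x * poly A' x
         + (poly A x * poly B' x + poly B x * poly A' x) * y + poly B x * poly B' x * (y * y)"
      by (simp add: algebra_simps)
    also have "\<dots> = poly (A * A' + B * B' * G) x + poly (A * B' + B * A' - B * B' * H) x * y"
      unfolding yy(1) by (simp add: algebra_simps)
    finally have "f * f' = (poly (A * A' + B * B' * G) x + poly (A * B' + B * A' - B * B' * H) x * y) / poly (C * C') x"
      unfolding 1(5) 2(5) by simp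
    hence m: "f * f' \<in> R" by (rule R_I[OF _ _ CC, rotated 2]) (intro polys_over_mult polys_over_add polys_over_diff 1(1-3) 2(1-3) yy(2,3))+
    show ?thesis using a m by simp
  qed
  show ?thesis unfolding set_field_def 
  proof (intro conjI ballI)
    show "1 \<in> R" by (rule one)
    fix f assume f: "f \<in> R"
    show "- f \<in> R" "inverse f \<in> R" using un[OF f] by simp_all
    fix g assume g: "g \<in> R"
    show "f + g \<in> R" "f * g \<in> R" using bin[OF f g] by simp_all
  qed
qed

end

lemma generate_field_subset:
  assumes "set_field (S :: 'a::field set)" "A \<subseteq> S"
  shows "generate_field ring_of_type_algebra A \<subseteq> S"
proof -
  interpret R: Ring.field "ring_of_type_algebra :: 'a ring" by (rule field_rta)
  show ?thesis by (rule R.generate_field_min_subfield1) (use assms subfield_rta_iff in auto)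
qed

lemma set_field_generate: "set_field (generate_field ring_of_type_algebra (A :: 'a::field set))"
proof -
  interpret R: Ring.field "ring_of_type_algebra :: 'a ring" by (rule field_rta)
  show ?thesis using R.generate_field_is_subfield[of A] subfield_rta_iff by auto
qed


locale elliptic =
  fixes K :: "'e::field set" and x y a1 a2 a3 a4 a6 :: 'e
  assumes sK: "set_field K" and finK: "finite K"
    and x_trans': "\<not> alg K x"
    and gen: "generate_field ring_of_type_algebra (K \<union> {x, y}) = UNIV"
    and a_K: "a1 \<in> K" "a2 \<in> K" "a3 \<in> K" "a4 \<in> K" "a6 \<in> K"
    and nonsing: "nonsingular_weierstrass K a1 a2 a3 a4 a6"
    and wei: "y^2 + a1 * x * y + a3 * y = x^3 + a2 * x^2 + a4 * x + a6"
begin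

abbreviation "L \<equiv> const_closure K"
abbreviation "M \<equiv> const_ext K"

sublocale KK: sfield K by standard (rule sK)

lemma set_field_to_ac: "set_field (to_ac ` K)"
  unfolding set_field_def
proof (intro conjI ballI)
  show "1 \<in> to_ac ` K" by (rule image_eqI[of _ _ 1]) simp_all
  fix u assume "u \<in> to_ac ` K"
  then obtain a where a: "a \<in> K" "u = to_ac a" by blast
  show "- u \<in> to_ac ` K" using a by (intro image_eqI[of _ _ "- a"]) simp_all
  show "inverse u \<in> to_ac ` K" using a by (intro image_eqI[of _ _ "inverse a"]) simp_all
  fix w assume "w \<in> to_ac ` K"
  then obtain b where b: "b \<in> K" "w = to_ac b" by blast
  show "u + w \<in> to_ac ` K" using a b by (intro image_eqI[of _ _ "a + b"]) simp_all
  show "u * w \<in> to_ac ` K" using a b by (intro image_eqI[of _ _ "a * b"]) simp_all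
qed

sublocale k0: finite_base_closed "to_ac ` K"
  by standard (simp_all add: set_field_to_ac finK)

lemma L_eq: "L = k0.alg_elts"
  unfolding const_closure_def k0.alg_elts_def
  using algebraic_rta_iff[OF set_field_to_ac] by (simp add: over_def)

lemma set_field_L: "set_field L" unfolding L_eq by (rule k0.A.set_field)

sublocale LL: sfield L by standard (rule set_field_L)

lemma to_ac_L: "c \<in> K \<Longrightarrow> to_ac c \<in> L"
  using k0.k_alg unfolding L_eq by blast

lemma a_L: "to_ac a1 \<in> L" "to_ac a2 \<in> L" "to_ac a3 \<in> L" "to_ac a4 \<in> L" "to_ac a6 \<in> L"
  using a_K to_ac_L by blast+

lemma hom_to_ac: "hom_on A to_ac" by (simp add: hom_on_def)

text \<open>An element algebraic over \<open>L\<close> lies in a finite field, so it is 0 or a root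
  of unity. Either property descends along \<open>to_ac\<close> and makes \<open>z\<close> algebraic
  over \<open>K\<close>.\<close>

lemma to_ac_trans:
  assumes "\<not> alg K z"
  shows "p \<in> polys_over L \<Longrightarrow> poly p (to_ac z) = 0 \<Longrightarrow> p = 0"
proof (rule ccontr)
  assume p: "p \<in> polys_over L" "poly p (to_ac z) = 0" "p \<noteq> 0"
  hence "to_ac z \<in> k0.alg_elts" using k0.root_alg[of p "to_ac z"] unfolding L_eq by simp
  then obtain S where S: "set_field S" "finite S" "to_ac z \<in> S" unfolding k0.alg_elts_iff by blast
  have "alg K z"
  proof (cases "z = 0")
    case True thus ?thesis unfolding alg_def by (intro bexI[of _ "[:0, 1:]"]) simp_all
  next
    case False
    obtain n where n: "n > 0" "to_ac z ^ n = 1" using finite_field_power[OF S] False by auto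
    hence "to_ac (z ^ n) = to_ac 1" by simp
    hence "z ^ n = 1" by (simp only: to_ac_eq_iff)
    thus ?thesis using alg_root_of_unity[OF sK _ n(1)] by blast
  qed
  thus False using assms by simp
qed

lemma x_trans'': "p \<in> polys_over K \<Longrightarrow> poly p x = 0 \<Longrightarrow> p = 0"
  using x_trans' unfolding alg_def by blast

lemma wei': "y * y = poly [:a6, a4, a2, 1:] x - poly [:a3, a1:] x * y"
  using wei by (simp add: algebra_simps power2_eq_square power3_eq_cube)

lemma wei_ac: "to_ac y^2 + to_ac a1 * to_ac x * to_ac y + to_ac a3 * to_ac y
    = to_ac x^3 + to_ac a2 * to_ac x^2 + to_ac a4 * to_ac x + to_ac a6"
  using arg_cong[OF wei, of to_ac] by simp

lemma wei_ac': "to_ac y * to_ac y = poly [:to_ac a6, to_ac a4, to_ac a2, 1:] (to_ac x) - poly [:to_ac a3, to_ac a1:] (to_ac x) * to_ac y"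
  using wei_ac by (simp add: algebra_simps power2_eq_square power3_eq_cube)

lemma nonsing_L:
  assumes "u \<in> L" "w \<in> L" "w^2 + to_ac a1 * u * w + to_ac a3 * w = u^3 + to_ac a2 * u^2 + to_ac a4 * u + to_ac a6"
    "to_ac a1 * w = 3 * u^2 + 2 * to_ac a2 * u + to_ac a4" "2 * w + to_ac a1 * u + to_ac a3 = 0"
  shows False
  using nonsing assms unfolding nonsingular_weierstrass_def by blast

lemma ex_root_L: "p \<in> polys_over L \<Longrightarrow> Polynomial.degree p > 0 \<Longrightarrow> \<exists>z\<in>L. poly p z = 0"
  using k0.ex_root unfolding L_eq by blast

text \<open>In characteristic 2 with \<open>a1 = a3 = 0\<close> the derivative with respect to
  \<open>y\<close> vanishes identically and the other one is \<open>u^2 + a4\<close> up to sign. A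
  root \<open>u\<close>, together with a square root of the cubic at \<open>u\<close>, is a singular
  point.\<close>

lemma separable_ac: "\<not> ((2 :: 'e alg_closure) = 0 \<and> to_ac a1 = 0 \<and> to_ac a3 = 0)"
proof
  assume *: "(2 :: 'e alg_closure) = 0 \<and> to_ac a1 = 0 \<and> to_ac a3 = 0"
  have three: "(3 :: 'e alg_closure) = 1" using * by (metis add_0 numeral_Bit1 numeral_One one_add_one mult_2 numeral_3_eq_3 add.commute numeral_plus_one semiring_norm(5))
  obtain u where u: "u \<in> L" "poly [:to_ac a4, 0, 1:] u = 0"
    using ex_root_L[of "[:to_ac a4, 0, 1:]"] a_L by auto
  obtain w where w: "w \<in> L" "poly [:- (u^3 + to_ac a2 * u^2 + to_ac a4 * u + to_ac a6), 0, 1:] w = 0"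
    using ex_root_L[of "[:- (u^3 + to_ac a2 * u^2 + to_ac a4 * u + to_ac a6), 0, 1:]"] a_L u(1) by auto
  have "w^2 - (u^3 + to_ac a2 * u^2 + to_ac a4 * u + to_ac a6)
      = poly [:- (u^3 + to_ac a2 * u^2 + to_ac a4 * u + to_ac a6), 0, 1:] w"
    by (simp add: power2_eq_square algebra_simps)
  hence w2: "w^2 = u^3 + to_ac a2 * u^2 + to_ac a4 * u + to_ac a6" unfolding w(2) by simp
  have u2: "u^2 + to_ac a4 = 0" using u(2) by (simp add: power2_eq_square add.commute)
  show False by (rule nonsing_L[OF u(1) w(1)]) (use * three w2 u2 in simp_all)
qed

lemma separable_E: "\<not> ((2 :: 'e) = 0 \<and> a1 = 0 \<and> a3 = 0)"
proof
  assume *: "(2 :: 'e) = 0 \<and> a1 = 0 \<and> a3 = 0"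
  have "to_ac (2 :: 'e) = to_ac 0" by (rule arg_cong[OF conjunct1[OF *]])
  hence "(2 :: 'e alg_closure) = 0" by (simp only: to_ac_numeral to_ac_0)
  thus False using separable_ac conjunct2[OF *] by simp
qed

lemma M_set_field: "set_field M" unfolding const_ext_def by (rule set_field_generate)

sublocale MM: sfield M by standard (rule M_set_field)

lemma L_M: "c \<in> L \<Longrightarrow> c \<in> M" unfolding const_ext_def by (rule generate_field.incl) simp

lemma to_ac_M [simp]: "to_ac z \<in> M" unfolding const_ext_def by (rule generate_field.incl) simp

definition "RE = {(poly A x + poly B x * y) / poly C x | A B C. A \<in> polys_over K \<and> B \<in> polys_over K \<and> C \<in> polys_over K \<and> C \<noteq> 0}"

lemma RE_UNIV: "f \<in> RE"
proof -
  have s: "set_field RE" unfolding RE_def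
    by (rule KK.set_field_quadratic[OF wei' _ _ x_trans'']) (use a_K in simp_all)
  have RE_I: "f \<in> RE" if "A \<in> polys_over K" "B \<in> polys_over K" "f = poly A x + poly B x * y" for A B f
    unfolding RE_def mem_Collect_eq
    by (rule exI[of _ A], rule exI[of _ B], rule exI[of _ 1]) (use that in simp)
  have "K \<union> {x, y} \<subseteq> RE"
  proof
    fix c assume "c \<in> K \<union> {x, y}"
    then consider "c \<in> K" | "c = x" | "c = y" by blast
    thus "c \<in> RE"
    proof cases
      case 1 thus ?thesis by (intro RE_I[of "[:c:]" 0]) simp_all
    next
      case 2 thus ?thesis by (intro RE_I[of "[:0, 1:]" 0]) simp_all
    next
      case 3 thus ?thesis by (intro RE_I[of 0 1]) simp_all
    qed
  qed
  from generate_field_subset[OF s this] show ?thesis unfolding gen by blast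
qed

definition "RM = {(poly A (to_ac x) + poly B (to_ac x) * to_ac y) / poly C (to_ac x) | A B C.
   A \<in> polys_over L \<and> B \<in> polys_over L \<and> C \<in> polys_over L \<and> C \<noteq> 0}"

lemma RM_M: "f \<in> M \<Longrightarrow> f \<in> RM"
proof -
  assume f: "f \<in> M"
  have s: "set_field RM" unfolding RM_def
    by (rule LL.set_field_quadratic[OF wei_ac' _ _ to_ac_trans[OF x_trans']]) (use a_L in simp_all)
  then interpret RM: sfield RM by unfold_locales
  have RM_I: "f \<in> RM" if "A \<in> polys_over L" "B \<in> polys_over L" "f = poly A (to_ac x) + poly B (to_ac x) * to_ac y" for A B f
    unfolding RM_def mem_Collect_eq
    by (rule exI[of _ A], rule exI[of _ B], rule exI[of _ 1]) (use that in simp)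
  have LR: "c \<in> RM" if "c \<in> L" for c using that by (intro RM_I[of "[:c:]" 0]) simp_all
  \<comment> \<open>The preimage of \<open>RM\<close> under \<open>to_ac\<close> is a field
    containing \<open>K\<close>, \<open>x\<close> and \<open>y\<close>, hence everything.\<close>
  have "set_field {e. to_ac e \<in> RM}" unfolding set_field_def by simp
  moreover have "K \<union> {x, y} \<subseteq> {e. to_ac e \<in> RM}"
  proof
    fix c assume "c \<in> K \<union> {x, y}"
    then consider "c \<in> K" | "c = x" | "c = y" by blast
    hence "to_ac c \<in> RM"
    proof cases
      case 1 thus ?thesis by (intro LR to_ac_L)
    next
      case 2 thus ?thesis by (intro RM_I[of "[:0, 1:]" 0]) simp_all
    next
      case 3 thus ?thesis by (intro RM_I[of 0 1]) simp_all
    qed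
    thus "c \<in> {e. to_ac e \<in> RM}" by simp
  qed
  ultimately have "UNIV \<subseteq> {e. to_ac e \<in> RM}" using generate_field_subset unfolding gen[symmetric] by blast
  hence "range to_ac \<union> L \<subseteq> RM" using LR by blast
  from generate_field_subset[OF s this] f show ?thesis unfolding const_ext_def by blast
qed

sublocale E: wcurve K UNIV x y a1 a2 a3 a4 a6
proof
  show "set_field (UNIV :: 'e set)" by (simp add: set_field_def)
  show "\<exists>A\<in>polys_over K. \<exists>B\<in>polys_over K. \<exists>C\<in>polys_over K. C \<noteq> 0 \<and> f = (poly A x + poly B x * y) / poly C x" for f
    using RE_UNIV[of f] unfolding RE_def by blast
  show "p = 0" if "p \<in> polys_over K" "poly p x = 0" for p by (rule x_trans''[OF that])
  fix a b assume *: "a \<in> K" "b \<in> K" "b^2 + a1 * a * b + a3 * b = a^3 + a2 * a^2 + a4 * a + a6"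
     "a1 * b = 3 * a^2 + 2 * a2 * a + a4" "2 * b + a1 * a + a3 = 0"
  show False
    using nonsing_L[OF to_ac_L[OF *(1)] to_ac_L[OF *(2)]] arg_cong[OF *(3), of to_ac] arg_cong[OF *(4), of to_ac] arg_cong[OF *(5), of to_ac]
    by simp
qed (use a_K wei separable_E in simp_all)

sublocale F: wcurve_closed L M "to_ac x" "to_ac y" "to_ac a1" "to_ac a2" "to_ac a3" "to_ac a4" "to_ac a6"
proof
  show "L \<subseteq> M" using L_M by blast
  show "\<exists>A\<in>polys_over L. \<exists>B\<in>polys_over L. \<exists>C\<in>polys_over L. C \<noteq> 0 \<and> f = (poly A (to_ac x) + poly B (to_ac x) * to_ac y) / poly C (to_ac x)"
    if "f \<in> M" for f using RM_M[OF that] unfolding RM_def by blast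
  show "p = 0" if "p \<in> polys_over L" "poly p (to_ac x) = 0" for p by (rule to_ac_trans[OF x_trans' that])
  show "infinite L" unfolding L_eq by (rule k0.infinite_alg_elts)
  show "\<exists>b\<in>L. b^2 + to_ac a1 * a * b + to_ac a3 * b = a^3 + to_ac a2 * a^2 + to_ac a4 * a + to_ac a6" if a: "a \<in> L" for a
  proof -
    let ?p = "[:- (a^3 + to_ac a2 * a^2 + to_ac a4 * a + to_ac a6), to_ac a1 * a + to_ac a3, 1:]"
    have "?p \<in> polys_over L" using a a_L by simp
    then obtain b where "b \<in> L" "poly ?p b = 0" using ex_root_L[of ?p] by auto
    moreover from this(2) have "b^2 + to_ac a1 * a * b + to_ac a3 * b - (a^3 + to_ac a2 * a^2 + to_ac a4 * a + to_ac a6) = 0"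
      by (simp add: algebra_simps power2_eq_square)
    ultimately show ?thesis by (intro bexI[of _ b]) simp_all
  qed
  show False if "a \<in> L" "b \<in> L" "b^2 + to_ac a1 * a * b + to_ac a3 * b = a^3 + to_ac a2 * a^2 + to_ac a4 * a + to_ac a6"
    "to_ac a1 * b = 3 * a^2 + 2 * to_ac a2 * a + to_ac a4" "2 * b + to_ac a1 * a + to_ac a3 = 0" for a b
    by (rule nonsing_L[OF that])
qed (use a_L wei_ac separable_ac in simp_all)

end


section \<open>Lifting places and automorphisms to the constant field extension\<close>

context elliptic
begin

text \<open>\<open>e1\<close> and \<open>e2\<close> witness that the restricted ring is strictly
  larger than \<open>K\<close> and strictly smaller than the whole field.\<close>

lemma restrict_place:
  assumes P: "P \<in> F.Pl" and e1: "to_ac e1 \<in> F.V P" "e1 \<notin> K" and e2: "to_ac e2 \<notin> F.V P"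
  shows "{e. to_ac e \<in> P} \<in> E.Pl" "E.V {e. to_ac e \<in> P} = {e. to_ac e \<in> F.V P}"
proof -
  define W where "W = {e. to_ac e \<in> F.V P}"
  have KW: "K \<subseteq> W" using F.K_V[OF P] to_ac_L by (auto simp: W_def)
  have vr: "is_valuation_ring K UNIV W" unfolding E.valuation_ring_iff
  proof (intro conjI ballI)
    show "1 \<in> W" using F.V_one[OF P] by (simp add: W_def)
    show "- a \<in> W" if "a \<in> W" for a using F.V_uminus[OF P] that by (simp add: W_def)
    show "a + b \<in> W" if "a \<in> W" "b \<in> W" for a b using F.V_add[OF P] that by (simp add: W_def)
    show "a * b \<in> W" if "a \<in> W" "b \<in> W" for a b using F.V_mult[OF P] that by (simp add: W_def)
    have "e1 \<in> W" using e1(1) by (simp add: W_def)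
    thus "K \<subset> W" using KW e1(2) by blast
    have "e2 \<notin> W" using e2 by (simp add: W_def)
    thus "W \<subset> UNIV" by blast
    fix z show "z \<in> W \<or> inverse z \<in> W" using F.V_cases[OF P to_ac_M, of z] by (simp add: W_def)
  qed
  have P': "{e. to_ac e \<in> P} = {z \<in> W. z = 0 \<or> inverse z \<notin> W}"
    using F.P_iff[OF P] by (simp add: W_def)
  show "{e. to_ac e \<in> P} \<in> E.Pl" unfolding E.places_iff by (intro exI[of _ W] conjI vr P')
  show "E.V {e. to_ac e \<in> P} = {e. to_ac e \<in> F.V P}" using E.place_ring_eq[OF vr P'] by (simp add: W_def)
qed

lemma to_ac_image_subset: "to_ac ` Q \<subseteq> P \<longleftrightarrow> Q \<subseteq> {e. to_ac e \<in> P}"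
  by blast

lemma lift_inf: "to_ac ` E.\<O> \<subseteq> F.\<O>" "P \<in> F.Pl \<Longrightarrow> to_ac ` E.\<O> \<subseteq> P \<Longrightarrow> P = F.\<O>"
proof -
  have xi: "inverse x \<notin> K" using KK.inverse_mem[of "inverse x"] E.x_not_K by auto
  have xF: "inverse (to_ac x) \<in> F.\<O>" using F.notV[OF F.inf_place(1) to_ac_M F.inf_place(2)] .
  have e1: "to_ac (inverse x) \<in> F.V F.\<O>" using F.P_V[OF F.inf_place(1) xF] by simp
  note r = restrict_place[OF F.inf_place(1) e1 xi F.inf_place(2)]
  have "{e. to_ac e \<in> F.\<O>} = E.\<O>"
    by (rule E.inf_eqI[OF r(1)]) (use r(2) F.inf_place(2) in simp)
  thus "to_ac ` E.\<O> \<subseteq> F.\<O>" unfolding to_ac_image_subset by simp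
  assume P: "P \<in> F.Pl" "to_ac ` E.\<O> \<subseteq> P"
  have "inverse x \<in> E.\<O>" using E.notV[OF E.inf_place(1) UNIV_I E.inf_place(2)] .
  hence "to_ac (inverse x) \<in> P" using P(2) by blast
  moreover have "to_ac (inverse x) \<noteq> 0" using E.x_nz[OF E.inf_place] by simp
  ultimately have "inverse (to_ac (inverse x)) \<notin> F.V P" by (rule F.P_inverse[OF P(1)])
  hence "to_ac x \<notin> F.V P" by simp
  thus "P = F.\<O>" by (rule F.inf_eqI[OF P(1)])
qed

lemma lift_at:
  assumes Q: "E.place_at Q a b" and Q': "F.place_at Q' (to_ac a) (to_ac b)"
  shows "to_ac ` Q \<subseteq> Q'"
proof -
  have QP: "Q' \<in> F.Pl" "to_ac x - to_ac a \<in> Q'" "to_ac y - to_ac b \<in> Q'" using Q' by (simp_all add: F.place_at_def)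
  have ab: "a \<in> K" "b \<in> K" using Q by (simp_all add: E.place_at_def)
  have xa: "x - a \<noteq> 0" using E.x_not_K ab(1) by (metis right_minus_eq)
  have "to_ac (x - a) \<in> Q'" "to_ac (x - a) \<noteq> 0" using QP(2) xa by (simp_all only: to_ac_diff[of x a, symmetric] to_ac_eq_0_iff not_False_eq_True)
  hence "inverse (to_ac (x - a)) \<notin> F.V Q'" by (rule F.P_inverse[OF QP(1)])
  hence e2: "to_ac (inverse (x - a)) \<notin> F.V Q'" by (simp only: to_ac_inverse simp_thms)
  note r = restrict_place[OF QP(1) F.at_V(1)[OF Q'] E.x_not_K e2]
  have "E.place_at {e. to_ac e \<in> Q'} a b" unfolding E.place_at_def using r(1) ab QP(2,3) by simp
  from E.at_unique[OF this Q] show ?thesis unfolding to_ac_image_subset by simp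
qed

lemma ex_place_at:
  assumes "E.place_at Q a b"
  shows "\<exists>Q'. F.place_at Q' (to_ac a) (to_ac b)"
proof -
  have ab: "a \<in> K" "b \<in> K" using assms by (simp_all add: E.place_at_def)
  have "to_ac b^2 + to_ac a1 * to_ac a * to_ac b + to_ac a3 * to_ac b = to_ac a^3 + to_ac a2 * to_ac a^2 + to_ac a4 * to_ac a + to_ac a6"
    using arg_cong[OF E.at_curve(1)[OF assms], of to_ac] by simp
  from F.ex_translation_at[OF to_ac_L[OF ab(1)] to_ac_L[OF ab(2)] this] show ?thesis by blast
qed

lemma at_if_lift:
  assumes Q: "E.place_at Q a b" and P: "P \<in> F.Pl" "to_ac ` Q \<subseteq> P"
  shows "F.place_at P (to_ac a) (to_ac b)"
proof -
  have "a \<in> K" "b \<in> K" "x - a \<in> Q" "y - b \<in> Q" using Q by (simp_all add: E.place_at_def)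
  have "to_ac (x - a) \<in> P" "to_ac (y - b) \<in> P" by (rule subsetD[OF P(2) imageI], fact)+
  hence 1: "to_ac x - to_ac a \<in> P" "to_ac y - to_ac b \<in> P" by (simp_all only: to_ac_diff)
  have 2: "to_ac a \<in> L" "to_ac b \<in> L" by (rule to_ac_L, fact)+
  show ?thesis unfolding F.place_at_def by (intro conjI P(1) 1 2)
qed

abbreviation "lift \<equiv> lift_place K"

text \<open>\<O> lifts to \<O>, and the place at \<open>(a, b)\<close> to the place at the same
  point above. Uniqueness holds because a place above \<open>Q\<close> is again a pole of
  \<open>x\<close>, or is centred at that point.\<close>

lemma ex1_lift:
  assumes Q: "Q \<in> E.Rat"
  shows "\<exists>Q'\<in>F.Rat. to_ac ` Q \<subseteq> Q' \<and> (\<forall>P\<in>F.Pl. to_ac ` Q \<subseteq> P \<longrightarrow> P = Q')"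
proof (cases "Q = E.\<O>")
  case True
  show ?thesis unfolding True
    by (intro bexI[OF _ F.O_rational] conjI lift_inf(1) ballI impI) (rule lift_inf(2))
next
  case False
  obtain a b where ab: "E.place_at Q a b" using E.rational_at_ex[OF Q False] by blast
  obtain Q' where Q': "F.place_at Q' (to_ac a) (to_ac b)" using ex_place_at[OF ab] by blast
  show ?thesis
    by (intro bexI[OF _ F.rational_at[OF Q']] conjI lift_at[OF ab Q'] ballI impI F.at_unique[OF at_if_lift[OF ab] Q'])
qed

lemma lift_eqI:
  assumes "Q \<in> E.Rat" "P \<in> F.Pl" "to_ac ` Q \<subseteq> P" shows "lift Q = P"
proof -
  obtain Q' where Q': "Q' \<in> F.Rat" "to_ac ` Q \<subseteq> Q'" "\<forall>P\<in>F.Pl. to_ac ` Q \<subseteq> P \<longrightarrow> P = Q'" using ex1_lift[OF assms(1)] by blast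
  show ?thesis unfolding lift_place_def
  proof (rule the_equality)
    show "P \<in> F.Pl \<and> to_ac ` Q \<subseteq> P" using assms by simp
    fix R assume R: "R \<in> F.Pl \<and> to_ac ` Q \<subseteq> R"
    have "R = Q'" by (rule mp[OF bspec[OF Q'(3) conjunct1[OF R]] conjunct2[OF R]])
    moreover have "P = Q'" by (rule mp[OF bspec[OF Q'(3) assms(2)] assms(3)])
    ultimately show "R = P" by (simp only:)
  qed
qed

lemma lift: assumes "Q \<in> E.Rat" shows "lift Q \<in> F.Rat" "to_ac ` Q \<subseteq> lift Q"
proof -
  obtain Q' where Q': "Q' \<in> F.Rat" "to_ac ` Q \<subseteq> Q'" using ex1_lift[OF assms] by blast
  have "lift Q = Q'" by (rule lift_eqI[OF assms F.Rat_Pl[OF Q'(1)] Q'(2)])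
  thus "lift Q \<in> F.Rat" "to_ac ` Q \<subseteq> lift Q" using Q' by (simp_all only:)
qed

lemma lift_O: "lift E.\<O> = F.\<O>"
  by (rule lift_eqI[OF E.O_rational F.inf_place(1) lift_inf(1)])

definition "lifts \<sigma> \<sigma>' \<longleftrightarrow> \<sigma> \<in> E.Aut \<and> \<sigma>' \<in> F.Aut \<and> (\<forall>z. \<sigma>' (to_ac z) = to_ac (\<sigma> z))"

lemma lifts_image:
  assumes "lifts \<sigma> \<sigma>'" "Q \<in> E.Rat"
  shows "lift (\<sigma> ` Q) = \<sigma>' ` lift Q"
proof (rule lift_eqI)
  have s: "\<sigma> \<in> E.Aut" "\<sigma>' \<in> F.Aut" "\<forall>z. \<sigma>' (to_ac z) = to_ac (\<sigma> z)" using assms(1) by (simp_all add: lifts_def)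
  show "\<sigma> ` Q \<in> E.Rat" by (rule E.image_rational[OF s(1) assms(2)])
  show "\<sigma>' ` lift Q \<in> F.Pl" by (rule F.image_place(1)[OF s(2) F.Rat_Pl[OF lift(1)[OF assms(2)]]])
  show "to_ac ` \<sigma> ` Q \<subseteq> \<sigma>' ` lift Q"
  proof (intro subsetI, elim imageE)
    fix z w u assume e: "z = to_ac w" "w = \<sigma> u" "u \<in> Q"
    have "z = \<sigma>' (to_ac u)" using s(3) e(1,2) by simp
    thus "z \<in> \<sigma>' ` lift Q" by (rule image_eqI) (rule subsetD[OF lift(2)[OF assms(2)] imageI[OF e(3)]])
  qed
qed

lemma lifts_comp: "lifts \<sigma> \<sigma>' \<Longrightarrow> lifts \<tau> \<tau>' \<Longrightarrow> lifts (\<sigma> \<circ> \<tau>) (\<sigma>' \<circ> \<tau>')"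
  unfolding lifts_def by (simp add: E.comp_aut F.comp_aut)

lemma lifts_id: "lifts id id"
  unfolding lifts_def by (intro conjI allI E.id_aut F.id_aut) (simp only: id_apply)

lemma lifts_if_agree:
  assumes s: "\<sigma> \<in> E.Aut" "hom_on M \<sigma>'" "\<And>c. c \<in> L \<Longrightarrow> \<sigma>' c = c"
    and xy: "\<sigma>' (to_ac x) = to_ac (\<sigma> x)" "\<sigma>' (to_ac y) = to_ac (\<sigma> y)"
  shows "\<sigma>' (to_ac z) = to_ac (\<sigma> z)"
proof -
  have h1: "hom_on UNIV (\<sigma>' \<circ> to_ac)" unfolding hom_on_def o_apply to_ac_1 to_ac_add to_ac_mult
    by (intro conjI ballI MM.hom_one[OF s(2)] MM.hom_add[OF s(2)] MM.hom_mult[OF s(2)] to_ac_M)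
  have h2: "hom_on UNIV (to_ac \<circ> \<sigma>)" unfolding hom_on_def o_apply E.aut_one[OF s(1)]
    by (intro conjI ballI) (simp_all add: E.aut_add[OF s(1)] E.aut_mult[OF s(1)])
  have "(\<sigma>' \<circ> to_ac) z = (to_ac \<circ> \<sigma>) z"
  proof (rule E.hom_unique[OF h1 h2])
    show "(\<sigma>' \<circ> to_ac) c = (to_ac \<circ> \<sigma>) c" if "c \<in> K" for c
      unfolding o_apply E.aut_K[OF s(1) that] by (rule s(3)[OF to_ac_L[OF that]])
    show "(\<sigma>' \<circ> to_ac) x = (to_ac \<circ> \<sigma>) x" "(\<sigma>' \<circ> to_ac) y = (to_ac \<circ> \<sigma>) y"
      unfolding o_apply by (rule xy)+
  qed (rule UNIV_I)
  thus ?thesis unfolding o_apply .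
qed

text \<open>The extension is the substitution of the images of \<open>x\<close> and
  \<open>y\<close>; \<open>to_ac_trans\<close> supplies the transcendence that
  \<open>F.ex_hom\<close> asks for.\<close>

lemma ex_lifts:
  assumes s: "\<sigma> \<in> E.Aut" shows "\<exists>\<sigma>'. lifts \<sigma> \<sigma>'"
proof -
  have na: "\<not> alg K (\<sigma> x)"
  proof
    assume "alg K (\<sigma> x)"
    then obtain p where p: "p \<in> polys_over K" "p \<noteq> 0" "poly p (\<sigma> x) = 0" unfolding alg_def by blast
    have "\<sigma> (poly p x) = poly p (\<sigma> x)"
      by (rule E.hom_poly[OF E.aut_hom[OF s] E.aut_K[OF s] p(1) UNIV_I])
    hence "\<sigma> (poly p x) = 0" unfolding p(3) .
    hence "poly p x = 0" by (rule iffD1[OF E.aut_eq_0[OF s UNIV_I]])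
    with p(2) show False using x_trans''[OF p(1)] by blast
  qed
  have eqE: "\<sigma> y^2 + a1 * \<sigma> x * \<sigma> y + a3 * \<sigma> y = \<sigma> x^3 + a2 * \<sigma> x^2 + a4 * \<sigma> x + a6"
    using arg_cong[OF wei, of \<sigma>] E.aut_K[OF s] a_K
    by (simp add: E.aut_add[OF s] E.aut_mult[OF s] E.aut_power[OF s])
  have eqF: "to_ac (\<sigma> y)^2 + to_ac a1 * to_ac (\<sigma> x) * to_ac (\<sigma> y) + to_ac a3 * to_ac (\<sigma> y)
     = to_ac (\<sigma> x)^3 + to_ac a2 * to_ac (\<sigma> x)^2 + to_ac a4 * to_ac (\<sigma> x) + to_ac a6"
    using arg_cong[OF eqE, of to_ac] by simp
  have "\<exists>\<phi>. hom_on M \<phi> \<and> \<phi> ` M \<subseteq> M \<and> (\<forall>c\<in>L. \<phi> c = c) \<and> \<phi> (to_ac x) = to_ac (\<sigma> x) \<and> \<phi> (to_ac y) = to_ac (\<sigma> y)"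
    by (rule F.ex_hom[OF to_ac_M to_ac_M eqF]) (rule to_ac_trans[OF na])
  then obtain \<phi> where f: "hom_on M \<phi>" "\<phi> ` M \<subseteq> M" "\<forall>c\<in>L. \<phi> c = c" "\<phi> (to_ac x) = to_ac (\<sigma> x)" "\<phi> (to_ac y) = to_ac (\<sigma> y)"
    by (elim exE conjE)
  have fK: "\<phi> c = c" if "c \<in> L" for c by (rule bspec[OF f(3) that])
  have ag: "\<phi> (to_ac z) = to_ac (\<sigma> z)" for z by (rule lifts_if_agree[OF s f(1) fK f(4,5)])
  have sur: "to_ac z \<in> \<phi> ` M" for z
  proof -
    have "z \<in> \<sigma> ` UNIV" unfolding E.aut_image[OF s] by (rule UNIV_I)
    then obtain u where u: "z = \<sigma> u" by (rule imageE)
    show ?thesis unfolding u ag[symmetric] by (rule imageI[OF to_ac_M])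
  qed
  have "\<phi> \<in> F.Aut" by (rule F.aut_if_surj[OF f(1,2) _ sur[of x] sur[of y]]) (rule fK)
  thus ?thesis unfolding lifts_def by (intro exI[of _ \<phi>] conjI allI s ag)
qed

lemma ex_lift_inverse:
  assumes l: "lifts \<sigma> \<sigma>'"
  shows "\<exists>\<rho> \<rho>'. lifts \<rho> \<rho>' \<and> \<rho> \<circ> \<sigma> = id \<and> \<sigma> \<circ> \<rho> = id \<and> (\<forall>P\<in>F.Pl. \<sigma>' ` (\<rho>' ` P) = P)"
proof -
  have s: "\<sigma> \<in> E.Aut" "\<sigma>' \<in> F.Aut" "\<And>z. \<sigma>' (to_ac z) = to_ac (\<sigma> z)" using l by (simp_all add: lifts_def)
  obtain \<rho> where r: "\<rho> \<in> E.Aut" "\<forall>f\<in>UNIV. \<rho> (\<sigma> f) = f" "\<forall>f\<in>UNIV. \<sigma> (\<rho> f) = f" using E.ex_inv_aut[OF s(1)] by blast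
  obtain \<rho>' where r': "\<rho>' \<in> F.Aut" "\<forall>f\<in>M. \<rho>' (\<sigma>' f) = f" "\<forall>f\<in>M. \<sigma>' (\<rho>' f) = f" using F.ex_inv_aut[OF s(2)] by blast
  have "\<rho>' (to_ac z) = to_ac (\<rho> z)" for z
  proof -
    have "\<sigma>' (to_ac (\<rho> z)) = to_ac z" using s(3)[of "\<rho> z"] r(3) by simp
    thus ?thesis using r'(2) to_ac_M by metis
  qed
  hence "lifts \<rho> \<rho>'" using r(1) r'(1) by (simp add: lifts_def)
  moreover have "\<rho> \<circ> \<sigma> = id" "\<sigma> \<circ> \<rho> = id" using r(2,3) by auto
  moreover have "\<sigma>' ` (\<rho>' ` P) = P" if P: "P \<in> F.Pl" for P
  proof -
    have "(\<lambda>f. \<sigma>' (\<rho>' f)) ` P = id ` P" by (rule F.image_cong_place[OF P]) (simp add: r'(3))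
    thus ?thesis by (simp add: image_image)
  qed
  ultimately show ?thesis by blast
qed

section \<open>Translations\<close>

text \<open>The condition in \<open>translation\<close>, with the sum of places replaced by the
  linear equivalence that characterises it.\<close>

definition "is_translation Q \<sigma> \<sigma>' \<longleftrightarrow> lifts \<sigma> \<sigma>' \<and> (\<forall>P\<in>F.Rat. F.leq (\<sigma>' ` P) F.\<O> P (lift Q))"

text \<open>By \<open>F.leq_unique\<close> the two extensions act alike on rational places above, so
  \<open>F.aut_eqI\<close> identifies them.\<close>

lemma is_translation_unique:
  assumes "is_translation Q \<sigma> \<sigma>'" "is_translation Q \<tau> \<tau>'" "Q \<in> E.Rat"
  shows "\<sigma> = \<tau>"
proof
  fix z
  have s: "\<sigma>' \<in> F.Aut" "\<sigma>' (to_ac z) = to_ac (\<sigma> z)" "\<forall>P\<in>F.Rat. F.leq (\<sigma>' ` P) F.\<O> P (lift Q)"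
    and t: "\<tau>' \<in> F.Aut" "\<tau>' (to_ac z) = to_ac (\<tau> z)" "\<forall>P\<in>F.Rat. F.leq (\<tau>' ` P) F.\<O> P (lift Q)"
    using assms by (simp_all add: is_translation_def lifts_def)
  have "\<sigma>' (to_ac z) = \<tau>' (to_ac z)"
  proof (rule F.aut_eqI[OF s(1) t(1) _ to_ac_M])
    fix P assume P: "P \<in> F.Rat"
    show "\<sigma>' ` P = \<tau>' ` P"
      by (rule F.leq_unique[OF F.image_rational[OF s(1) P] F.image_rational[OF t(1) P] bspec[OF s(3) P] bspec[OF t(3) P]])
  qed
  thus "\<sigma> z = \<tau> z" using s(2) t(2) by simp
qed

text \<open>The chord formulas are rational with coefficients in \<open>K\<close>, so they commute
  with \<open>to_ac\<close>: the translation constructed above at the lifted point extends the one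
  constructed below.\<close>

lemma ex_is_translation:
  assumes Q: "Q \<in> E.Rat"
  shows "\<exists>\<sigma> \<sigma>'. is_translation Q \<sigma> \<sigma>' \<and> \<sigma> ` E.\<O> = Q \<and> (\<forall>P\<in>E.Rat. E.leq (\<sigma> ` P) E.\<O> P Q)"
proof (cases "Q = E.\<O>")
  case True
  have 1: "F.leq (id ` P) F.\<O> P F.\<O>" for P
    unfolding F.leq_def using F.v_one[OF F.discrete] by (intro bexI[of _ 1]) simp_all
  have 2: "E.leq (id ` P) E.\<O> P E.\<O>" for P
    unfolding E.leq_def using E.v_one[OF E.discrete] by (intro bexI[of _ 1]) simp_all
  show ?thesis unfolding is_translation_def True lift_O using lifts_id 1 2
    by (intro exI[of _ id]) simp
next
  case False
  obtain a b where ab: "E.place_at Q a b" using E.rational_at_ex[OF Q False] by blast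
  have abK: "a \<in> K" "b \<in> K" using ab by (simp_all add: E.place_at_def)
  have abL: "to_ac a \<in> L" "to_ac b \<in> L" using abK to_ac_L by blast+
  note cE = E.at_curve(1)[OF ab]
  have cF: "to_ac b^2 + to_ac a1 * to_ac a * to_ac b + to_ac a3 * to_ac b = to_ac a^3 + to_ac a2 * to_ac a^2 + to_ac a4 * to_ac a + to_ac a6"
    using arg_cong[OF cE, of to_ac] by simp
  obtain \<tau> where t: "\<tau> \<in> E.Aut" "\<tau> x = E.chord_x a b" "\<tau> y = - E.chord_y a b - a1 * E.chord_x a b - a3"
    "E.place_at (\<tau> ` E.\<O>) a b" "\<forall>P\<in>E.Rat. E.leq (\<tau> ` P) E.\<O> P (\<tau> ` E.\<O>)"
    using E.ex_translation_at[OF abK cE] by blast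
  obtain \<tau>' where t': "\<tau>' \<in> F.Aut" "\<tau>' (to_ac x) = F.chord_x (to_ac a) (to_ac b)"
    "\<tau>' (to_ac y) = - F.chord_y (to_ac a) (to_ac b) - to_ac a1 * F.chord_x (to_ac a) (to_ac b) - to_ac a3"
    "F.place_at (\<tau>' ` F.\<O>) (to_ac a) (to_ac b)" "\<forall>P\<in>F.Rat. F.leq (\<tau>' ` P) F.\<O> P (\<tau>' ` F.\<O>)"
    using F.ex_translation_at[OF abL cF] by blast
  have z: "F.chord_z (to_ac a) (to_ac b) = to_ac (E.chord_z a b)"
    by (simp add: F.chord_z_def E.chord_z_def)
  have cx: "F.chord_x (to_ac a) (to_ac b) = to_ac (E.chord_x a b)"
    by (simp add: F.chord_x_def E.chord_x_def z)
  have cy: "F.chord_y (to_ac a) (to_ac b) = to_ac (E.chord_y a b)"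
    by (simp add: F.chord_y_def E.chord_y_def z cx)
  have "\<tau>' (to_ac z) = to_ac (\<tau> z)" for z
    by (rule lifts_if_agree[OF t(1) F.aut_hom[OF t'(1)] F.aut_K[OF t'(1)]]) (simp_all add: t(2,3) t'(2,3) cx cy)
  hence l: "lifts \<tau> \<tau>'" using t(1) t'(1) by (simp add: lifts_def)
  have Qe: "\<tau> ` E.\<O> = Q" by (rule E.at_unique[OF t(4) ab])
  have "lift Q = \<tau>' ` F.\<O>" using lifts_image[OF l E.O_rational] unfolding Qe lift_O .
  thus ?thesis unfolding is_translation_def using l Qe t(5) t'(5) by (intro exI[of _ \<tau>] exI[of _ \<tau>']) simp
qed

abbreviation "tr \<equiv> translation K x y"

lemma translation_eqI:
  assumes Q: "Q \<in> E.Rat" and t: "is_translation Q \<sigma> \<sigma>'"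
  shows "tr Q = \<sigma>"
proof -
  have iff: "(\<forall>P\<in>F.Rat. \<tau>' ` P = place_add L M F.\<O> P (lift Q)) \<longleftrightarrow> (\<forall>P\<in>F.Rat. F.leq (\<tau>' ` P) F.\<O> P (lift Q))"
    if "\<tau>' \<in> F.Aut" for \<tau>'
  proof (intro ball_cong refl)
    fix P assume P: "P \<in> F.Rat"
    show "\<tau>' ` P = place_add L M F.\<O> P (lift Q) \<longleftrightarrow> F.leq (\<tau>' ` P) F.\<O> P (lift Q)"
      using F.place_add(2)[OF P lift(1)[OF Q]] F.place_add_eqI[OF P lift(1)[OF Q] F.image_rational[OF that P]] by auto
  qed
  have O': "infinite_place L M (to_ac x) (to_ac y) = F.\<O>" by (simp add: F.\<O>_def)
  show ?thesis unfolding translation_def O'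
  proof (rule the_equality)
    have "lifts \<sigma> \<sigma>'" using t by (simp add: is_translation_def)
    hence s: "\<sigma> \<in> E.Aut" "\<sigma>' \<in> F.Aut" "\<forall>z. \<sigma>' (to_ac z) = to_ac (\<sigma> z)" by (simp_all add: lifts_def)
    moreover have "\<forall>P\<in>F.Rat. \<sigma>' ` P = place_add L M F.\<O> P (lift Q)" using iff[OF s(2)] t by (simp add: is_translation_def)
    ultimately show "\<sigma> \<in> E.Aut \<and> (\<exists>\<sigma>'\<in>F.Aut. (\<forall>z. \<sigma>' (to_ac z) = to_ac (\<sigma> z)) \<and>
        (\<forall>P\<in>F.Rat. \<sigma>' ` P = place_add L M F.\<O> P (lift Q)))" by blast
  next
    fix \<tau> assume "\<tau> \<in> E.Aut \<and> (\<exists>\<sigma>'\<in>F.Aut. (\<forall>z. \<sigma>' (to_ac z) = to_ac (\<tau> z)) \<and>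
        (\<forall>P\<in>F.Rat. \<sigma>' ` P = place_add L M F.\<O> P (lift Q)))"
    then obtain \<tau>' where t': "\<tau> \<in> E.Aut" "\<tau>' \<in> F.Aut" "\<forall>z. \<tau>' (to_ac z) = to_ac (\<tau> z)"
        "\<forall>P\<in>F.Rat. \<tau>' ` P = place_add L M F.\<O> P (lift Q)" by blast
    hence "is_translation Q \<tau> \<tau>'" using iff[OF t'(2)] by (simp add: is_translation_def lifts_def)
    thus "\<tau> = \<sigma>" using is_translation_unique t Q by blast
  qed
qed

lemma tr:
  assumes Q: "Q \<in> E.Rat"
  shows "\<exists>\<sigma>'. is_translation Q (tr Q) \<sigma>'" "tr Q ` E.\<O> = Q" "P \<in> E.Rat \<Longrightarrow> tr Q ` P = place_add K UNIV E.\<O> P Q"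
    "tr Q \<in> E.Aut"
proof -
  obtain \<sigma> \<sigma>' where s: "is_translation Q \<sigma> \<sigma>'" "\<sigma> ` E.\<O> = Q" "\<forall>P\<in>E.Rat. E.leq (\<sigma> ` P) E.\<O> P Q"
    using ex_is_translation[OF Q] by blast
  have e: "tr Q = \<sigma>" by (rule translation_eqI[OF Q s(1)])
  show "\<exists>\<sigma>'. is_translation Q (tr Q) \<sigma>'" "tr Q ` E.\<O> = Q" unfolding e by (intro exI[of _ \<sigma>'] s(1)) (rule s(2))
  show A: "tr Q \<in> E.Aut" using s(1) e by (simp add: is_translation_def lifts_def)
  show "tr Q ` P = place_add K UNIV E.\<O> P Q" if P: "P \<in> E.Rat"
    using E.place_add_eqI[OF P Q E.image_rational[OF A P]] s(3) P e by simp
qed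

lemma tr_O: "tr E.\<O> = id"
proof (rule translation_eqI[OF E.O_rational])
  have "F.leq (id ` P) F.\<O> P F.\<O>" for P
    unfolding F.leq_def using F.v_one[OF F.discrete] by (intro bexI[of _ 1]) simp_all
  thus "is_translation E.\<O> id id" unfolding is_translation_def lift_O using lifts_id by simp
qed

text \<open>The lift of the sum of \<open>P\<close> and \<open>Q\<close> is the translate of the
  lift of \<open>P\<close>, so \<open>F.leq_trans\<close> shows that the composite above has the
  property characterising the translation by the sum.\<close>

lemma tr_comp:
  assumes P: "P \<in> E.Rat" and Q: "Q \<in> E.Rat"
  shows "tr P \<circ> tr Q = tr (place_add K UNIV E.\<O> P Q)"
proof -
  define U where "U = place_add K UNIV E.\<O> P Q"
  have U: "U \<in> E.Rat" unfolding U_def by (rule E.place_add(1)[OF P Q])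
  obtain \<sigma>' where s: "is_translation P (tr P) \<sigma>'" using tr(1)[OF P] by blast
  obtain \<tau>' where t: "is_translation Q (tr Q) \<tau>'" using tr(1)[OF Q] by blast
  have ls: "lifts (tr P) \<sigma>'" "\<And>S. S \<in> F.Rat \<Longrightarrow> F.leq (\<sigma>' ` S) F.\<O> S (lift P)" using s by (simp_all add: is_translation_def)
  have lt: "lifts (tr Q) \<tau>'" "\<And>S. S \<in> F.Rat \<Longrightarrow> F.leq (\<tau>' ` S) F.\<O> S (lift Q)" using t by (simp_all add: is_translation_def)
  have "lift U = \<tau>' ` lift P" using lifts_image[OF lt(1) P] tr(3)[OF Q P] by (simp add: U_def)
  hence lU: "F.leq (lift U) F.\<O> (lift P) (lift Q)" using lt(2)[OF lift(1)[OF P]] by simp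
  have "is_translation U (tr P \<circ> tr Q) (\<sigma>' \<circ> \<tau>')" unfolding is_translation_def
  proof (intro conjI ballI)
    show "lifts (tr P \<circ> tr Q) (\<sigma>' \<circ> \<tau>')" by (rule lifts_comp[OF ls(1) lt(1)])
    fix S assume S: "S \<in> F.Rat"
    have tA: "\<tau>' \<in> F.Aut" using lt(1) by (simp add: lifts_def)
    have "F.leq (\<sigma>' ` (\<tau>' ` S)) F.\<O> S (lift U)"
      by (rule F.leq_trans[OF ls(2)[OF F.image_rational[OF tA S]] lt(2)[OF S] lU])
    thus "F.leq ((\<sigma>' \<circ> \<tau>') ` S) F.\<O> S (lift U)" by (simp add: image_comp)
  qed
  from translation_eqI[OF U this] show ?thesis by (simp add: U_def)
qed

lemma tr_conj:
  assumes a: "\<alpha> \<in> E.Aut" "\<alpha> ` E.\<O> = E.\<O>" and Q: "Q \<in> E.Rat"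
  shows "\<alpha> \<circ> tr Q = tr (\<alpha> ` Q) \<circ> \<alpha>"
proof -
  obtain \<alpha>' where la: "lifts \<alpha> \<alpha>'" using ex_lifts[OF a(1)] by blast
  have aA: "\<alpha>' \<in> F.Aut" using la by (simp add: lifts_def)
  obtain \<rho> \<rho>' where r: "lifts \<rho> \<rho>'" "\<rho> \<circ> \<alpha> = id" "\<alpha> \<circ> \<rho> = id" "\<forall>P\<in>F.Pl. \<alpha>' ` (\<rho>' ` P) = P"
    using ex_lift_inverse[OF la] by blast
  have rA: "\<rho>' \<in> F.Aut" using r(1) by (simp add: lifts_def)
  obtain \<tau>' where t: "is_translation Q (tr Q) \<tau>'" using tr(1)[OF Q] by blast
  have lt: "lifts (tr Q) \<tau>'" "\<And>S. S \<in> F.Rat \<Longrightarrow> F.leq (\<tau>' ` S) F.\<O> S (lift Q)" using t by (simp_all add: is_translation_def)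
  have tA: "\<tau>' \<in> F.Aut" using lt(1) by (simp add: lifts_def)
  have aO: "\<alpha>' ` F.\<O> = F.\<O>" using lifts_image[OF la E.O_rational] unfolding a(2) lift_O by simp
  have aQ: "\<alpha> ` Q \<in> E.Rat" by (rule E.image_rational[OF a(1) Q])
  have "is_translation (\<alpha> ` Q) (\<alpha> \<circ> (tr Q \<circ> \<rho>)) (\<alpha>' \<circ> (\<tau>' \<circ> \<rho>'))" unfolding is_translation_def
  proof (intro conjI ballI)
    show "lifts (\<alpha> \<circ> (tr Q \<circ> \<rho>)) (\<alpha>' \<circ> (\<tau>' \<circ> \<rho>'))" by (intro lifts_comp la lt(1) r(1))
    fix S assume S: "S \<in> F.Rat"
    have rS: "\<rho>' ` S \<in> F.Rat" by (rule F.image_rational[OF rA S])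
    have "F.leq (\<alpha>' ` (\<tau>' ` (\<rho>' ` S))) (\<alpha>' ` F.\<O>) (\<alpha>' ` (\<rho>' ` S)) (\<alpha>' ` lift Q)"
      by (intro F.leq_image[OF aA lt(2)[OF rS]] F.Rat_Pl F.image_rational[OF tA rS] F.O_rational rS lift(1)[OF Q])
    moreover have "\<alpha>' ` (\<rho>' ` S) = S" using r(4) F.Rat_Pl[OF S] by simp
    ultimately have "F.leq (\<alpha>' ` (\<tau>' ` (\<rho>' ` S))) F.\<O> S (lift (\<alpha> ` Q))"
      using aO lifts_image[OF la Q] by simp
    thus "F.leq ((\<alpha>' \<circ> (\<tau>' \<circ> \<rho>')) ` S) F.\<O> S (lift (\<alpha> ` Q))" by (simp only: image_comp comp_assoc)
  qed
  from translation_eqI[OF aQ this] have "tr (\<alpha> ` Q) \<circ> \<alpha> = \<alpha> \<circ> (tr Q \<circ> (\<rho> \<circ> \<alpha>))" by (simp add: comp_assoc)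
  thus ?thesis unfolding r(2) by simp
qed

section \<open>The semidirect product\<close>

abbreviation "G \<equiv> aut_group K"
abbreviation "T \<equiv> translation_group K x y"
abbreviation "H \<equiv> aut_stabilizer K x y"

lemma G_simps [simp]: "carrier G = E.Aut" "\<sigma> \<otimes>\<^bsub>G\<^esub> \<tau> = \<sigma> \<circ> \<tau>" "\<one>\<^bsub>G\<^esub> = id"
  by (simp_all add: aut_group_def)

lemma H_iff: "\<sigma> \<in> H \<longleftrightarrow> \<sigma> \<in> E.Aut \<and> \<sigma> ` E.\<O> = E.\<O>"
  by (simp add: aut_stabilizer_def E.\<O>_def)

lemma T_iff: "\<sigma> \<in> T \<longleftrightarrow> (\<exists>Q\<in>E.Rat. \<sigma> = tr Q)"
  by (auto simp: translation_group_def)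

lemma ex_inverse: "\<sigma> \<in> E.Aut \<Longrightarrow> \<exists>\<rho>\<in>E.Aut. \<rho> \<circ> \<sigma> = id \<and> \<sigma> \<circ> \<rho> = id"
  using E.ex_inv_aut[of \<sigma>] by (simp only: fun_eq_iff o_apply id_apply ball_UNIV)

lemma group_G: "group G"
proof (rule groupI, unfold G_simps)
  show "\<sigma> \<circ> \<tau> \<in> E.Aut" if "\<sigma> \<in> E.Aut" "\<tau> \<in> E.Aut" for \<sigma> \<tau> by (rule E.comp_aut[OF that])
  show "id \<in> E.Aut" by (rule E.id_aut)
  show "\<exists>\<rho>\<in>E.Aut. \<rho> \<circ> \<sigma> = id" if "\<sigma> \<in> E.Aut" for \<sigma> using ex_inverse[OF that] by blast
qed (simp_all only: comp_assoc id_comp)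

lemma G_inv: "\<sigma> \<in> E.Aut \<Longrightarrow> \<rho> \<in> E.Aut \<Longrightarrow> \<rho> \<circ> \<sigma> = id \<Longrightarrow> inv\<^bsub>G\<^esub> \<sigma> = \<rho>"
  using group.inv_equality[OF group_G, of \<rho> \<sigma>] by simp

text \<open>Let \<open>R\<close> be the image of \<O> under the inverse automorphism of
  \<open>tr P\<close>. Then \<open>tr P \<circ> tr R\<close> is a translation fixing \<O>, hence the
  identity.\<close>

lemma tr_inverse:
  assumes P: "P \<in> E.Rat" shows "\<exists>R\<in>E.Rat. tr P \<circ> tr R = id"
proof -
  obtain \<rho> where r: "\<rho> \<in> E.Aut" "\<rho> \<circ> tr P = id" "tr P \<circ> \<rho> = id" using ex_inverse[OF tr(4)[OF P]] by blast
  define R where "R = \<rho> ` E.\<O>"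
  have R: "R \<in> E.Rat" unfolding R_def by (rule E.image_rational[OF r(1) E.O_rational])
  have "tr (place_add K UNIV E.\<O> P R) ` E.\<O> = tr P ` (tr R ` E.\<O>)"
    unfolding tr_comp[OF P R, symmetric] by (rule image_comp[symmetric])
  also have "\<dots> = (tr P \<circ> \<rho>) ` E.\<O>" unfolding tr(2)[OF R] unfolding R_def by (rule image_comp)
  also have "\<dots> = E.\<O>" unfolding r(3) by simp
  finally have "place_add K UNIV E.\<O> P R = E.\<O>" using tr(2)[OF E.place_add(1)[OF P R]] by simp
  thus ?thesis using tr_comp[OF P R] tr_O R by (intro bexI[of _ R]) simp_all
qed

lemma subgroup_T: "subgroup T G"
proof (rule group.subgroupI[OF group_G])
  show "T \<subseteq> carrier G" using tr(4) by (auto simp: T_iff)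
  show "T \<noteq> {}" using E.O_rational T_iff by blast
  show "\<sigma> \<otimes>\<^bsub>G\<^esub> \<tau> \<in> T" if st: "\<sigma> \<in> T" "\<tau> \<in> T" for \<sigma> \<tau>
  proof -
    obtain P Q where "P \<in> E.Rat" "\<sigma> = tr P" "Q \<in> E.Rat" "\<tau> = tr Q" using st unfolding T_iff by blast
    thus ?thesis using tr_comp[of P Q] E.place_add(1)[of P Q] unfolding T_iff by auto
  qed
  show "inv\<^bsub>G\<^esub> \<sigma> \<in> T" if s: "\<sigma> \<in> T" for \<sigma>
  proof -
    obtain P where P: "P \<in> E.Rat" "\<sigma> = tr P" using s unfolding T_iff by blast
    obtain R where R: "R \<in> E.Rat" "tr P \<circ> tr R = id" using tr_inverse[OF P(1)] by blast
    have "inv\<^bsub>G\<^esub> (tr R) = tr P" by (rule G_inv[OF tr(4)[OF R(1)] tr(4)[OF P(1)] R(2)])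
    hence "inv\<^bsub>G\<^esub> \<sigma> = tr R" using group.inv_inv[OF group_G, of "tr R"] tr(4)[OF R(1)] P(2) by simp
    thus ?thesis using R(1) T_iff by blast
  qed
qed

lemma subgroup_H: "subgroup H G"
proof (rule group.subgroupI[OF group_G])
  show "H \<subseteq> carrier G" by (auto simp: H_iff)
  have "id \<in> H" using E.id_aut by (simp add: H_iff)
  thus "H \<noteq> {}" by blast
  show "\<sigma> \<otimes>\<^bsub>G\<^esub> \<tau> \<in> H" if "\<sigma> \<in> H" "\<tau> \<in> H" for \<sigma> \<tau>
    using that E.comp_aut[of \<sigma> \<tau>] by (simp only: H_iff G_simps image_comp[symmetric] simp_thms)
  show "inv\<^bsub>G\<^esub> \<sigma> \<in> H" if s: "\<sigma> \<in> H" for \<sigma>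
  proof -
    have A: "\<sigma> \<in> E.Aut" "\<sigma> ` E.\<O> = E.\<O>" using s by (simp_all add: H_iff)
    obtain \<rho> where r: "\<rho> \<in> E.Aut" "\<rho> \<circ> \<sigma> = id" using ex_inverse[OF A(1)] by blast
    have "\<rho> ` E.\<O> = \<rho> ` (\<sigma> ` E.\<O>)" unfolding A(2) ..
    also have "\<dots> = E.\<O>" unfolding image_comp r(2) by simp
    finally have "\<rho> \<in> H" using r(1) by (simp add: H_iff)
    thus ?thesis using G_inv[OF A(1) r] by simp
  qed
qed

text \<open>Take \<open>P\<close> to be the image of \<O> under \<sigma>; undoing
  \<open>tr P\<close> brings it back to \<O>.\<close>

lemma decomposition:
  assumes "\<sigma> \<in> E.Aut" shows "\<exists>P\<in>E.Rat. \<exists>\<alpha>\<in>H. \<sigma> = tr P \<circ> \<alpha>"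
proof -
  define P where "P = \<sigma> ` E.\<O>"
  have P: "P \<in> E.Rat" unfolding P_def by (rule E.image_rational[OF assms E.O_rational])
  obtain \<rho> where r: "\<rho> \<in> E.Aut" "\<rho> \<circ> tr P = id" "tr P \<circ> \<rho> = id" using ex_inverse[OF tr(4)[OF P]] by blast
  have "(\<rho> \<circ> \<sigma>) ` E.\<O> = \<rho> ` (tr P ` E.\<O>)" unfolding tr(2)[OF P] unfolding P_def by (rule image_comp[symmetric])
  also have "\<dots> = E.\<O>" unfolding image_comp r(2) by simp
  finally have "\<rho> \<circ> \<sigma> \<in> H" using E.comp_aut[OF r(1) assms] by (simp add: H_iff)
  moreover have "\<sigma> = tr P \<circ> (\<rho> \<circ> \<sigma>)" unfolding comp_assoc[symmetric] r(3) by simp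
  ultimately show ?thesis using P by blast
qed

lemma normal_T: "T \<lhd> G"
  unfolding group.normal_inv_iff[OF group_G]
proof (intro conjI ballI subgroup_T)
  fix \<sigma> \<tau> assume st: "\<sigma> \<in> carrier G" "\<tau> \<in> T"
  obtain Q where Q: "Q \<in> E.Rat" "\<tau> = tr Q" using st(2) T_iff by blast
  obtain P \<alpha> where P: "P \<in> E.Rat" "\<alpha> \<in> H" "\<sigma> = tr P \<circ> \<alpha>" using decomposition[of \<sigma>] st(1) by auto
  have a: "\<alpha> \<in> E.Aut" "\<alpha> ` E.\<O> = E.\<O>" using P(2) by (simp_all add: H_iff)
  have PT: "tr P \<in> T" using P(1) T_iff by blast
  have "\<alpha> ` Q \<in> E.Rat" by (rule E.image_rational[OF a(1) Q(1)])
  hence QT: "tr (\<alpha> ` Q) \<in> T" using T_iff by blast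
  have sub: "tr P \<in> carrier G" "tr (\<alpha> ` Q) \<in> carrier G" "\<alpha> \<in> carrier G" "tr Q \<in> carrier G"
    using tr(4) P(1) Q(1) a(1) \<open>\<alpha> ` Q \<in> E.Rat\<close> by simp_all
  have "\<sigma> \<otimes>\<^bsub>G\<^esub> \<tau> = (tr P \<otimes>\<^bsub>G\<^esub> tr (\<alpha> ` Q)) \<otimes>\<^bsub>G\<^esub> \<alpha>"
    using tr_conj[OF a Q(1)] by (simp add: P(3) Q(2) comp_assoc)
  moreover have "\<sigma> = tr P \<otimes>\<^bsub>G\<^esub> \<alpha>" using P(3) by simp
  ultimately have "\<sigma> \<otimes>\<^bsub>G\<^esub> \<tau> \<otimes>\<^bsub>G\<^esub> inv\<^bsub>G\<^esub> \<sigma> = tr P \<otimes>\<^bsub>G\<^esub> tr (\<alpha> ` Q) \<otimes>\<^bsub>G\<^esub> \<alpha> \<otimes>\<^bsub>G\<^esub> (inv\<^bsub>G\<^esub> \<alpha> \<otimes>\<^bsub>G\<^esub> inv\<^bsub>G\<^esub> (tr P))"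
    using group.inv_mult_group[OF group_G sub(1,3)] by simp
  also have "\<dots> = tr P \<otimes>\<^bsub>G\<^esub> tr (\<alpha> ` Q) \<otimes>\<^bsub>G\<^esub> inv\<^bsub>G\<^esub> (tr P)"
  proof -
    have m: "u \<otimes>\<^bsub>G\<^esub> w \<otimes>\<^bsub>G\<^esub> (inv\<^bsub>G\<^esub> w \<otimes>\<^bsub>G\<^esub> t) = u \<otimes>\<^bsub>G\<^esub> t"
      if c: "u \<in> carrier G" "w \<in> carrier G" "t \<in> carrier G" for u w t
    proof -
      have "u \<otimes>\<^bsub>G\<^esub> w \<otimes>\<^bsub>G\<^esub> (inv\<^bsub>G\<^esub> w \<otimes>\<^bsub>G\<^esub> t) = u \<otimes>\<^bsub>G\<^esub> (w \<otimes>\<^bsub>G\<^esub> inv\<^bsub>G\<^esub> w) \<otimes>\<^bsub>G\<^esub> t" by (simp add: comp_assoc)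
      thus ?thesis using group.r_inv[OF group_G c(2)] by simp
    qed
    show ?thesis by (rule m[OF monoid.m_closed[OF group.is_monoid[OF group_G] sub(1,2)] sub(3) group.inv_closed[OF group_G sub(1)]])
  qed
  also have "\<dots> \<in> T"
    by (intro subgroup.m_closed[OF subgroup_T] subgroup.m_inv_closed[OF subgroup_T] PT QT)
  finally show "\<sigma> \<otimes>\<^bsub>G\<^esub> \<tau> \<otimes>\<^bsub>G\<^esub> inv\<^bsub>G\<^esub> \<sigma> \<in> T" .
qed

lemma semidirect: "internal_semidirect_product G T H"
  unfolding internal_semidirect_product_def
proof (intro conjI normal_T subgroup_H group_G)
  show "T <#>\<^bsub>G\<^esub> H = carrier G"
  proof
    show "T <#>\<^bsub>G\<^esub> H \<subseteq> carrier G"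
      by (rule group.setmult_subset_G[OF group_G subgroup.subset[OF subgroup_T] subgroup.subset[OF subgroup_H]])
    show "carrier G \<subseteq> T <#>\<^bsub>G\<^esub> H"
    proof
      fix \<sigma> assume "\<sigma> \<in> carrier G"
      then obtain P \<alpha> where P: "P \<in> E.Rat" "\<alpha> \<in> H" "\<sigma> = tr P \<circ> \<alpha>" using decomposition[of \<sigma>] by auto
      have "tr P \<in> T" using P(1) T_iff by blast
      thus "\<sigma> \<in> T <#>\<^bsub>G\<^esub> H" unfolding set_mult_def using P(2,3) by auto
    qed
  qed
  show "T \<inter> H = {\<one>\<^bsub>G\<^esub>}"
  proof
    show "T \<inter> H \<subseteq> {\<one>\<^bsub>G\<^esub>}"
    proof
      fix \<sigma> assume s: "\<sigma> \<in> T \<inter> H"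
      then obtain P where P: "P \<in> E.Rat" "\<sigma> = tr P" using T_iff by blast
      have "P = E.\<O>" using s tr(2)[OF P(1)] P(2) by (simp add: H_iff)
      thus "\<sigma> \<in> {\<one>\<^bsub>G\<^esub>}" using P(2) tr_O by simp
    qed
    show "{\<one>\<^bsub>G\<^esub>} \<subseteq> T \<inter> H"
      using subgroup.one_closed[OF subgroup_T] subgroup.one_closed[OF subgroup_H] by simp
  qed
qed

lemma group_law:
  assumes "P \<in> E.Rat" "Q \<in> E.Rat" "\<alpha> \<in> H"
  shows "(tr P \<circ> \<alpha>) \<circ> (tr Q \<circ> \<beta>) = tr (place_add K UNIV E.\<O> P (\<alpha> ` Q)) \<circ> (\<alpha> \<circ> \<beta>)"
proof -
  have a: "\<alpha> \<in> E.Aut" "\<alpha> ` E.\<O> = E.\<O>" using assms(3) by (simp_all add: H_iff)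
  have aQ: "\<alpha> ` Q \<in> E.Rat" by (rule E.image_rational[OF a(1) assms(2)])
  have "(tr P \<circ> \<alpha>) \<circ> (tr Q \<circ> \<beta>) = tr P \<circ> (\<alpha> \<circ> tr Q) \<circ> \<beta>" by (simp only: comp_assoc)
  also have "\<dots> = (tr P \<circ> tr (\<alpha> ` Q)) \<circ> (\<alpha> \<circ> \<beta>)" unfolding tr_conj[OF a assms(2)] by (simp only: comp_assoc)
  finally show ?thesis unfolding tr_comp[OF assms(1) aQ] .
qed

end

theorem theorem3p1:
  fixes K :: "'e::field set" and x y :: 'e
  assumes "elliptic_function_field K x y"
  shows "internal_semidirect_product (aut_group K) (translation_group K x y) (aut_stabilizer K x y)
    \<and> (\<forall>P \<in> rat_places_E K. \<forall>Q \<in> rat_places_E K.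
        \<forall>\<alpha> \<in> aut_stabilizer K x y. \<forall>\<beta> \<in> aut_stabilizer K x y.
          (translation K x y P \<otimes>\<^bsub>aut_group K\<^esub> \<alpha>) \<otimes>\<^bsub>aut_group K\<^esub> (translation K x y Q \<otimes>\<^bsub>aut_group K\<^esub> \<beta>)
            = translation K x y (add_E K x y P (\<alpha> ` Q)) \<otimes>\<^bsub>aut_group K\<^esub> (\<alpha> \<otimes>\<^bsub>aut_group K\<^esub> \<beta>))"
proof -
  obtain a1 a2 a3 a4 a6 where a: "a1 \<in> K" "a2 \<in> K" "a3 \<in> K" "a4 \<in> K" "a6 \<in> K"
     "nonsingular_weierstrass K a1 a2 a3 a4 a6" "y^2 + a1 * x * y + a3 * y = x^3 + a2 * x^2 + a4 * x + a6"
    using assms unfolding elliptic_function_field_def by blast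
  have K: "set_field K" "finite K" "generate_field ring_of_type_algebra (K \<union> {x, y}) = UNIV"
    using assms by (simp_all add: elliptic_function_field_def subfield_rta_iff)
  have "\<not> alg K x" using assms algebraic_rta_iff[OF K(1)] by (simp add: elliptic_function_field_def)
  then interpret elliptic K x y a1 a2 a3 a4 a6 using a K by unfold_locales
  have inf: "inf_E K x y = E.\<O>" by (simp add: E.\<O>_def)
  show ?thesis unfolding inf G_simps by (intro conjI ballI semidirect group_law)
qed

end
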